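(* Let $\Omega\subset\mathbb{R}^n$ be open and bounded. If $u\in\mathrm{USC}(\overline\Omega)$ is locally semiconvex on $\Omega$, then $$\sup_{\overline\Omega}u\leq\sup_{\partial\Omega}u+\frac{\mathrm{diam}(\Omega)}{\omega_n^{1/n}}\biggl(\int_{E(u)}|\det D^2u(x)|\,dx\biggr)^{1/n},$$ where $\omega_n=|B_1|$ is the Lebesgue measure of the unit ball of $\mathbb{R}^n$ and $$E(u)=\mathcal{C}^+(u,\Omega,0)\cap\mathrm{Diff}^2u$$ is the set of all flat global upper contact points of $u$ on $\Omega$ at which $u$ is twice differentiable.
   Context: $\mathrm{USC}(\overline\Omega)$ is the set of upper semicontinuous functions on $\overline\Omega$ with values in $[-\infty,+\infty)$. A function is $\lambda$-semiconvex ($\lambda\ge0$) on a convex set if adding $\frac{\lambda}{2}|\cdot|^2$ makes it convex (and real-valued) there; $u$ is locally semiconvex on $\Omega$ if every $x\in\Omega$ belongs to some ball $B\subset\Omega$ on which $u$ is $\lambda$-semiconvex for some $\lambda=\lambda(x)\geq0$. $\mathcal{C}^+(u,\Omega,0)=\{x\in\Omega:\ \exists\,p\in\mathbb{R}^n\text{ such that }u(y)\leq u(x)+\langle p,y-x\rangle\ \forall\,y\in\Omega\}$. $\mathrm{Diff}^2u$ is the set of $x\in\Omega$ at which $u$ is twice differentiable in the Peano sense: $u(y)=u(x)+\langle q,y-x\rangle+\frac12\langle A(y-x),y-x\rangle+o(|y-x|^2)$ as $y\to x$ for some $q\in\mathbb{R}^n$ and symmetric $A$, in which case $D^2u(x)=A$.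 *)

theory Defs
  imports "HOL-Analysis.Analysis" "HOL-Library.Landau_Symbols"
begin

definition USC :: "'a::topological_space set \<Rightarrow> ('a \<Rightarrow> ereal) set" where
  "USC S = {u. (\<forall>x\<in>S. u x < \<infinity>) \<and>
               (\<forall>x\<in>S. \<forall>c. u x < c \<longrightarrow> (\<forall>\<^sub>F y in at x within S. u y < c))}"

definition semiconvex_on :: "real \<Rightarrow> 'a::real_normed_vector set \<Rightarrow> ('a \<Rightarrow> ereal) \<Rightarrow> bool" where
  "semiconvex_on l S u \<longleftrightarrow>
     (\<forall>x\<in>S. \<bar>u x\<bar> \<noteq> \<infinity>) \<and> convex_on S (\<lambda>x. real_of_ereal (u x) + l / 2 * (norm x)\<^sup>2)"

definition locally_semiconvex_on :: "'a::real_normed_vector set \<Rightarrow> ('a \<Rightarrow> ereal) \<Rightarrow> bool" where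
  "locally_semiconvex_on \<Omega> u \<longleftrightarrow>
     (\<forall>x\<in>\<Omega>. \<exists>z r l. x \<in> ball z r \<and> ball z r \<subseteq> \<Omega> \<and> l \<ge> 0 \<and> semiconvex_on l (ball z r) u)"

definition flat_upper_contact :: "'a::real_inner set \<Rightarrow> ('a \<Rightarrow> ereal) \<Rightarrow> 'a set" where
  "flat_upper_contact \<Omega> u =
     {x \<in> \<Omega>. \<exists>p. \<forall>y\<in>\<Omega>. u y \<le> u x + ereal (p \<bullet> (y - x))}"

definition peano_expansion ::
    "(real^'n \<Rightarrow> real) \<Rightarrow> real^'n \<Rightarrow> real^'n \<Rightarrow> real^'n^'n \<Rightarrow> bool" where
  "peano_expansion v x q A \<longleftrightarrow>
     transpose A = A \<and>
     (\<lambda>y. v y - (v x + q \<bullet> (y - x) + 1 / 2 * ((A *v (y - x)) \<bullet> (y - x))))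
       \<in> o[at x](\<lambda>y. (norm (y - x))\<^sup>2)"

lemma peano_expansion_unique:
  fixes A A' :: "real^'n^'n"
  assumes "peano_expansion v x q A" and "peano_expansion v x q' A'"
  shows "A = A'"
proof -
  define B where "B = A' - A"
  define d where "d = q' - q"
  have sym: "transpose B = B"
    using assms by (simp add: peano_expansion_def B_def transpose_def vec_eq_iff)
  have o1: "(\<lambda>y. d \<bullet> (y - x) + 1 / 2 * ((B *v (y - x)) \<bullet> (y - x))) \<in> o[at x](\<lambda>y. (norm (y - x))\<^sup>2)"
  proof -
    have "(\<lambda>y. (v y - (v x + q \<bullet> (y - x) + 1 / 2 * ((A *v (y - x)) \<bullet> (y - x)))) -
               (v y - (v x + q' \<bullet> (y - x) + 1 / 2 * ((A' *v (y - x)) \<bullet> (y - x)))))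
            \<in> o[at x](\<lambda>y. (norm (y - x))\<^sup>2)"
      by (rule sum_in_smallo(2)) (use assms in \<open>simp_all only: peano_expansion_def\<close>)
    then show ?thesis
      by (simp add: B_def d_def algebra_simps inner_diff_left matrix_vector_mult_diff_rdistrib
          cong: landau_o.small.cong)
  qed
  have key: "d \<bullet> w = 0 \<and> (B *v w) \<bullet> w = 0" for w
  proof (cases "w = 0")
    case False
    have flim: "filterlim (\<lambda>t. x + t *\<^sub>R w) (at x) (at_right (0::real))"
      unfolding filterlim_at
    proof
      show "\<forall>\<^sub>F t in at_right 0. x + t *\<^sub>R w \<in> UNIV \<and> x + t *\<^sub>R w \<noteq> x"
        using False by (auto simp: eventually_at_filter)
      have "((\<lambda>t. x + t *\<^sub>R w) \<longlongrightarrow> x + 0 *\<^sub>R w) (at_right 0)"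
        by (intro tendsto_intros)
      then show "((\<lambda>t. x + t *\<^sub>R w) \<longlongrightarrow> x) (at_right 0)" by simp
    qed
    have "((\<lambda>y. (d \<bullet> (y - x) + 1 / 2 * ((B *v (y - x)) \<bullet> (y - x))) / (norm (y - x))\<^sup>2) \<longlongrightarrow> 0) (at x)"
      by (rule smalloD_tendsto[OF o1])
    from filterlim_compose[OF this flim]
    have "((\<lambda>t. (t * (d \<bullet> w) + 1 / 2 * (t * t * ((B *v w) \<bullet> w))) / (t\<^sup>2 * (norm w)\<^sup>2)) \<longlongrightarrow> 0) (at_right (0::real))"
      by (simp add: power_mult_distrib matrix_vector_mult_scaleR
          mult.assoc)
    from tendsto_mult_right[OF this, of "(norm w)\<^sup>2"]
    have l: "((\<lambda>t. (norm w)\<^sup>2 * ((t * (d \<bullet> w) + 1 / 2 * (t * t * ((B *v w) \<bullet> w))) / (t\<^sup>2 * (norm w)\<^sup>2)))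
             \<longlongrightarrow> 0) (at_right (0::real))"
      by (simp add: mult.commute)
    have l2: "((\<lambda>t. (d \<bullet> w) / t + 1 / 2 * ((B *v w) \<bullet> w)) \<longlongrightarrow> 0) (at_right (0::real))"
      by (rule Lim_transform_eventually[OF l])
         (use False in \<open>auto simp: eventually_at_filter field_simps power2_eq_square\<close>)
    have id: "((\<lambda>t::real. t) \<longlongrightarrow> 0) (at_right 0)" by (intro tendsto_intros)
    from tendsto_mult[OF id l2]
    have l3: "((\<lambda>t. t * ((d \<bullet> w) / t + 1 / 2 * ((B *v w) \<bullet> w))) \<longlongrightarrow> 0) (at_right (0::real))"
      by simp
    have "((\<lambda>t. d \<bullet> w + t * (1 / 2 * ((B *v w) \<bullet> w))) \<longlongrightarrow> 0) (at_right (0::real))"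
      by (rule Lim_transform_eventually[OF l3]) (auto simp: eventually_at_filter field_simps)
    moreover have "((\<lambda>t. d \<bullet> w + t * (1 / 2 * ((B *v w) \<bullet> w))) \<longlongrightarrow> d \<bullet> w + 0 * (1 / 2 * ((B *v w) \<bullet> w)))
        (at_right (0::real))"
      by (intro tendsto_intros)
    ultimately have d0: "d \<bullet> w = 0"
      using tendsto_unique trivial_limit_at_right_real by fastforce
    with l2 have "((\<lambda>t::real. 1 / 2 * ((B *v w) \<bullet> w)) \<longlongrightarrow> 0) (at_right 0)" by simp
    then have "(B *v w) \<bullet> w = 0"
      by (simp add: tendsto_const_iff)
    with d0 show ?thesis by simp
  qed simp
  have bil: "(B *v z) \<bullet> w = 0" for z w
  proof -
    have "(B *v z) \<bullet> w = (B *v w) \<bullet> z"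
      by (metis dot_lmul_matrix inner_commute sym transpose_matrix_vector)
    moreover have "(B *v (z + w)) \<bullet> (z + w) = 0" "(B *v z) \<bullet> z = 0" "(B *v w) \<bullet> w = 0"
      using key by auto
    ultimately show ?thesis
      by (simp add: matrix_vector_right_distrib inner_add_left inner_add_right)
  qed
  have "B *v z = 0" for z
    using bil[of z "B *v z"] by simp
  then have "B = 0" by (simp add: matrix_eq)
  then show ?thesis by (simp add: B_def)
qed

definition peano_hessian :: "(real^'n \<Rightarrow> real) \<Rightarrow> real^'n \<Rightarrow> real^'n^'n" where
  "peano_hessian v x = (THE A. \<exists>q. peano_expansion v x q A)"

lemma peano_hessian_eq:
  assumes "peano_expansion v x q A"
  shows "peano_hessian v x = A"
  unfolding peano_hessian_def
  using assms by (blast intro: the_equality peano_expansion_unique)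

(* Finiteness of u near x keeps real_of_ereal from replacing infinite values by 0. *)
definition Diff2 :: "(real^'n) set \<Rightarrow> (real^'n \<Rightarrow> ereal) \<Rightarrow> (real^'n) set" where
  "Diff2 \<Omega> u =
     {x \<in> \<Omega>. (\<forall>\<^sub>F y in nhds x. \<bar>u y\<bar> \<noteq> \<infinity>) \<and>
            (\<exists>q A. peano_expansion (\<lambda>y. real_of_ereal (u y)) x q A)}"

definition D2 :: "(real^'n \<Rightarrow> ereal) \<Rightarrow> real^'n \<Rightarrow> real^'n^'n" where
  "D2 u = peano_hessian (\<lambda>y. real_of_ereal (u y))"

definition ennreal_root :: "nat \<Rightarrow> ennreal \<Rightarrow> ennreal" where
  "ennreal_root n a = (if a = \<infinity> then \<infinity> else ennreal (root n (enn2real a)))"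

end

theory Submission
  imports Defs
begin

text \<open>
  The estimate is a comparison of measures in the space of slopes. Let \<open>u\<close> at a point of \<open>\<Omega>\<close> exceed
  its boundary supremum by more than \<open>\<delta> diameter \<Omega>\<close>. Every affine function with slope \<open>p\<close>, \<open>norm p \<le> \<delta>\<close>, can be
  lowered until it touches the graph of \<open>u\<close> from above, and the contact takes place inside \<open>\<Omega>\<close>
  (\<open>contact_point_exists\<close>). Hence the ball of radius \<open>\<delta>\<close> consists of slopes at contact points, and its
  volume \<open>\<omega> \<delta>\<^sup>n\<close> is at most the measure of the image of the contact set under the slope map.

  At a contact point the upper bound by an affine function and the lower bound from semiconvexity
  control \<open>u\<close> quadratically from both sides. Therefore the slope map is single-valued and locally
  Lipschitz (\<open>touches_slope_close\<close>), and where \<open>u\<close> has a Peano expansion its derivative relative to the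
  contact set is the matrix \<open>D2 u\<close> (\<open>touches_slope_peano\<close>). Contact points without such an expansion
  form a null set by Alexandrov's theorem and have a null set of slopes; the other ones contribute at most
  the integral of \<open>\<bar>det (D2 u)\<bar>\<close> (\<open>area_inequality\<close>). Together, \<open>\<omega> \<delta>\<^sup>n\<close> is at most the integral
  (\<open>contact_slopes_measure\<close>), and letting \<open>\<delta>\<close> grow gives the theorem.

  Most of the work is Alexandrov's theorem that a convex function \<open>f\<close> has a second-order Peano
  expansion almost everywhere (\<open>alexandrov_convex\<close>). On a line, \<open>f\<close> has monotone subgradients, which are
  differentiable almost everywhere by Lebesgue's theorem (\<open>mono_on_differentiable_ae\<close>). Fubini's theorem
  yields, at almost every point, second-order expansions along all integer directions at once, with
  second derivatives \<open>q e\<close>. That \<open>q\<close> is a quadratic form amounts to the parallelogram law, whose defect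
  is the limit of an iterated second difference; such a limit vanishes almost everywhere because almost
  everywhere convergent functions change little, in mean, under small shifts
  (\<open>convex_parallelogram_ae\<close>). Finally, for convex functions convergence along a dense set of
  directions is automatically locally uniform, so the directional expansions combine into a Peano
  expansion (\<open>convex_peano_at_point\<close>).
\<close>

section \<open>Monotone functions of one variable are differentiable almost everywhere\<close>

text \<open>The Vitali covering theorem for nondegenerate intervals that may have the covered point as an
  end point. Passing to the open intervals loses only countably many end points; openness is what
  allows a second covering to be nested inside the first.\<close>

lemma vitali_intervals:
  fixes P :: "real \<Rightarrow> real \<Rightarrow> bool"
  assumes cov: "\<And>x d. x \<in> E \<Longrightarrow> 0 < d \<Longrightarrow> \<exists>a b. a < b \<and> a \<le> x \<and> x \<le> b \<and> b - a < d \<and> P a b"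
  obtains C where "countable C" "\<And>a b. (a, b) \<in> C \<Longrightarrow> a < b \<and> P a b"
    "disjoint_family_on (\<lambda>(a, b). {a..b}) C"
    "negligible (E - (\<Union>(a, b)\<in>C. {a<..<b}))"
proof -
  define mid where "mid = (\<lambda>(a, b). (a + b) / 2 :: real)"
  define rad where "rad = (\<lambda>(a, b). (b - a) / 2 :: real)"
  define K where "K = {(a, b). a < b \<and> P a b}"
  have cb: "cball (mid i) (rad i) = (case i of (a, b) \<Rightarrow> {a..b})" for i
    by (cases i) (auto simp: mid_def rad_def cball_eq_atLeastAtMost field_simps)
  have r: "0 < rad i" if "i \<in> K" for i
    using that by (auto simp: K_def rad_def)
  have c: "\<exists>i. i \<in> K \<and> x \<in> cball (mid i) (rad i) \<and> rad i < d" if "x \<in> E" "0 < d" for x d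
  proof -
    from cov[OF that] obtain a b where "a < b" "a \<le> x" "x \<le> b" "b - a < d" "P a b" by blast
    moreover from this have "x \<in> cball (mid (a, b)) (rad (a, b))" unfolding cb by simp
    ultimately show ?thesis
      by (intro exI[of _ "(a, b)"]) (auto simp: K_def rad_def)
  qed
  obtain C where C: "countable C" "C \<subseteq> K"
     "pairwise (\<lambda>i j. disjnt (cball (mid i) (rad i)) (cball (mid j) (rad j))) C"
     "negligible (E - (\<Union>i\<in>C. cball (mid i) (rad i)))"
    using Vitali_covering_theorem_cballs[of K rad E mid, OF r c] by blast
  show thesis
  proof (rule that[of C])
    show "countable C" by fact
    show "a < b \<and> P a b" if "(a, b) \<in> C" for a b
      using that C(2) by (auto simp: K_def)
    show "disjoint_family_on (\<lambda>(a, b). {a..b}) C"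
      using C(3) unfolding disjoint_family_on_def pairwise_def disjnt_def cb by blast
    have "countable (fst ` C \<union> snd ` C)"
      using C(1) by auto
    then have "negligible (fst ` C \<union> snd ` C)"
      by (simp add: negligible_iff_null_sets countable_imp_null_set_lborel null_sets_completionI)
    with C(4) have "negligible ((E - (\<Union>i\<in>C. cball (mid i) (rad i))) \<union> (fst ` C \<union> snd ` C))"
      by (rule negligible_Un)
    then show "negligible (E - (\<Union>(a, b)\<in>C. {a<..<b}))"
      by (rule negligible_subset) (force simp: cb)
  qed
qed

lemma disjoint_family_mono_images:
  fixes F :: "real \<Rightarrow> real"
  assumes "mono_on I F" and "\<And>a b. (a, b) \<in> C \<Longrightarrow> a < b \<and> {a..b} \<subseteq> I"
    and "disjoint_family_on (\<lambda>(a, b). {a..b}) C"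
  shows "disjoint_family_on (\<lambda>(a, b). {F a..<F b}) C"
  unfolding disjoint_family_on_def
proof (intro ballI impI)
  fix i j assume ij: "i \<in> C" "j \<in> C" "i \<noteq> j"
  obtain a b c d where eq: "i = (a, b)" "j = (c, d)" by (cases i, cases j) auto
  have ab: "a < b" "c < d" "{a..b} \<subseteq> I" "{c..d} \<subseteq> I" using ij assms(2) eq by auto
  have "(case i of (a, b) \<Rightarrow> {a..b}) \<inter> (case j of (a, b) \<Rightarrow> {a..b}) = {}"
    using assms(3) ij unfolding disjoint_family_on_def by blast
  then have "{a..b} \<inter> {c..d} = {}"
    by (simp add: eq)
  then have "max a c \<notin> {a..b} \<inter> {c..d}" by blast
  then have "b < c \<or> d < a"
    using ab by (auto simp: max_def not_le split: if_splits)
  then have "F b \<le> F c \<or> F d \<le> F a"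
  proof
    assume "b < c"
    then have "F b \<le> F c" using ab by (intro mono_onD[OF assms(1)]) (auto simp: subset_eq)
    then show ?thesis ..
  next
    assume "d < a"
    then have "F d \<le> F a" using ab by (intro mono_onD[OF assms(1)]) (auto simp: subset_eq)
    then show ?thesis ..
  qed
  then show "(case i of (a, b) \<Rightarrow> {F a..<F b}) \<inter> (case j of (a, b) \<Rightarrow> {F a..<F b}) = {}"
    by (auto simp: eq)
qed

lemma disjoint_family_half_open:
  fixes C :: "(real \<times> real) set"
  assumes "disjoint_family_on (\<lambda>(a, b). {a..b}) C"
  shows "disjoint_family_on (\<lambda>(a, b). {a..<b}) C"
proof -
  have "(case i of (a, b) \<Rightarrow> {a..<b}) \<subseteq> (case i of (a, b) \<Rightarrow> {a..b})" for i :: "real \<times> real"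
    by (cases i) auto
  then show ?thesis
    using assms unfolding disjoint_family_on_def by blast
qed

lemma emeasure_Union_intervals:
  fixes C :: "(real \<times> real) set" and u v :: "real \<Rightarrow> real \<Rightarrow> real"
  assumes "countable C" and "\<And>a b. (a, b) \<in> C \<Longrightarrow> u a b \<le> v a b"
    and "disjoint_family_on (\<lambda>(a, b). {u a b..<v a b}) C"
  shows "emeasure lebesgue (\<Union>(a, b)\<in>C. {u a b..<v a b})
           = (\<integral>\<^sup>+(a, b). ennreal (v a b - u a b) \<partial>count_space C)"
proof -
  have "emeasure lebesgue (\<Union>(a, b)\<in>C. {u a b..<v a b})
      = (\<integral>\<^sup>+i. emeasure lebesgue (case i of (a, b) \<Rightarrow> {u a b..<v a b}) \<partial>count_space C)"
    by (rule emeasure_UN_countable) (use assms in auto)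
  also have "\<dots> = (\<integral>\<^sup>+(a, b). ennreal (v a b - u a b) \<partial>count_space C)"
    by (rule nn_integral_cong) (use assms(2) in auto)
  finally show ?thesis .
qed

lemma quotient_on_interval:
  fixes F :: "real \<Rightarrow> real"
  assumes "y \<noteq> x"
  shows "(F (max x y) - F (min x y)) / (max x y - min x y) = (F y - F x) / (y - x)"
  using minus_divide_divide[of "F y - F x" "y - x"] by (cases "x \<le> y") (simp_all add: max_def min_def)

text \<open>Cover \<open>E\<close> once more by disjoint intervals on which \<open>F\<close> grows faster than \<open>\<beta>\<close> times the length
  and which lie inside members of the given family. Instead of summing increments, one measures the
  intervals between the values of \<open>F\<close> at the end points: these are disjoint because \<open>F\<close> is monotone, and the ones
  coming from the finer family lie in the ones coming from the coarser family. No measurability of the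
  exceptional set is known at this stage, hence the outer measure.\<close>

lemma mono_steep_cover:
  fixes F :: "real \<Rightarrow> real"
  assumes mono: "mono_on I F" and "\<beta> > 0" and C: "countable C"
    "\<And>a b. (a, b) \<in> C \<Longrightarrow> a < b \<and> {a..b} \<subseteq> I"
    "disjoint_family_on (\<lambda>(a, b). {a..b}) C"
    and null: "negligible (E - (\<Union>(a, b)\<in>C. {a<..<b}))"
    and steep: "\<And>x d. x \<in> E \<Longrightarrow> 0 < d \<Longrightarrow>
        \<exists>y\<in>I. y \<noteq> x \<and> \<bar>y - x\<bar> < d \<and> \<beta> < (F y - F x) / (y - x)"
  shows "ennreal \<beta> * outer_measure_of lebesgue E
           \<le> (\<integral>\<^sup>+(a, b). ennreal (F b - F a) \<partial>count_space C)"
proof -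
  define V where "V = (\<Union>(a, b)\<in>C. {a<..<b})"
  \<comment> \<open>Steep intervals that fit into a member of the given family.\<close>
  define P where "P = (\<lambda>c d. \<beta> * (d - c) < F d - F c \<and> (\<exists>(a, b)\<in>C. {c..d} \<subseteq> {a<..<b}))"
  have cov: "\<exists>c d. c < d \<and> c \<le> x \<and> x \<le> d \<and> d - c < e \<and> P c d" if x: "x \<in> E \<inter> V" and e: "0 < e" for x e
  proof -
    from x obtain a b where ab: "(a, b) \<in> C" "a < x" "x < b" by (auto simp: V_def)
    define e' where "e' = min e (min (x - a) (b - x))"
    have "e' > 0" using ab e by (auto simp: e'_def)
    from steep[OF _ this, of x] x obtain y where y: "y \<in> I" "y \<noteq> x" "\<bar>y - x\<bar> < e'" "\<beta> < (F y - F x) / (y - x)"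
      by blast
    show ?thesis
    proof (intro exI conjI)
      show "min x y < max x y" "min x y \<le> x" "x \<le> max x y" using y(2) by auto
      show "max x y - min x y < e" using y(3) by (auto simp: e'_def)
      have "\<beta> * (max x y - min x y) < F (max x y) - F (min x y)"
        using y(2) y(4)[folded quotient_on_interval[OF y(2), of F]] by (subst (asm) pos_less_divide_eq) auto
      moreover have "{min x y..max x y} \<subseteq> {a<..<b}"
        using y(3) ab by (auto simp: e'_def min_def max_def split: if_splits)
      ultimately show "P (min x y) (max x y)" using ab(1) unfolding P_def by auto
    qed
  qed
  obtain D where D: "countable D" "\<And>c d. (c, d) \<in> D \<Longrightarrow> c < d \<and> P c d"
    "disjoint_family_on (\<lambda>(a, b). {a..b}) D"
    "negligible (E \<inter> V - (\<Union>(a, b)\<in>D. {a<..<b}))"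
    using vitali_intervals[of "E \<inter> V" P] cov by metis
  define T where "T = (\<Union>(c, d)\<in>D. {c..<d})"
  define N where "N = E - T"
  have T: "T \<in> sets lebesgue"
    unfolding T_def using D(1) by (intro sets.countable_UN') auto
  have N: "negligible N"
    by (rule negligible_subset[OF negligible_Un[OF null D(4)]]) (force simp: N_def T_def V_def)
  have host: "\<exists>(a, b)\<in>C. {c..d} \<subseteq> {a<..<b}" if "(c, d) \<in> D" for c d
    using D(2)[OF that] by (auto simp: P_def)
  have DI: "\<And>a b. (a, b) \<in> D \<Longrightarrow> a < b \<and> {a..b} \<subseteq> I"
  proof -
    fix c d assume cd: "(c, d) \<in> D"
    from host[OF cd] obtain a b where "(a, b) \<in> C" "{c..d} \<subseteq> {a<..<b}" by auto
    moreover have "{a<..<b} \<subseteq> {a..b}" by auto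
    ultimately show "c < d \<and> {c..d} \<subseteq> I"
      using C(2)[of a b] D(2)[OF cd] by blast
  qed
  have leI: "F a \<le> F b" if "a < b \<and> {a..b} \<subseteq> I" for a b
    using that mono by (intro mono_onD[of I F]) auto
  have "ennreal \<beta> * outer_measure_of lebesgue E \<le> ennreal \<beta> * outer_measure_of lebesgue (T \<union> N)"
    by (intro mult_left_mono outer_measure_of_mono) (auto simp: N_def)
  also have "outer_measure_of lebesgue (T \<union> N) = emeasure lebesgue (T \<union> N)"
    using T N by (intro outer_measure_of_eq) (auto intro!: sets.Un simp: negligible_iff_null_sets)
  also have "\<dots> = emeasure lebesgue T"
    using T N by (intro emeasure_Un_null_set) (auto simp: negligible_iff_null_sets)
  also have "\<dots> = (\<integral>\<^sup>+(c, d). ennreal (d - c) \<partial>count_space D)"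
    unfolding T_def
  proof (rule emeasure_Union_intervals[of D "\<lambda>c d. c" "\<lambda>c d. d"])
    show "disjoint_family_on (\<lambda>(a, b). {a..<b}) D"
      using D(3) by (rule disjoint_family_half_open)
  qed (use D in \<open>auto intro: less_imp_le\<close>)
  also have "ennreal \<beta> * \<dots> = (\<integral>\<^sup>+(c, d). ennreal (\<beta> * (d - c)) \<partial>count_space D)"
    using \<open>\<beta> > 0\<close> D(2) by (subst nn_integral_cmult[symmetric]) (auto intro!: nn_integral_cong simp: ennreal_mult less_imp_le)
  also have "\<dots> \<le> (\<integral>\<^sup>+(c, d). ennreal (F d - F c) \<partial>count_space D)"
    using D(2) by (intro nn_integral_mono) (auto simp: P_def less_imp_le intro!: ennreal_leI)
  also have "\<dots> = emeasure lebesgue (\<Union>(c, d)\<in>D. {F c..<F d})"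
    using D(1) leI[OF DI] disjoint_family_mono_images[OF mono DI D(3)]
    by (rule emeasure_Union_intervals[of D "\<lambda>c d. F c" "\<lambda>c d. F d", symmetric])
  also have "\<dots> \<le> emeasure lebesgue (\<Union>(a, b)\<in>C. {F a..<F b})"
  proof (rule emeasure_mono)
    show "(\<Union>(c, d)\<in>D. {F c..<F d}) \<subseteq> (\<Union>(a, b)\<in>C. {F a..<F b})"
    proof clarify
      fix y c d assume cd: "(c, d) \<in> D" and y: "y \<in> {F c..<F d}"
      from host[OF cd] obtain a b where ab: "(a, b) \<in> C" "{c..d} \<subseteq> {a<..<b}" by auto
      have "a < b" "{a..b} \<subseteq> I" "c < d" using C(2)[OF ab(1)] D(2)[OF cd] by auto
      moreover from ab(2) this have "a < c" "d < b" by (auto simp: subset_eq)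
      ultimately have "F a \<le> F c" "F d \<le> F b"
        by (auto intro!: mono_onD[OF mono])
      with y have "y \<in> {F a..<F b}" by auto
      then show "y \<in> (\<Union>(a, b)\<in>C. {F a..<F b})" using ab(1) by blast
    qed
    show "(\<Union>(a, b)\<in>C. {F a..<F b}) \<in> sets lebesgue"
      using C(1) by (intro sets.countable_UN') auto
  qed
  also have "\<dots> = (\<integral>\<^sup>+(a, b). ennreal (F b - F a) \<partial>count_space C)"
    using C(1) leI[OF C(2)] disjoint_family_mono_images[OF mono C(2,3)]
    by (rule emeasure_Union_intervals[of C "\<lambda>c d. F c" "\<lambda>c d. F d"])
  finally show ?thesis .
qed

lemma negligible_outer_measure_0:
  assumes "outer_measure_of lebesgue E = 0"
  shows "negligible E"
proof -
  have "E \<subseteq> space lebesgue" by simp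
  from outer_measure_of_attain[OF this] obtain T
    where T: "T \<in> sets lebesgue" "E \<subseteq> T" "emeasure lebesgue T = 0"
    unfolding assms by metis
  then have "negligible T"
    unfolding negligible_iff_null_sets by (intro null_setsI)
  then show ?thesis
    using T(2) by (rule negligible_subset)
qed

lemma outer_measure_open_approx:
  assumes "outer_measure_of lebesgue E < \<infinity>" "e > 0"
  obtains U where "open U" "E \<subseteq> U" "emeasure lebesgue U \<le> outer_measure_of lebesgue E + ennreal e"
proof -
  have "E \<subseteq> space lebesgue" by simp
  from outer_measure_of_attain[OF this] obtain T
    where T: "T \<in> sets lebesgue" "E \<subseteq> T" "emeasure lebesgue T = outer_measure_of lebesgue E"
    by metis
  obtain U where U: "open U" "T \<subseteq> U" "U - T \<in> lmeasurable" "emeasure lebesgue (U - T) < ennreal e"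
    using sets_lebesgue_outer_open[OF T(1) \<open>e > 0\<close>] by metis
  have "emeasure lebesgue U = emeasure lebesgue (T \<union> (U - T))"
    using U(2) by (simp add: Un_absorb1)
  also have "\<dots> = emeasure lebesgue T + emeasure lebesgue (U - T)"
    using T U by (intro plus_emeasure[symmetric]) auto
  also have "\<dots> \<le> outer_measure_of lebesgue E + ennreal e"
    using T U by (auto intro!: add_mono)
  finally show thesis using that U T by blast
qed

text \<open>If at every point of \<open>E\<close> some difference quotients stay below \<open>\<alpha>\<close> and others exceed \<open>\<beta> > \<alpha>\<close>, a
  covering by flat intervals inside an open set almost as small as \<open>E\<close>, refined by steep intervals,
  gives \<open>\<beta> m \<le> \<alpha> (m + e)\<close> for the outer measure \<open>m\<close> of \<open>E\<close>.\<close>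

lemma negligible_dini_gap:
  fixes F :: "real \<Rightarrow> real"
  assumes mono: "mono_on I F" and "open I" "E \<subseteq> I" "bounded E" and ab: "0 < \<alpha>" "\<alpha> < \<beta>"
    and flat: "\<And>x d. x \<in> E \<Longrightarrow> 0 < d \<Longrightarrow>
        \<exists>y\<in>I. y \<noteq> x \<and> \<bar>y - x\<bar> < d \<and> (F y - F x) / (y - x) < \<alpha>"
    and steep: "\<And>x d. x \<in> E \<Longrightarrow> 0 < d \<Longrightarrow>
        \<exists>y\<in>I. y \<noteq> x \<and> \<bar>y - x\<bar> < d \<and> \<beta> < (F y - F x) / (y - x)"
  shows "negligible E"
proof -
  define m where "m = outer_measure_of lebesgue E"
  have m_fin: "m < \<infinity>"
  proof -
    obtain a :: real where "E \<subseteq> cball 0 a" using \<open>bounded E\<close> by (auto simp: bounded_iff subset_eq)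
    then have "m \<le> outer_measure_of lebesgue (cball (0::real) a)"
      unfolding m_def by (intro outer_measure_of_mono)
    also have "\<dots> = emeasure lebesgue (cball (0::real) a)" by simp
    also have "\<dots> < \<infinity>"
      using emeasure_lborel_cball_finite[of "0::real" a] by simp
    finally show ?thesis .
  qed
  have key: "ennreal \<beta> * m \<le> ennreal \<alpha> * (m + ennreal e)" if "e > 0" for e
  proof -
    obtain U where U: "open U" "E \<subseteq> U" "emeasure lebesgue U \<le> m + ennreal e"
      using outer_measure_open_approx[OF _ \<open>e > 0\<close>] m_fin unfolding m_def by metis
    define P where "P = (\<lambda>a b. F b - F a < \<alpha> * (b - a) \<and> {a..b} \<subseteq> U \<inter> I)"
    have cov: "\<exists>c d. c < d \<and> c \<le> x \<and> x \<le> d \<and> d - c < e \<and> P c d" if x: "x \<in> E" and e: "0 < e" for x e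
    proof -
      have "x \<in> U \<inter> I" "open (U \<inter> I)" using x U \<open>open I\<close> \<open>E \<subseteq> I\<close> by auto
      then obtain r where r: "r > 0" "ball x r \<subseteq> U \<inter> I" by (meson open_contains_ball)
      have "min e r > 0" using e r by auto
      from flat[OF x this] obtain y where y: "y \<in> I" "y \<noteq> x" "\<bar>y - x\<bar> < min e r" "(F y - F x) / (y - x) < \<alpha>"
        by blast
      show ?thesis
      proof (intro exI conjI)
        show "min x y < max x y" "min x y \<le> x" "x \<le> max x y" using y(2) by auto
        show "max x y - min x y < e" using y(3) by auto
        have "F (max x y) - F (min x y) < \<alpha> * (max x y - min x y)"
          using y(2) y(4)[folded quotient_on_interval[OF y(2), of F]] by (subst (asm) pos_divide_less_eq) auto
        moreover have "{min x y..max x y} \<subseteq> ball x r"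
          using y(3) by (auto simp: dist_real_def min_def max_def split: if_splits)
        ultimately show "P (min x y) (max x y)" using r unfolding P_def by auto
      qed
    qed
    obtain C where C: "countable C" "\<And>c d. (c, d) \<in> C \<Longrightarrow> c < d \<and> P c d"
      "disjoint_family_on (\<lambda>(a, b). {a..b}) C"
      "negligible (E - (\<Union>(a, b)\<in>C. {a<..<b}))"
      using vitali_intervals[of E P] cov by metis
    have "ennreal \<beta> * m \<le> (\<integral>\<^sup>+(a, b). ennreal (F b - F a) \<partial>count_space C)"
      unfolding m_def
      by (rule mono_steep_cover[OF mono _ C(1) _ C(3,4) steep]) (use ab C(2) in \<open>auto simp: P_def\<close>)
    also have "\<dots> \<le> (\<integral>\<^sup>+(a, b). ennreal \<alpha> * ennreal (b - a) \<partial>count_space C)"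
      using C(2) ab by (intro nn_integral_mono) (auto simp: P_def ennreal_mult[symmetric] less_imp_le intro!: ennreal_leI)
    also have "\<dots> = ennreal \<alpha> * (\<integral>\<^sup>+(a, b). ennreal (b - a) \<partial>count_space C)"
      by (subst nn_integral_cmult[symmetric]) (auto intro!: nn_integral_cong)
    also have "(\<integral>\<^sup>+(a, b). ennreal (b - a) \<partial>count_space C) = emeasure lebesgue (\<Union>(a, b)\<in>C. {a..<b})"
    proof (rule emeasure_Union_intervals[of C "\<lambda>c d. c" "\<lambda>c d. d", symmetric])
      show "disjoint_family_on (\<lambda>(a, b). {a..<b}) C"
        using C(3) by (rule disjoint_family_half_open)
    qed (use C in \<open>auto intro: less_imp_le\<close>)
    also have "\<dots> \<le> emeasure lebesgue U"
    proof (rule emeasure_mono)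
      have "{a..<b} \<subseteq> U" if "(a, b) \<in> C" for a b
        using C(2)[OF that] by (force simp: P_def)
      then show "(\<Union>(a, b)\<in>C. {a..<b}) \<subseteq> U" by blast
    qed (use U in auto)
    also have "ennreal \<alpha> * \<dots> \<le> ennreal \<alpha> * (m + ennreal e)"
      by (intro mult_left_mono U) auto
    finally show ?thesis by (simp add: mult_left_mono)
  qed
  obtain r where r: "m = ennreal r" "r \<ge> 0" using m_fin by (cases m) auto
  have bound: "\<beta> * r \<le> \<alpha> * (r + e)" if "e > 0" for e
    using key[OF that] r ab that by (simp add: ennreal_mult[symmetric] ennreal_plus[symmetric] del: ennreal_plus)
  have "(\<beta> - \<alpha>) * r \<le> 0 + e" if "e > 0" for e
  proof -
    have "\<beta> * r \<le> \<alpha> * (r + e / \<alpha>)" using bound[of "e / \<alpha>"] that ab by auto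
    then show ?thesis using ab by (simp add: algebra_simps)
  qed
  then have "(\<beta> - \<alpha>) * r \<le> 0" by (rule field_le_epsilon)
  then have "r = 0" using ab r by (simp add: mult_le_0_iff)
  then show ?thesis using r negligible_outer_measure_0 unfolding m_def by auto
qed

text \<open>Points with an infinite upper derivative: the steep covering inside a single interval bounds
  \<open>\<beta> m\<close> by the total increment, for every \<open>\<beta>\<close>.\<close>

lemma negligible_dini_infinite:
  fixes F :: "real \<Rightarrow> real"
  assumes mono: "mono_on I F" and I: "{a..b} \<subseteq> I" "a < b" "E \<subseteq> {a<..<b}"
    and steep: "\<And>x d \<beta>. x \<in> E \<Longrightarrow> 0 < d \<Longrightarrow>
        \<exists>y\<in>I. y \<noteq> x \<and> \<bar>y - x\<bar> < d \<and> \<beta> < (F y - F x) / (y - x)"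
  shows "negligible E"
proof -
  define m where "m = outer_measure_of lebesgue E"
  have "a \<in> I" "b \<in> I" using I by (auto simp: subset_eq)
  then have Fab: "F a \<le> F b" using mono_onD[OF mono, of a b] I by auto
  have key: "ennreal \<beta> * m \<le> ennreal (F b - F a)" if "\<beta> > 0" for \<beta>
  proof -
    have "ennreal \<beta> * m \<le> (\<integral>\<^sup>+(a, b). ennreal (F b - F a) \<partial>count_space {(a, b)})"
      unfolding m_def
    proof (rule mono_steep_cover[OF mono that _ _ _ _ steep])
      have "E - {a<..<b} = {}" using I by auto
      then show "negligible (E - (\<Union>(a, b)\<in>{(a, b)}. {a<..<b}))" by simp
    qed (use I in \<open>auto simp: disjoint_family_on_def\<close>)
    also have "\<dots> = ennreal (F b - F a)"
      by (subst nn_integral_count_space_finite) auto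
    finally show ?thesis .
  qed
  have "m < \<infinity>" using key[of 1] by (auto simp: less_top[symmetric] top_unique)
  then obtain r where r: "m = ennreal r" "r \<ge> 0" by (cases m) auto
  have *: "\<beta> * r \<le> F b - F a" if "\<beta> > 0" for \<beta>
    using key[OF that] r that Fab by (simp add: ennreal_mult[symmetric])
  have "r = 0"
  proof (rule ccontr)
    assume "r \<noteq> 0"
    with r have "r > 0" by simp
    then show False using *[of "(F b - F a + 1) / r"] Fab by simp
  qed
  then show ?thesis using r negligible_outer_measure_0 unfolding m_def by auto
qed

lemma real_limit_from_oscillation:
  fixes Q :: "'a \<Rightarrow> real"
  assumes "F \<noteq> bot" and lo: "eventually (\<lambda>y. 0 \<le> Q y) F" and hi: "eventually (\<lambda>y. Q y \<le> B) F"
    and no_gap: "\<And>\<alpha> \<beta>. \<alpha> \<in> \<rat> \<Longrightarrow> \<beta> \<in> \<rat> \<Longrightarrow> 0 < \<alpha> \<Longrightarrow> \<alpha> < \<beta> \<Longrightarrow>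
       eventually (\<lambda>y. \<alpha> \<le> Q y) F \<or> eventually (\<lambda>y. Q y \<le> \<beta>) F"
  shows "\<exists>L. (Q \<longlongrightarrow> L) F"
proof -
  define l where "l = Liminf F (\<lambda>y. ereal (Q y))"
  define u where "u = Limsup F (\<lambda>y. ereal (Q y))"
  have lu: "l \<le> u" unfolding l_def u_def by (rule Liminf_le_Limsup) fact
  have l0: "0 \<le> l" unfolding l_def by (rule Liminf_bounded) (use lo in auto)
  have uB: "u \<le> ereal B" unfolding u_def by (rule Limsup_bounded) (use hi in auto)
  have "\<not> l < u"
  proof
    assume "l < u"
    then obtain s where s: "l < s" "s < u" using dense by blast
    obtain l' where l': "l = ereal l'" using l0 lu uB by (cases l) auto
    obtain u' where u': "u = ereal u'" using l0 lu uB by (cases u) auto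
    have "l' < u'" using \<open>l < u\<close> l' u' by simp
    then obtain \<alpha> where \<alpha>: "\<alpha> \<in> \<rat>" "l' < \<alpha>" "\<alpha> < u'" using Rats_dense_in_real by blast
    then obtain \<beta> where \<beta>: "\<beta> \<in> \<rat>" "\<alpha> < \<beta>" "\<beta> < u'" using Rats_dense_in_real by blast
    have "0 < \<alpha>" using l0 l' \<alpha> by simp
    from no_gap[OF \<alpha>(1) \<beta>(1) this \<beta>(2)] show False
    proof
      assume "eventually (\<lambda>y. \<alpha> \<le> Q y) F"
      then have "ereal \<alpha> \<le> l" unfolding l_def by (intro Liminf_bounded) auto
      with l' \<alpha> show False by simp
    next
      assume "eventually (\<lambda>y. Q y \<le> \<beta>) F"
      then have "u \<le> ereal \<beta>" unfolding u_def by (intro Limsup_bounded) auto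
      with u' \<beta> show False by simp
    qed
  qed
  then have eq: "l = u" using lu by simp
  obtain L where L: "l = ereal L" using l0 lu uB by (cases l) auto
  have "((\<lambda>y. ereal (Q y)) \<longlongrightarrow> ereal L) F"
    by (rule Liminf_eq_Limsup) (use assms(1) eq L in \<open>auto simp: l_def u_def\<close>)
  then show ?thesis by auto
qed

text \<open>Lebesgue's theorem. A difference quotient that is bounded and has no rational gap between its
  lower and upper limits converges, so the exceptional set is a countable union of the sets treated
  before.\<close>

theorem mono_on_differentiable_ae:
  fixes F :: "real \<Rightarrow> real"
  assumes mono: "mono_on I F" and "open I"
  shows "negligible {x \<in> I. \<not> F differentiable (at x)}"
proof -
  define flat where "flat = (\<lambda>\<alpha> x. \<forall>d>0. \<exists>y\<in>I. y \<noteq> x \<and> \<bar>y - x\<bar> < d \<and> (F y - F x) / (y - x) < \<alpha>)"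
  define steep where "steep = (\<lambda>\<beta> x. \<forall>d>0. \<exists>y\<in>I. y \<noteq> x \<and> \<bar>y - x\<bar> < d \<and> \<beta> < (F y - F x) / (y - x))"
  define W where "W = {(a::real, b). a \<in> \<rat> \<and> b \<in> \<rat> \<and> a < b \<and> {a..b} \<subseteq> I}"
  define G where "G = {(\<alpha>::real, \<beta>). \<alpha> \<in> \<rat> \<and> \<beta> \<in> \<rat> \<and> 0 < \<alpha> \<and> \<alpha> < \<beta>}"
  have cW: "countable W" "countable G"
    unfolding W_def G_def
    by (rule countable_subset[of _ "\<rat> \<times> \<rat>"], auto intro: countable_rat)+
  define N where "N = (\<Union>(a, b)\<in>W. {x \<in> {a<..<b}. \<forall>\<beta>. steep \<beta> x}) \<union>
     (\<Union>(a, b)\<in>W. \<Union>(\<alpha>, \<beta>)\<in>G. {x \<in> {a<..<b}. flat \<alpha> x \<and> steep \<beta> x})"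
  have "negligible N"
    unfolding N_def
  proof (intro negligible_Un negligible_countable_Union countable_image cW, safe)
    fix a b assume "(a, b) \<in> W"
    then show "negligible {x \<in> {a<..<b}. \<forall>\<beta>. steep \<beta> x}"
      by (intro negligible_dini_infinite[OF mono]) (auto simp: W_def steep_def)
  next
    fix a b assume W: "(a, b) \<in> W"
    show "negligible (\<Union>(\<alpha>, \<beta>)\<in>G. {x \<in> {a<..<b}. flat \<alpha> x \<and> steep \<beta> x})"
    proof (intro negligible_countable_Union countable_image cW, safe)
      fix \<alpha> \<beta> assume G: "(\<alpha>, \<beta>) \<in> G"
      show "negligible {x \<in> {a<..<b}. flat \<alpha> x \<and> steep \<beta> x}"
      proof (rule negligible_dini_gap[OF mono \<open>open I\<close>])
        show "{x \<in> {a<..<b}. flat \<alpha> x \<and> steep \<beta> x} \<subseteq> I" using W by (force simp: W_def)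
        show "bounded {x \<in> {a<..<b}. flat \<alpha> x \<and> steep \<beta> x}"
          by (rule bounded_subset[of "{a<..<b}"]) auto
      qed (use G in \<open>auto simp: G_def flat_def steep_def\<close>)
    qed
  qed
  moreover have "{x \<in> I. \<not> F differentiable (at x)} \<subseteq> N"
  proof clarify
    fix x assume x: "x \<in> I" and nd: "\<not> F differentiable (at x)"
    show "x \<in> N"
    proof (rule ccontr)
      assume xN: "x \<notin> N"
      obtain r where r: "r > 0" "ball x r \<subseteq> I" using x \<open>open I\<close> by (meson open_contains_ball)
      obtain a where a: "a \<in> \<rat>" "x - r < a" "a < x" using Rats_dense_in_real[of "x - r" x] r by auto
      obtain b where b: "b \<in> \<rat>" "x < b" "b < x + r" using Rats_dense_in_real[of x "x + r"] r by auto
      have abI: "{a..b} \<subseteq> I" using a b by (intro order_trans[OF _ r(2)]) (auto simp: dist_real_def)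
      have W: "(a, b) \<in> W" using a b abI by (auto simp: W_def)
      have evI: "eventually (\<lambda>y. y \<in> I \<and> y \<noteq> x) (at x)"
        using x \<open>open I\<close> by (auto simp: eventually_at_topological)
      define Q where "Q = (\<lambda>y. (F y - F x) / (y - x))"
      have ev: "eventually (\<lambda>y. P (Q y)) (at x)"
        if nd: "\<not> (\<forall>d>0. \<exists>y\<in>I. y \<noteq> x \<and> \<bar>y - x\<bar> < d \<and> \<not> P (Q y))" for P
      proof -
        obtain d where d: "d > 0" "\<forall>y\<in>I. y \<noteq> x \<longrightarrow> \<bar>y - x\<bar> < d \<longrightarrow> P (Q y)" using nd by blast
        have "eventually (\<lambda>y. \<bar>y - x\<bar> < d) (at x)"
          using d(1) by (auto simp: eventually_at dist_real_def)
        with evI show ?thesis by eventually_elim (use d in auto)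
      qed
      have nf: "eventually (\<lambda>y. \<alpha> \<le> Q y) (at x)" if "\<not> flat \<alpha> x" for \<alpha>
        using that ev[of "\<lambda>r. \<alpha> \<le> r"] unfolding flat_def Q_def not_le by blast
      have ns: "eventually (\<lambda>y. Q y \<le> \<beta>) (at x)" if "\<not> steep \<beta> x" for \<beta>
        using that ev[of "\<lambda>r. r \<le> \<beta>"] unfolding steep_def Q_def not_le by blast
      have "\<not> (\<forall>B. steep B x)"
      proof
        assume "\<forall>B. steep B x"
        then have "x \<in> N" unfolding N_def using a b by (intro UnI1 UN_I[OF W]) auto
        with xN show False by blast
      qed
      then obtain B where B: "\<not> steep B x" by blast
      have "\<exists>L. (Q \<longlongrightarrow> L) (at x)"
      proof (rule real_limit_from_oscillation)
        show "at x \<noteq> bot" by simp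
        show "eventually (\<lambda>y. 0 \<le> Q y) (at x)"
          using evI
        proof eventually_elim
          case (elim y)
          show ?case
          proof (cases "x \<le> y")
            case True then have "F x \<le> F y" using mono_onD[OF mono x] elim by auto
            then show ?thesis using True by (auto simp: Q_def)
          next
            case False then have "F y \<le> F x" using mono_onD[OF mono _ x] elim by auto
            then show ?thesis using False by (auto simp: Q_def divide_nonpos_nonpos)
          qed
        qed
        show "eventually (\<lambda>y. Q y \<le> B) (at x)" by (rule ns[OF B])
        fix \<alpha> \<beta> :: real assume "\<alpha> \<in> \<rat>" "\<beta> \<in> \<rat>" "0 < \<alpha>" "\<alpha> < \<beta>"
        then have "(\<alpha>, \<beta>) \<in> G" by (auto simp: G_def)
        have "\<not> (flat \<alpha> x \<and> steep \<beta> x)"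
        proof
          assume "flat \<alpha> x \<and> steep \<beta> x"
          then have "x \<in> (\<Union>(\<alpha>, \<beta>)\<in>G. {x \<in> {a<..<b}. flat \<alpha> x \<and> steep \<beta> x})"
            using a b by (intro UN_I[OF \<open>(\<alpha>, \<beta>) \<in> G\<close>]) auto
          then have "x \<in> N" unfolding N_def by (intro UnI2 UN_I[OF W]) simp
          with xN show False by blast
        qed
        then show "eventually (\<lambda>y. \<alpha> \<le> Q y) (at x) \<or> eventually (\<lambda>y. Q y \<le> \<beta>) (at x)"
          using nf ns by blast
      qed
      then obtain L where "(Q \<longlongrightarrow> L) (at x)" by blast
      then have "(F has_field_derivative L) (at x)"
        by (simp add: has_field_derivative_iff Q_def)
      then show False using nd unfolding has_field_derivative_def differentiable_def by blast
    qed
  qed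
  ultimately show ?thesis by (rule negligible_subset)
qed

section \<open>Convex functions of one variable have second-order expansions almost everywhere\<close>

text \<open>A chain of \<open>N\<close> equal steps makes the quadratic error \<open>B (t/N)\<^sup>2 N\<close> disappear as \<open>N\<close> grows.\<close>

lemma increments_bound:
  fixes \<psi> :: "real \<Rightarrow> real"
  assumes inc: "\<And>u v. \<lbrakk>\<bar>u\<bar> \<le> \<bar>t\<bar>; \<bar>v\<bar> \<le> \<bar>t\<bar>\<rbrakk> \<Longrightarrow> \<bar>\<psi> u - \<psi> v\<bar> \<le> A * \<bar>u - v\<bar> + B * (u - v)\<^sup>2"
  shows "\<bar>\<psi> t - \<psi> 0\<bar> \<le> A * \<bar>t\<bar>"
proof -
  have step: "\<bar>\<psi> t - \<psi> 0\<bar> \<le> A * \<bar>t\<bar> + B * t\<^sup>2 * (1 / real (Suc n))" for n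
  proof -
    define N where "N = Suc n"
    define p where "p = (\<lambda>i. real i * t / real N)"
    have "\<psi> t - \<psi> 0 = (\<Sum>i<N. \<psi> (p (Suc i)) - \<psi> (p i))"
      by (subst sum_lessThan_telescope) (simp add: p_def N_def)
    also have "\<bar>\<dots>\<bar> \<le> (\<Sum>i<N. \<bar>\<psi> (p (Suc i)) - \<psi> (p i)\<bar>)" by (rule sum_abs)
    also have "\<dots> \<le> (\<Sum>i<N. A * (\<bar>t\<bar> / N) + B * (t / N)\<^sup>2)"
    proof (rule sum_mono)
      fix i assume "i \<in> {..<N}"
      then have "i < N" by simp
      have le: "\<bar>p j\<bar> \<le> \<bar>t\<bar>" if "j \<le> N" for j
      proof -
        have "real j / real N \<le> 1" using that by (simp add: N_def divide_le_eq_1)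
        then have "real j / real N * \<bar>t\<bar> \<le> 1 * \<bar>t\<bar>" by (intro mult_right_mono) auto
        then show ?thesis by (simp add: p_def abs_mult)
      qed
      have diff: "p (Suc i) - p i = t / N" by (simp add: p_def add_divide_distrib distrib_right)
      show "\<bar>\<psi> (p (Suc i)) - \<psi> (p i)\<bar> \<le> A * (\<bar>t\<bar> / N) + B * (t / N)\<^sup>2"
        using inc[OF le le, of "Suc i" i] \<open>i < N\<close> by (simp add: diff)
    qed
    also have "\<dots> = A * \<bar>t\<bar> + B * t\<^sup>2 * (1 / real (Suc n))"
      by (simp add: N_def field_simps power2_eq_square del: of_nat_Suc)
    finally show ?thesis .
  qed
  have "(\<lambda>n. A * \<bar>t\<bar> + B * t\<^sup>2 * (1 / real (Suc n))) \<longlonglongrightarrow> A * \<bar>t\<bar> + B * t\<^sup>2 * 0"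
    by (intro tendsto_intros lim_const_over_n[THEN filterlim_sequentially_Suc[THEN iffD2]])
  from LIMSEQ_le_const[OF this] show ?thesis using step by auto
qed

text \<open>The Peano expansion of order two at the origin; \<open>q\<close> is half of the second derivative.\<close>

definition second_order_at_0 :: "(real \<Rightarrow> real) \<Rightarrow> real \<Rightarrow> real \<Rightarrow> bool" where
  "second_order_at_0 h a q \<longleftrightarrow> ((\<lambda>t. (h t - h 0 - a * t - q * t\<^sup>2) / t\<^sup>2) \<longlongrightarrow> 0) (at 0)"

lemma second_order_at_0D:
  assumes "second_order_at_0 h a q" "e > 0"
  obtains d where "d > 0" "\<And>t. \<bar>t\<bar> < d \<Longrightarrow> \<bar>h t - h 0 - a * t - q * t\<^sup>2\<bar> \<le> e * t\<^sup>2"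
proof -
  from assms have "eventually (\<lambda>t. \<bar>(h t - h 0 - a * t - q * t\<^sup>2) / t\<^sup>2\<bar> < e) (at 0)"
    by (auto simp: second_order_at_0_def tendsto_iff dist_real_def)
  then obtain d where d: "d > 0" "\<And>t. t \<noteq> 0 \<Longrightarrow> \<bar>t\<bar> < d \<Longrightarrow> \<bar>(h t - h 0 - a * t - q * t\<^sup>2) / t\<^sup>2\<bar> < e"
    by (auto simp: eventually_at dist_real_def)
  show thesis
  proof (rule that[OF d(1)])
    fix t :: real assume "\<bar>t\<bar> < d"
    show "\<bar>h t - h 0 - a * t - q * t\<^sup>2\<bar> \<le> e * t\<^sup>2"
    proof (cases "t = 0")
      case False
      have "\<bar>h t - h 0 - a * t - q * t\<^sup>2\<bar> / t\<^sup>2 < e"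
        using d(2)[OF False \<open>\<bar>t\<bar> < d\<close>] by (simp add: abs_divide)
      then show ?thesis using False by (simp add: pos_divide_less_eq less_imp_le)
    qed simp
  qed
qed

lemma second_order_at_0I:
  assumes "\<And>e. e > 0 \<Longrightarrow> \<exists>d>0. \<forall>t. \<bar>t\<bar> < d \<longrightarrow> \<bar>h t - h 0 - a * t - q * t\<^sup>2\<bar> \<le> e * t\<^sup>2"
  shows "second_order_at_0 h a q"
  unfolding second_order_at_0_def
proof (rule tendstoI)
  fix e :: real assume "e > 0"
  with assms[of "e / 2"] obtain d where d: "d > 0"
    "\<And>t. \<bar>t\<bar> < d \<Longrightarrow> \<bar>h t - h 0 - a * t - q * t\<^sup>2\<bar> \<le> e / 2 * t\<^sup>2" by auto
  have "\<bar>(h t - h 0 - a * t - q * t\<^sup>2) / t\<^sup>2\<bar> < e" if "t \<noteq> 0" "\<bar>t\<bar> < d" for t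
  proof -
    have "\<bar>h t - h 0 - a * t - q * t\<^sup>2\<bar> / t\<^sup>2 \<le> e / 2"
      using d(2)[OF that(2)] that by (simp add: pos_divide_le_eq)
    then have "\<bar>h t - h 0 - a * t - q * t\<^sup>2\<bar> / t\<^sup>2 < e" using \<open>e > 0\<close> by linarith
    then show ?thesis by (simp add: abs_divide)
  qed
  then show "eventually (\<lambda>t. dist ((h t - h 0 - a * t - q * t\<^sup>2) / t\<^sup>2) 0 < e) (at 0)"
    using d(1) by (auto simp: eventually_at dist_real_def)
qed

lemma second_order_at_0_cong:
  assumes "eventually (\<lambda>t. h t = h' t) (nhds 0)"
  shows "second_order_at_0 h a q \<longleftrightarrow> second_order_at_0 h' a q"
proof -
  have "h 0 = h' 0" using eventually_nhds_x_imp_x[OF assms] .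
  moreover have "eventually (\<lambda>t. h t = h' t) (at 0)"
    using assms by (auto simp: eventually_at_filter elim: eventually_mono)
  ultimately show ?thesis
    unfolding second_order_at_0_def
    by (intro tendsto_cong) (auto elim: eventually_mono)
qed

text \<open>A convex function is recovered from its subgradients \<open>F\<close> by adding up increments, so the
  first-order expansion of \<open>F\<close> integrates to a second-order expansion of \<open>\<phi>\<close>.\<close>

lemma subgradient_second_order:
  fixes \<phi> F :: "real \<Rightarrow> real"
  assumes sub: "\<And>y z. y \<in> I \<Longrightarrow> z \<in> I \<Longrightarrow> \<phi> z + F z * (y - z) \<le> \<phi> y"
    and "open I" "x \<in> I" and der: "(F has_field_derivative L) (at x)"
  shows "second_order_at_0 (\<lambda>t. \<phi> (x + t)) (F x) (L / 2)"
proof (rule second_order_at_0I)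
  fix e :: real assume e: "e > 0"
  from der have "((\<lambda>y. (F y - F x) / (y - x)) \<longlongrightarrow> L) (at x)"
    by (simp add: has_field_derivative_iff)
  then have "eventually (\<lambda>y. \<bar>(F y - F x) / (y - x) - L\<bar> < e) (at x)"
    using e by (auto simp: tendsto_iff dist_real_def)
  moreover have "eventually (\<lambda>y. y \<in> I) (at x)"
    using \<open>open I\<close> \<open>x \<in> I\<close> by (auto simp: eventually_at_topological)
  ultimately have "eventually (\<lambda>y. y \<in> I \<and> \<bar>(F y - F x) / (y - x) - L\<bar> < e) (at x)"
    by eventually_elim auto
  then obtain d where d: "d > 0"
    "\<And>y. y \<noteq> x \<Longrightarrow> \<bar>y - x\<bar> < d \<Longrightarrow> y \<in> I \<and> \<bar>(F y - F x) / (y - x) - L\<bar> < e"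
    by (auto simp: eventually_at dist_real_def)
  have inI: "x + s \<in> I" if "\<bar>s\<bar> < d" for s
    using d(2)[of "x + s"] that \<open>x \<in> I\<close> by (cases "s = 0") auto
  have err: "\<bar>F (x + s) - F x - L * s\<bar> \<le> e * \<bar>s\<bar>" if "\<bar>s\<bar> < d" for s
  proof (cases "s = 0")
    case False
    then have "\<bar>(F (x + s) - F x) / s - L\<bar> < e" using d(2)[of "x + s"] that by auto
    moreover have "(F (x + s) - F x) / s - L = (F (x + s) - F x - L * s) / s"
      using False by (simp add: field_simps)
    ultimately have "\<bar>F (x + s) - F x - L * s\<bar> / \<bar>s\<bar> < e" by (simp add: abs_divide)
    then show ?thesis using False by (simp add: pos_divide_less_eq)
  qed simp
  define \<psi> where "\<psi> = (\<lambda>t. \<phi> (x + t) - \<phi> x - F x * t - L / 2 * t\<^sup>2)"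
  show "\<exists>d>0. \<forall>t. \<bar>t\<bar> < d \<longrightarrow> \<bar>\<phi> (x + t) - \<phi> (x + 0) - F x * t - L / 2 * t\<^sup>2\<bar> \<le> e * t\<^sup>2"
  proof (intro exI conjI allI impI)
    show "d > 0" by fact
    fix t assume t: "\<bar>t\<bar> < d"
    have half: "\<psi> v - \<psi> u \<le> e * \<bar>t\<bar> * \<bar>u - v\<bar> + \<bar>L\<bar> / 2 * (u - v)\<^sup>2"
      if "\<bar>u\<bar> \<le> \<bar>t\<bar>" "\<bar>v\<bar> \<le> \<bar>t\<bar>" for u v
    proof -
      have "\<phi> (x + v) - \<phi> (x + u) \<le> F (x + v) * (v - u)"
        using sub[OF inI inI, of u v] that t by (simp add: algebra_simps)
      then have "\<psi> v - \<psi> u \<le> (F (x + v) - F x - L * v) * (v - u) + L / 2 * (u - v)\<^sup>2"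
        by (simp add: \<psi>_def algebra_simps power2_eq_square)
      also have "(F (x + v) - F x - L * v) * (v - u) \<le> \<bar>F (x + v) - F x - L * v\<bar> * \<bar>v - u\<bar>"
        by (metis abs_ge_self abs_mult)
      also have "\<dots> \<le> (e * \<bar>v\<bar>) * \<bar>v - u\<bar>"
        using err[of v] that t by (intro mult_right_mono) auto
      also have "\<dots> \<le> (e * \<bar>t\<bar>) * \<bar>v - u\<bar>"
        using that e by (intro mult_right_mono mult_left_mono) auto
      also have "L / 2 * (u - v)\<^sup>2 \<le> \<bar>L\<bar> / 2 * (u - v)\<^sup>2"
        by (intro mult_right_mono) auto
      finally show ?thesis by (simp add: abs_minus_commute)
    qed
    have "\<bar>\<psi> t - \<psi> 0\<bar> \<le> (e * \<bar>t\<bar>) * \<bar>t\<bar>"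
    proof (rule increments_bound)
      fix u v assume uv: "\<bar>u\<bar> \<le> \<bar>t\<bar>" "\<bar>v\<bar> \<le> \<bar>t\<bar>"
      show "\<bar>\<psi> u - \<psi> v\<bar> \<le> e * \<bar>t\<bar> * \<bar>u - v\<bar> + \<bar>L\<bar> / 2 * (u - v)\<^sup>2"
      proof -
        have eq: "\<bar>v - u\<bar> = \<bar>u - v\<bar>" "(v - u)\<^sup>2 = (u - v)\<^sup>2" by (simp_all add: power2_commute)
        show ?thesis using half[OF uv] half[OF uv(2,1)] unfolding eq abs_le_iff by linarith
      qed
    qed
    then show "\<bar>\<phi> (x + t) - \<phi> (x + 0) - F x * t - L / 2 * t\<^sup>2\<bar> \<le> e * t\<^sup>2"
      by (simp add: \<psi>_def power2_eq_square)
  qed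
qed

lemma convex_second_order_ae_real:
  fixes \<phi> :: "real \<Rightarrow> real"
  assumes "convex_on I \<phi>" "open I"
  shows "negligible {x \<in> I. \<not> (\<exists>a q. second_order_at_0 (\<lambda>t. \<phi> (x + t)) a q)}"
proof -
  define F where "F = (\<lambda>x. Inf ((\<lambda>t. (\<phi> x - \<phi> t) / (x - t)) ` ({x<..} \<inter> I)))"
  have sub: "\<phi> z + F z * (y - z) \<le> \<phi> y" if "y \<in> I" "z \<in> I" for y z
    unfolding F_def using convex_le_Inf_differential[OF assms(1), of z y] that assms(2)
    by (simp add: interior_open)
  have "mono_on I F"
  proof (rule mono_onI)
    fix r s assume rs: "r \<in> I" "s \<in> I" "r \<le> s"
    have "\<phi> r + F r * (s - r) \<le> \<phi> s" "\<phi> s + F s * (r - s) \<le> \<phi> r"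
      using sub rs by auto
    then have "0 \<le> (F s - F r) * (s - r)" by (simp add: algebra_simps)
    then show "F r \<le> F s" using rs(3) by (cases "r = s") (auto simp: zero_le_mult_iff)
  qed
  from mono_on_differentiable_ae[OF this assms(2)]
  show ?thesis
  proof (rule negligible_subset, safe)
    fix x assume x: "x \<in> I" "\<not> (\<exists>a q. second_order_at_0 (\<lambda>t. \<phi> (x + t)) a q)" "F differentiable (at x)"
    from x(3) obtain L where "(F has_field_derivative L) (at x)"
      unfolding real_differentiable_def by (elim exE)
    then have "second_order_at_0 (\<lambda>t. \<phi> (x + t)) (F x) (L / 2)"
      using subgradient_second_order[of I \<phi> F x L] sub assms(2) x(1) by simp
    then show False using x(2) by (elim notE) (intro exI)
  qed
qed

lemma second_order_at_0_imp_derivative: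
  assumes "second_order_at_0 h a q"
  shows "(h has_field_derivative a) (at 0)"
proof -
  define r where "r = (\<lambda>t. (h t - h 0 - a * t - q * t\<^sup>2) / t\<^sup>2)"
  have r: "(r \<longlongrightarrow> 0) (at 0)" using assms by (simp add: second_order_at_0_def r_def)
  have "((\<lambda>t. r t * t + a + q * t) \<longlongrightarrow> 0 * 0 + a + q * 0) (at 0)" by (intro tendsto_intros r)
  then have "((\<lambda>t. r t * t + a + q * t) \<longlongrightarrow> a) (at 0)" by simp
  then have "((\<lambda>t. (h t - h 0) / (t - 0)) \<longlongrightarrow> a) (at 0)"
    by (rule Lim_transform_eventually) (auto simp: eventually_at_filter r_def field_simps power2_eq_square)
  then show ?thesis by (simp add: has_field_derivative_iff)
qed

lemma second_order_blowup:
  assumes "second_order_at_0 h a q" and \<tau>: "\<tau> \<longlonglongrightarrow> 0" "\<And>k. \<tau> k > 0"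
  shows "(\<lambda>k. (h (s * \<tau> k) - h 0 - \<tau> k * (s * a)) / (\<tau> k)\<^sup>2) \<longlonglongrightarrow> s\<^sup>2 * q"
proof (cases "s = 0")
  case False
  define r where "r = (\<lambda>t. (h t - h 0 - a * t - q * t\<^sup>2) / t\<^sup>2)"
  have r: "(r \<longlongrightarrow> 0) (at 0)" using assms(1) by (simp add: second_order_at_0_def r_def)
  have nz: "s * \<tau> k \<noteq> 0" for k using False \<tau>(2)[of k] by simp
  have "(\<lambda>k. s * \<tau> k) \<longlonglongrightarrow> s * 0" by (intro tendsto_intros \<tau>)
  then have "filterlim (\<lambda>k. s * \<tau> k) (at 0) sequentially" using nz by (auto simp: filterlim_at)
  then have "(\<lambda>k. r (s * \<tau> k)) \<longlonglongrightarrow> 0" by (rule filterlim_compose[OF r])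
  then have "(\<lambda>k. s\<^sup>2 * (r (s * \<tau> k) + q)) \<longlonglongrightarrow> s\<^sup>2 * (0 + q)" by (intro tendsto_intros)
  moreover have "s\<^sup>2 * (r (s * \<tau> k) + q) = (h (s * \<tau> k) - h 0 - \<tau> k * (s * a)) / (\<tau> k)\<^sup>2" for k
    using False \<tau>(2)[of k] by (simp add: r_def field_simps power_mult_distrib)
  ultimately show ?thesis by simp
qed simp

text \<open>If \<open>h\<close> has a second-order expansion at 0, its coefficients are these limits of difference
  quotients. Unlike an existential quantifier over the coefficients, the limits depend measurably on
  parameters, and only countably many values of \<open>h\<close> are involved below; this shows that exceptional
  sets are Borel sets.\<close>

definition slope_limit :: "(real \<Rightarrow> real) \<Rightarrow> real" where
  "slope_limit h = lim (\<lambda>k. (h (1 / real (Suc k)) - h 0) / (1 / real (Suc k)))"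

definition curvature_limit :: "(real \<Rightarrow> real) \<Rightarrow> real" where
  "curvature_limit h = lim (\<lambda>k. (h (1 / real (Suc k)) - h 0 - 1 / real (Suc k) * slope_limit h) / (1 / real (Suc k))\<^sup>2)"

definition rational_second_order :: "(real \<Rightarrow> real) \<Rightarrow> bool" where
  "rational_second_order h \<longleftrightarrow>
     (\<forall>e::rat. e > 0 \<longrightarrow> (\<exists>d::rat. d > 0 \<and> (\<forall>t::rat. \<bar>real_of_rat t\<bar> < real_of_rat d \<longrightarrow>
        \<bar>h (of_rat t) - h 0 - slope_limit h * of_rat t - curvature_limit h * (of_rat t)\<^sup>2\<bar> \<le> of_rat e * (of_rat t)\<^sup>2)))"

lemma harmonic_step: "(\<lambda>k. 1 / real (Suc k)) \<longlonglongrightarrow> 0" "1 / real (Suc k) > 0"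
  using LIMSEQ_Suc[OF lim_1_over_n] by auto

lemma second_order_limits:
  assumes so: "second_order_at_0 h a q"
  shows "slope_limit h = a" "curvature_limit h = q"
proof -
  have "((\<lambda>t. (h t - h 0) / t) \<longlongrightarrow> a) (at 0)"
    using second_order_at_0_imp_derivative[OF so] by (simp add: has_field_derivative_iff)
  moreover have "filterlim (\<lambda>k. 1 / real (Suc k)) (at 0) sequentially"
    using harmonic_step(1) by (auto simp: filterlim_at)
  ultimately have "(\<lambda>k. (h (1 / real (Suc k)) - h 0) / (1 / real (Suc k))) \<longlonglongrightarrow> a"
    by (rule filterlim_compose)
  then show a: "slope_limit h = a" unfolding slope_limit_def by (rule limI)
  show "curvature_limit h = q"
    unfolding curvature_limit_def a
    using second_order_blowup[OF so harmonic_step, of 1] by (intro limI) simp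
qed

lemma second_order_iff_rational:
  assumes cont: "continuous_on {-r<..<r} h" and "r > 0"
  shows "(\<exists>a q. second_order_at_0 h a q) \<longleftrightarrow> rational_second_order h"
proof
  assume "\<exists>a q. second_order_at_0 h a q"
  then obtain a q where so: "second_order_at_0 h a q" by blast
  show "rational_second_order h"
    unfolding rational_second_order_def second_order_limits[OF so]
  proof (intro allI impI)
    fix e :: rat assume "e > 0"
    then have "real_of_rat e > 0" by simp
    from second_order_at_0D[OF so this] obtain d where d: "d > 0"
      "\<And>t. \<bar>t\<bar> < d \<Longrightarrow> \<bar>h t - h 0 - a * t - q * t\<^sup>2\<bar> \<le> of_rat e * t\<^sup>2" by blast
    obtain d' :: rat where d': "0 < real_of_rat d'" "real_of_rat d' < d" using of_rat_dense[OF d(1)] by auto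
    then have "d' > 0" by simp
    moreover have "\<bar>h (of_rat t) - h 0 - a * of_rat t - q * (of_rat t)\<^sup>2\<bar> \<le> of_rat e * (of_rat t)\<^sup>2"
      if "\<bar>real_of_rat t\<bar> < real_of_rat d'" for t
      using d'(2) that by (intro d(2)) linarith
    ultimately show "\<exists>d::rat. d > 0 \<and> (\<forall>t::rat. \<bar>real_of_rat t\<bar> < real_of_rat d \<longrightarrow>
        \<bar>h (of_rat t) - h 0 - a * of_rat t - q * (of_rat t)\<^sup>2\<bar> \<le> of_rat e * (of_rat t)\<^sup>2)" by blast
  qed
next
  assume rat: "rational_second_order h"
  define R where "R = (\<lambda>t. h t - h 0 - slope_limit h * t - curvature_limit h * t\<^sup>2)"
  have "second_order_at_0 h (slope_limit h) (curvature_limit h)"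
  proof (rule second_order_at_0I)
    fix e :: real assume "e > 0"
    obtain e' :: rat where e': "0 < real_of_rat e'" "real_of_rat e' < e" using of_rat_dense[OF \<open>e > 0\<close>] by auto
    then have "e' > 0" by simp
    with rat obtain d' :: rat where d': "d' > 0"
      "\<And>t::rat. \<bar>real_of_rat t\<bar> < of_rat d' \<Longrightarrow> \<bar>R (of_rat t)\<bar> \<le> of_rat e' * (of_rat t)\<^sup>2"
      unfolding rational_second_order_def R_def by blast
    define d where "d = min r (of_rat d')"
    have "d > 0" using d' \<open>r > 0\<close> by (simp add: d_def)
    moreover have "\<bar>R t\<bar> \<le> e * t\<^sup>2" if t: "\<bar>t\<bar> < d" for t
    proof (rule ccontr)
      assume "\<not> \<bar>R t\<bar> \<le> e * t\<^sup>2"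
      moreover have "real_of_rat e' * t\<^sup>2 \<le> e * t\<^sup>2" using e' by (intro mult_right_mono) auto
      ultimately have pos: "0 < \<bar>R t\<bar> - of_rat e' * t\<^sup>2" by linarith
      have "t \<in> {-r<..<r}" using t by (auto simp: d_def abs_less_iff)
      then have "isCont h t" using cont by (simp add: continuous_on_eq_continuous_at)
      then have "isCont (\<lambda>t. \<bar>R t\<bar> - of_rat e' * t\<^sup>2) t" unfolding R_def by (intro continuous_intros)
      then have "((\<lambda>t. \<bar>R t\<bar> - of_rat e' * t\<^sup>2) \<longlongrightarrow> \<bar>R t\<bar> - of_rat e' * t\<^sup>2) (at t)" by (simp add: isCont_def)
      from order_tendstoD(1)[OF this pos] obtain \<eta> where \<eta>: "\<eta> > 0"
        "\<And>x. x \<noteq> t \<Longrightarrow> dist x t < \<eta> \<Longrightarrow> 0 < \<bar>R x\<bar> - of_rat e' * x\<^sup>2"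
        by (auto simp: eventually_at)
      have "t < min d (t + \<eta>)" using t \<eta>(1) by auto
      then obtain x :: rat where x: "t < of_rat x" "of_rat x < min d (t + \<eta>)" using of_rat_dense by blast
      have "0 < \<bar>R (of_rat x)\<bar> - of_rat e' * (of_rat x)\<^sup>2"
        using x by (intro \<eta>(2)) (auto simp: dist_real_def)
      moreover have "- of_rat d' < real_of_rat x" "real_of_rat x < of_rat d'"
        using x t by (auto simp: d_def abs_less_iff)
      then have "\<bar>R (of_rat x)\<bar> \<le> of_rat e' * (of_rat x)\<^sup>2"
        by (intro d'(2)) linarith
      ultimately show False by simp
    qed
    ultimately show "\<exists>d>0. \<forall>t. \<bar>t\<bar> < d \<longrightarrow> \<bar>h t - h 0 - slope_limit h * t - curvature_limit h * t\<^sup>2\<bar> \<le> e * t\<^sup>2"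
      unfolding R_def by blast
  qed
  then show "\<exists>a q. second_order_at_0 h a q" by blast
qed

section \<open>Second-order expansions along a fixed direction\<close>

lemma nn_integral_lborel_shift:
  fixes F :: "'a::euclidean_space \<Rightarrow> ennreal"
  assumes [measurable]: "F \<in> borel_measurable borel"
  shows "(\<integral>\<^sup>+x. F (x + c) \<partial>lborel) = (\<integral>\<^sup>+x. F x \<partial>lborel)"
proof -
  have "(\<integral>\<^sup>+x. F x \<partial>lborel) = (\<integral>\<^sup>+x. F x \<partial>distr lborel borel ((+) c))" by (simp add: lborel_distr_plus)
  also have "\<dots> = (\<integral>\<^sup>+x. F (c + x) \<partial>lborel)" by (rule nn_integral_distr) auto
  finally show ?thesis by (simp add: add.commute)
qed

text \<open>Averaging the translates \<open>N - s e\<close> over \<open>s \<in> [0, 1]\<close> and exchanging the integrals reduces the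
  measure of \<open>N\<close> to its intersections with the lines in direction \<open>e\<close>; this avoids choosing
  coordinates adapted to \<open>e\<close>.\<close>

lemma negligible_if_null_on_lines:
  fixes N :: "'a::euclidean_space set"
  assumes N[measurable]: "N \<in> sets borel"
    and lines: "\<And>x. negligible {s::real. x + s *\<^sub>R e \<in> N}"
  shows "negligible N"
proof -
  have "emeasure lborel N = (\<integral>\<^sup>+s. indicator {0..1::real} s * emeasure lborel N \<partial>lborel)"
    by (simp add: nn_integral_multc)
  also have "\<dots> = (\<integral>\<^sup>+s. (\<integral>\<^sup>+x. indicator {0..1::real} s * indicator N (x + s *\<^sub>R e) \<partial>lborel) \<partial>lborel)"
    by (intro nn_integral_cong) (simp add: nn_integral_cmult nn_integral_lborel_shift[of "indicator N"])
  also have "\<dots> = (\<integral>\<^sup>+x. (\<integral>\<^sup>+s. indicator {0..1::real} s * indicator N (x + s *\<^sub>R e) \<partial>lborel) \<partial>lborel)"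
    by (rule lborel_pair.Fubini') measurable
  also have "\<dots> = (\<integral>\<^sup>+x. 0 \<partial>(lborel::'a measure))"
  proof (rule nn_integral_cong)
    fix x :: 'a
    define M where "M = {s::real. x + s *\<^sub>R e \<in> N}"
    have M[measurable]: "M \<in> sets borel" unfolding M_def by measurable
    have "M \<in> null_sets lborel"
      using lines[of x] M by (auto simp: negligible_iff_null_sets null_sets_completion_iff M_def[symmetric])
    have "(\<integral>\<^sup>+s. indicator {0..1::real} s * indicator N (x + s *\<^sub>R e) \<partial>lborel) \<le> (\<integral>\<^sup>+s. indicator M s \<partial>lborel)"
      by (intro nn_integral_mono) (auto simp: M_def indicator_def)
    also have "\<dots> = 0" using \<open>M \<in> null_sets lborel\<close> by (simp add: null_setsD1)
    finally show "(\<integral>\<^sup>+s. indicator {0..1::real} s * indicator N (x + s *\<^sub>R e) \<partial>lborel) = 0" by simp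
  qed
  finally have "emeasure lborel N = 0" by simp
  then have "N \<in> null_sets lborel" by (intro null_setsI) auto
  then show ?thesis
    by (simp add: negligible_iff_null_sets null_sets_completionI)
qed

lemma convex_on_line:
  fixes f :: "'a::real_vector \<Rightarrow> real"
  assumes "convex_on U f"
  shows "convex_on {s. x + s *\<^sub>R e \<in> U} (\<lambda>s. f (x + s *\<^sub>R e))"
proof -
  have eq: "x + (u * s + v * t) *\<^sub>R e = u *\<^sub>R (x + s *\<^sub>R e) + v *\<^sub>R (x + t *\<^sub>R e)" if "u + v = 1" for u v s t :: real
  proof -
    have "u *\<^sub>R x + v *\<^sub>R x = x" using that by (simp flip: scaleR_left_distrib)
    then show ?thesis by (simp add: algebra_simps)
  qed
  have cU: "convex U" using assms by (rule convex_on_imp_convex)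
  show ?thesis
    unfolding convex_on_def
  proof (intro conjI ballI allI impI)
    show "convex {s. x + s *\<^sub>R e \<in> U}"
      unfolding convex_def
    proof (intro ballI allI impI)
      fix s t u v :: real
      assume *: "s \<in> {s. x + s *\<^sub>R e \<in> U}" "t \<in> {s. x + s *\<^sub>R e \<in> U}" "0 \<le> u" "0 \<le> v" "u + v = 1"
      have "x + (u * s + v * t) *\<^sub>R e \<in> U"
        unfolding eq[OF *(5)] using * by (intro convexD[OF cU]) auto
      then show "u *\<^sub>R s + v *\<^sub>R t \<in> {s. x + s *\<^sub>R e \<in> U}" by simp
    qed
  next
    fix s t u v :: real
    assume *: "s \<in> {s. x + s *\<^sub>R e \<in> U}" "t \<in> {s. x + s *\<^sub>R e \<in> U}" "0 \<le> u" "0 \<le> v" "u + v = 1"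
    have "f (u *\<^sub>R (x + s *\<^sub>R e) + v *\<^sub>R (x + t *\<^sub>R e)) \<le> u * f (x + s *\<^sub>R e) + v * f (x + t *\<^sub>R e)"
      using assms * unfolding convex_on_def by blast
    then show "f (x + (u *\<^sub>R s + v *\<^sub>R t) *\<^sub>R e) \<le> u * f (x + s *\<^sub>R e) + v * f (x + t *\<^sub>R e)"
      by (simp add: eq[OF *(5)])
  qed
qed

text \<open>Shifted arguments may leave the domain \<open>U\<close>, where nothing is known about \<open>f\<close>; the extension by
  zero makes shifted expressions Borel measurable on the whole space.\<close>

lemma zero_extension_borel:
  fixes f :: "'a::euclidean_space \<Rightarrow> real"
  assumes "open U" "continuous_on U f"
  shows "(\<lambda>x. if x \<in> U then f x else 0) \<in> borel_measurable borel"
  by (rule borel_measurable_continuous_on_if) (use assms in auto)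

text \<open>On each line this is the one-variable result. The rational criterion shows that the exceptional
  set is Borel, so that its null sections add up to a null set.\<close>

theorem convex_second_order_ae_along:
  fixes f :: "'a::euclidean_space \<Rightarrow> real"
  assumes conv: "convex_on U f" and "open U"
  shows "negligible {x \<in> U. \<not> (\<exists>a q. second_order_at_0 (\<lambda>t. f (x + t *\<^sub>R e)) a q)}"
proof -
  have cont: "continuous_on U f" using convex_on_continuous[OF \<open>open U\<close> conv] .
  define f0 where "f0 = (\<lambda>x. if x \<in> U then f x else 0)"
  have f0[measurable]: "f0 \<in> borel_measurable borel"
    unfolding f0_def by (rule zero_extension_borel) fact+
  define N where "N = {x \<in> U. \<not> rational_second_order (\<lambda>t. f0 (x + t *\<^sub>R e))}"
  have U[measurable]: "U \<in> sets borel" using \<open>open U\<close> by auto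
  have N: "N \<in> sets borel"
    unfolding N_def rational_second_order_def slope_limit_def curvature_limit_def by measurable
  have crit: "(\<exists>a q. second_order_at_0 (\<lambda>t. f (x + t *\<^sub>R e)) a q) \<longleftrightarrow> rational_second_order (\<lambda>t. f0 (x + t *\<^sub>R e))"
    if "x \<in> U" for x
  proof -
    obtain r where r: "r > 0" "ball x r \<subseteq> U" using \<open>open U\<close> \<open>x \<in> U\<close> by (meson open_contains_ball)
    define \<rho> where "\<rho> = r / (norm e + 1)"
    have \<rho>: "\<rho> > 0" using r by (simp add: \<rho>_def add_nonneg_pos)
    have inU: "x + t *\<^sub>R e \<in> U" if "\<bar>t\<bar> < \<rho>" for t
    proof -
      have "\<bar>t\<bar> * norm e \<le> \<bar>t\<bar> * (norm e + 1)" by (intro mult_left_mono) auto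
      also have "\<dots> < r" using that by (simp add: \<rho>_def pos_less_divide_eq add_nonneg_pos)
      finally have "x + t *\<^sub>R e \<in> ball x r" by (simp add: dist_norm)
      then show ?thesis using r by blast
    qed
    have ev: "eventually (\<lambda>t. f (x + t *\<^sub>R e) = f0 (x + t *\<^sub>R e)) (nhds 0)"
      unfolding eventually_nhds_metric using \<rho> inU by (intro exI[of _ \<rho>]) (auto simp: f0_def)
    have c: "continuous_on {-\<rho><..<\<rho>} (\<lambda>t. f0 (x + t *\<^sub>R e))"
    proof -
      have "continuous_on {-\<rho><..<\<rho>} (\<lambda>t. f (x + t *\<^sub>R e))"
        by (intro continuous_on_compose2[OF cont] continuous_intros) (auto intro!: inU simp: abs_less_iff)
      then show ?thesis
        by (rule continuous_on_eq) (use inU in \<open>auto simp: f0_def abs_less_iff\<close>)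
    qed
    show ?thesis
      unfolding second_order_at_0_cong[OF ev] by (rule second_order_iff_rational[OF c \<rho>])
  qed
  have "negligible N"
  proof (rule negligible_if_null_on_lines[OF N, of e])
    fix x
    define I where "I = {s. x + s *\<^sub>R e \<in> U}"
    define \<phi> where "\<phi> = (\<lambda>s. f (x + s *\<^sub>R e))"
    have "open ((\<lambda>s. x + s *\<^sub>R e) -` U)"
      by (rule open_vimage[OF \<open>open U\<close>]) (intro continuous_intros)
    then have "open I" by (simp add: I_def vimage_def)
    moreover have "convex_on I \<phi>" unfolding I_def \<phi>_def by (rule convex_on_line[OF conv])
    ultimately have "negligible {s \<in> I. \<not> (\<exists>a q. second_order_at_0 (\<lambda>t. \<phi> (s + t)) a q)}"
      by (intro convex_second_order_ae_real)
    moreover have "{s. x + s *\<^sub>R e \<in> N} = {s \<in> I. \<not> (\<exists>a q. second_order_at_0 (\<lambda>t. \<phi> (s + t)) a q)}"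
    proof -
      have eq: "(\<lambda>t. \<phi> (s + t)) = (\<lambda>t. f ((x + s *\<^sub>R e) + t *\<^sub>R e))" for s
        by (simp add: \<phi>_def scaleR_left_distrib add.assoc)
      show ?thesis unfolding eq N_def I_def using crit by blast
    qed
    ultimately show "negligible {s. x + s *\<^sub>R e \<in> N}" by simp
  qed
  moreover have "{x \<in> U. \<not> (\<exists>a q. second_order_at_0 (\<lambda>t. f (x + t *\<^sub>R e)) a q)} = N"
    unfolding N_def using crit by auto
  ultimately show ?thesis by simp
qed

section \<open>Second differences at shifted points\<close>

lemma ball_borel_measurable [measurable]: "ball c r \<in> sets borel"
  by simp

lemma nn_integral_ball_tendsto_0:
  fixes u :: "nat \<Rightarrow> 'a::euclidean_space \<Rightarrow> real"
  assumes [measurable]: "\<And>k. u k \<in> borel_measurable borel"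
    and bd: "\<And>k x. u k x \<le> K" and lim: "AE x in lborel. (\<lambda>k. u k x) \<longlonglongrightarrow> 0"
  shows "(\<lambda>k. \<integral>\<^sup>+x. ennreal (u k x) * indicator (ball 0 R) x \<partial>lborel) \<longlonglongrightarrow> 0"
proof -
  have "(\<lambda>k. \<integral>\<^sup>+x. ennreal (u k x) * indicator (ball 0 R) x \<partial>lborel) \<longlonglongrightarrow> (\<integral>\<^sup>+x. 0 \<partial>(lborel::'a measure))"
  proof (rule nn_integral_dominated_convergence[where w = "\<lambda>x. ennreal K * indicator (ball 0 R) x"])
    show "AE x in lborel. ennreal (u j x) * indicator (ball 0 R) x \<le> ennreal K * indicator (ball 0 R) x" for j
      using bd by (intro AE_I2 mult_right_mono ennreal_leI) auto
    have "(\<integral>\<^sup>+x. ennreal K * indicator (ball 0 R) (x::'a) \<partial>lborel) = ennreal K * emeasure lborel (ball (0::'a) R)"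
      by (rule nn_integral_cmult_indicator) auto
    also have "\<dots> < \<infinity>" using emeasure_lborel_ball_finite[of "0::'a" R] by (simp add: ennreal_mult_less_top)
    finally show "(\<integral>\<^sup>+x. ennreal K * indicator (ball 0 R) (x::'a) \<partial>lborel) < \<infinity>" .
    show "AE x in lborel. (\<lambda>k. ennreal (u k x) * indicator (ball 0 R) x) \<longlonglongrightarrow> 0"
      using lim
    proof eventually_elim
      case (elim x)
      have "(\<lambda>k. ennreal (u k x)) \<longlonglongrightarrow> ennreal 0" by (intro tendsto_intros elim)
      then show ?case by (cases "x \<in> ball 0 R") simp_all
    qed
  qed auto
  then show ?thesis by simp
qed

lemma continuous_approximation_ae:
  fixes a :: "'a::euclidean_space \<Rightarrow> real"
  assumes [measurable]: "a \<in> borel_measurable borel" and bd: "\<And>x. \<bar>a x\<bar> \<le> K"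
  obtains c where "\<And>j::nat. continuous_on UNIV (c j)" "\<And>j x. \<bar>c j x\<bar> \<le> K"
    "AE x in lborel. (\<lambda>j. c j x) \<longlonglongrightarrow> a x"
proof -
  have "a \<in> borel_measurable (lebesgue_on UNIV)"
    using assms(1) by (simp add: measurable_completion lebesgue_on_UNIV_eq)
  then have "a measurable_on UNIV"
    by (intro lebesgue_measurable_imp_measurable_on) (auto simp: lebesgue_on_UNIV_eq)
  then obtain N g where N: "negligible N" "\<And>n. continuous_on UNIV (g n)"
    "\<And>x. x \<notin> N \<Longrightarrow> (\<lambda>n. g n x) \<longlonglongrightarrow> a x"
    unfolding measurable_on_def by auto
  \<comment> \<open>Truncation makes the approximations uniformly bounded and leaves the limit unchanged.\<close>
  define c where "c = (\<lambda>j x. max (-K) (min K (g j x)))"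
  show thesis
  proof (rule that[of c])
    show "continuous_on UNIV (c j)" for j :: nat
      unfolding c_def by (intro continuous_intros N)
    have "K \<ge> 0" using bd[of 0] by linarith
    then show "\<bar>c j x\<bar> \<le> K" for j x by (auto simp: c_def)
    have "AE x in lebesgue. x \<notin> N"
      using N(1) by (intro AE_not_in) (simp add: negligible_iff_null_sets)
    then have "AE x in lebesgue. (\<lambda>j. c j x) \<longlonglongrightarrow> a x"
    proof eventually_elim
      case (elim x)
      have "(\<lambda>j. c j x) \<longlonglongrightarrow> max (-K) (min K (a x))"
        unfolding c_def by (intro tendsto_intros N(3) elim)
      moreover have "max (-K) (min K (a x)) = a x" using bd[of x] by auto
      ultimately show ?case by simp
    qed
    then show "AE x in lborel. (\<lambda>j. c j x) \<longlonglongrightarrow> a x"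
      by (simp add: AE_completion_iff)
  qed
qed

lemma nn_integral_shifted_ball_le:
  fixes F :: "'a::euclidean_space \<Rightarrow> ennreal"
  assumes F[measurable]: "F \<in> borel_measurable borel" and "norm v \<le> 1"
  shows "(\<integral>\<^sup>+x. F (x + v) * indicator (ball 0 R) x \<partial>lborel) \<le> (\<integral>\<^sup>+x. F x * indicator (ball 0 (R + 1)) x \<partial>lborel)"
proof -
  have "(\<integral>\<^sup>+x. F (x + v) * indicator (ball 0 R) x \<partial>lborel)
      \<le> (\<integral>\<^sup>+x. F (x + v) * indicator (ball 0 (R + 1)) (x + v) \<partial>lborel)"
  proof (rule nn_integral_mono)
    fix x :: 'a
    have "norm (x + v) < R + 1" if "norm x < R"
      using norm_triangle_ineq[of x v] that \<open>norm v \<le> 1\<close> by linarith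
    then show "F (x + v) * indicator (ball 0 R) x \<le> F (x + v) * indicator (ball 0 (R + 1)) (x + v)"
      by (auto simp: indicator_def)
  qed
  also have "\<dots> = (\<integral>\<^sup>+x. F x * indicator (ball 0 (R + 1)) x \<partial>lborel)"
    by (rule nn_integral_lborel_shift[of "\<lambda>x. F x * indicator (ball 0 (R + 1)) x"]) measurable
  finally show ?thesis .
qed

text \<open>The limit \<open>a\<close> is compared with a continuous function \<open>c\<close>, for which small shifts cause small
  changes. The other three error terms are bounded by integrals of unshifted quantities over a slightly larger
  ball, by translation invariance.\<close>

lemma shifted_L1_tendsto_0:
  fixes g :: "nat \<Rightarrow> 'a::euclidean_space \<Rightarrow> real"
  assumes [measurable]: "\<And>k. g k \<in> borel_measurable borel" "a \<in> borel_measurable borel"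
    and bd: "\<And>k x. \<bar>g k x\<bar> \<le> K" "\<And>x. \<bar>a x\<bar> \<le> K"
    and lim: "AE x in lborel. (\<lambda>k. g k x) \<longlonglongrightarrow> a x" and v: "v \<longlonglongrightarrow> 0"
  shows "(\<lambda>k. \<integral>\<^sup>+x. ennreal \<bar>g k (x + v k) - a x\<bar> * indicator (ball 0 R) x \<partial>lborel) \<longlonglongrightarrow> 0"
proof (rule order_tendstoI)
  fix y :: ennreal assume "0 < y"
  then obtain y' where y': "0 < y'" "y' < y" using dense by blast
  then obtain e where e: "y' = ennreal e" "e > 0"
    by (cases y') (auto simp: top_unique dest: less_trans)
  define \<epsilon> where "\<epsilon> = ennreal (e / 4)"
  have \<epsilon>: "0 < \<epsilon>" using e by (simp add: \<epsilon>_def)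
  have sum\<epsilon>: "\<epsilon> + \<epsilon> + \<epsilon> + \<epsilon> = y'"
    using e by (simp add: \<epsilon>_def e(1) flip: ennreal_plus)
  obtain c where c: "\<And>j::nat. continuous_on UNIV (c j)" "\<And>j x. \<bar>c j x\<bar> \<le> K"
    "AE x in lborel. (\<lambda>j. c j x) \<longlonglongrightarrow> a x"
    using continuous_approximation_ae[OF assms(2) bd(2)] by blast
  have cm[measurable]: "c j \<in> borel_measurable borel" for j
    by (rule borel_measurable_continuous_onI) (rule c)
  let ?J = "\<lambda>u. \<integral>\<^sup>+x. ennreal (u x) * indicator (ball (0::'a) (R + 1)) x \<partial>lborel"
  have "(\<lambda>j. ?J (\<lambda>x. \<bar>c j x - a x\<bar>)) \<longlonglongrightarrow> 0"
  proof (rule nn_integral_ball_tendsto_0)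
    show "\<bar>c j x - a x\<bar> \<le> 2 * K" for j x using c(2)[of j x] bd(2)[of x] by linarith
    show "AE x in lborel. (\<lambda>k. \<bar>c k x - a x\<bar>) \<longlonglongrightarrow> 0"
      using c(3) by eventually_elim (auto intro!: tendsto_rabs_zero simp: LIM_zero)
  qed measurable
  from order_tendstoD(2)[OF this \<epsilon>] obtain j where j: "?J (\<lambda>x. \<bar>c j x - a x\<bar>) < \<epsilon>"
    by (auto simp: eventually_sequentially)
  have "(\<lambda>k. ?J (\<lambda>x. \<bar>g k x - a x\<bar>)) \<longlonglongrightarrow> 0"
  proof (rule nn_integral_ball_tendsto_0)
    show "\<bar>g k x - a x\<bar> \<le> 2 * K" for k x using bd(1)[of k x] bd(2)[of x] by linarith
    show "AE x in lborel. (\<lambda>k. \<bar>g k x - a x\<bar>) \<longlonglongrightarrow> 0"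
      using lim by eventually_elim (auto intro!: tendsto_rabs_zero simp: LIM_zero)
  qed measurable
  from order_tendstoD(2)[OF this \<epsilon>]
  have 1: "eventually (\<lambda>k. ?J (\<lambda>x. \<bar>g k x - a x\<bar>) < \<epsilon>) sequentially" .
  have "(\<lambda>k. \<integral>\<^sup>+x. ennreal \<bar>c j (x + v k) - c j x\<bar> * indicator (ball 0 R) x \<partial>lborel) \<longlonglongrightarrow> 0"
  proof (rule nn_integral_ball_tendsto_0)
    show "\<bar>c j (x + v k) - c j x\<bar> \<le> 2 * K" for k x using c(2)[of j x] c(2)[of j "x + v k"] by linarith
    show "AE x in lborel. (\<lambda>k. \<bar>c j (x + v k) - c j x\<bar>) \<longlonglongrightarrow> 0"
    proof (rule AE_I2)
      fix x
      have "isCont (c j) x" using c(1)[of j] by (simp add: continuous_on_eq_continuous_at)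
      moreover have "(\<lambda>k. x + v k) \<longlonglongrightarrow> x" using tendsto_add[OF tendsto_const v] by simp
      ultimately have "(\<lambda>k. c j (x + v k)) \<longlonglongrightarrow> c j x" by (rule isCont_tendsto_compose)
      then show "(\<lambda>k. \<bar>c j (x + v k) - c j x\<bar>) \<longlonglongrightarrow> 0"
        by (auto intro!: tendsto_rabs_zero simp: LIM_zero)
    qed
  qed measurable
  from order_tendstoD(2)[OF this \<epsilon>]
  have 2: "eventually (\<lambda>k. (\<integral>\<^sup>+x. ennreal \<bar>c j (x + v k) - c j x\<bar> * indicator (ball 0 R) x \<partial>lborel) < \<epsilon>) sequentially" .
  have 3: "eventually (\<lambda>k. norm (v k) < 1) sequentially"
    using v by (auto simp: tendsto_iff dist_norm dest: spec[of _ 1])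
  from 1 2 3 show "eventually (\<lambda>k. (\<integral>\<^sup>+x. ennreal \<bar>g k (x + v k) - a x\<bar> * indicator (ball 0 R) x \<partial>lborel) < y) sequentially"
  proof eventually_elim
    case (elim k)
    let ?B = "indicator (ball (0::'a) R) :: 'a \<Rightarrow> ennreal"
    let ?t1 = "\<lambda>x. ennreal \<bar>g k (x + v k) - a (x + v k)\<bar> * ?B x"
    let ?t2 = "\<lambda>x. ennreal \<bar>c j (x + v k) - a (x + v k)\<bar> * ?B x"
    let ?t3 = "\<lambda>x. ennreal \<bar>c j (x + v k) - c j x\<bar> * ?B x"
    let ?t4 = "\<lambda>x. ennreal \<bar>c j x - a x\<bar> * ?B x"
    have "(\<integral>\<^sup>+x. ennreal \<bar>g k (x + v k) - a x\<bar> * ?B x \<partial>lborel)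
       \<le> (\<integral>\<^sup>+x. ?t1 x + ?t2 x + ?t3 x + ?t4 x \<partial>lborel)"
    proof (rule nn_integral_mono)
      fix x
      have "\<bar>g k (x + v k) - a x\<bar> \<le> \<bar>g k (x + v k) - a (x + v k)\<bar> + \<bar>c j (x + v k) - a (x + v k)\<bar>
          + \<bar>c j (x + v k) - c j x\<bar> + \<bar>c j x - a x\<bar>" (is "_ \<le> ?s") by linarith
      then have "ennreal \<bar>g k (x + v k) - a x\<bar> * ?B x \<le> ennreal ?s * ?B x"
        by (intro mult_right_mono ennreal_leI) auto
      then show "ennreal \<bar>g k (x + v k) - a x\<bar> * ?B x \<le> ?t1 x + ?t2 x + ?t3 x + ?t4 x"
        by (simp add: distrib_right)
    qed
    also have "\<dots> = integral\<^sup>N lborel ?t1 + integral\<^sup>N lborel ?t2 + integral\<^sup>N lborel ?t3 + integral\<^sup>N lborel ?t4"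
      by (subst nn_integral_add, measurable)+
    also have "\<dots> \<le> ?J (\<lambda>x. \<bar>g k x - a x\<bar>) + ?J (\<lambda>x. \<bar>c j x - a x\<bar>) + integral\<^sup>N lborel ?t3 + ?J (\<lambda>x. \<bar>c j x - a x\<bar>)"
    proof (intro add_mono order_refl)
      show "integral\<^sup>N lborel ?t1 \<le> ?J (\<lambda>x. \<bar>g k x - a x\<bar>)"
        using nn_integral_shifted_ball_le[of "\<lambda>x. ennreal \<bar>g k x - a x\<bar>" "v k" R] elim by simp
      show "integral\<^sup>N lborel ?t2 \<le> ?J (\<lambda>x. \<bar>c j x - a x\<bar>)"
        using nn_integral_shifted_ball_le[of "\<lambda>x. ennreal \<bar>c j x - a x\<bar>" "v k" R] elim by simp
      show "integral\<^sup>N lborel ?t4 \<le> ?J (\<lambda>x. \<bar>c j x - a x\<bar>)"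
        using nn_integral_shifted_ball_le[of "\<lambda>x. ennreal \<bar>c j x - a x\<bar>" 0 R] by simp
    qed
    also have "\<dots> \<le> \<epsilon> + \<epsilon> + \<epsilon> + \<epsilon>"
      using elim j by (intro add_mono) auto
    also have "\<dots> < y" using y' sum\<epsilon> by simp
    finally show ?case .
  qed
qed simp

text \<open>Convergence \<open>g k x \<longlonglongrightarrow> a x\<close> almost everywhere persists along small shifts in mean, and hence,
  by Fatou's lemma, almost everywhere along a subsequence depending on the point. The limit is assumed
  for the whole sequence, so a subsequence suffices to identify it. The arctangent makes the functions
  bounded without affecting convergence.\<close>

lemma shifted_second_difference_ae:
  fixes g :: "nat \<Rightarrow> 'a::euclidean_space \<Rightarrow> real"
  assumes g[measurable]: "\<And>k. g k \<in> borel_measurable borel"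
    and conv: "AE x in lborel. convergent (\<lambda>k. g k x)" and v: "v \<longlonglongrightarrow> 0"
  shows "AE x in lborel. \<forall>L. (\<lambda>k. g k (x + v k) + g k (x - v k) - 2 * g k x) \<longlonglongrightarrow> L \<longrightarrow> L = 0"
proof -
  define a where "a = (\<lambda>x. lim (\<lambda>k. g k x))"
  have a[measurable]: "a \<in> borel_measurable borel"
    unfolding a_def by measurable
  have lim: "AE x in lborel. (\<lambda>k. g k x) \<longlonglongrightarrow> a x"
    using conv by eventually_elim (simp add: a_def convergent_LIMSEQ_iff)
  \<comment> \<open>The parameter \<open>s\<close> takes the values 1 and -1, so that both shifts are controlled along the same subsequence.\<close>
  define h where "h = (\<lambda>s k x. \<bar>arctan (g k (x + s *\<^sub>R v k)) - arctan (a x)\<bar>)"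
  have h[measurable]: "h s k \<in> borel_measurable borel" for s k
    unfolding h_def by measurable
  have h0: "(\<lambda>k. \<integral>\<^sup>+x. ennreal (h s k x) * indicator (ball 0 R) x \<partial>lborel) \<longlonglongrightarrow> 0" for s R
    unfolding h_def
  proof (rule shifted_L1_tendsto_0)
    show "\<bar>arctan (g k x)\<bar> \<le> pi / 2" "\<bar>arctan (a x)\<bar> \<le> pi / 2" for k x
      using arctan_bounded[of "g k x"] arctan_bounded[of "a x"] by (auto simp: abs_le_iff)
    show "AE x in lborel. (\<lambda>k. arctan (g k x)) \<longlonglongrightarrow> arctan (a x)"
      using lim by eventually_elim (intro tendsto_intros)
    show "(\<lambda>k. s *\<^sub>R v k) \<longlonglongrightarrow> 0" using tendsto_scaleR[OF tendsto_const v, of s] by simp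
  qed measurable
  have "AE x in lborel. liminf (\<lambda>k. ennreal (h 1 k x + h (-1) k x) * indicator (ball 0 R) x) = 0" for R
  proof -
    have "(\<integral>\<^sup>+x. liminf (\<lambda>k. ennreal (h 1 k x + h (-1) k x) * indicator (ball 0 R) x) \<partial>lborel)
        \<le> liminf (\<lambda>k. \<integral>\<^sup>+x. ennreal (h 1 k x + h (-1) k x) * indicator (ball 0 R) x \<partial>lborel)"
      by (rule nn_integral_liminf) measurable
    also have "(\<lambda>k. \<integral>\<^sup>+x. ennreal (h 1 k x + h (-1) k x) * indicator (ball 0 R) x \<partial>lborel) \<longlonglongrightarrow> 0"
    proof -
      have "(\<integral>\<^sup>+x. ennreal (h 1 k x + h (-1) k x) * indicator (ball 0 R) x \<partial>lborel)
        = (\<integral>\<^sup>+x. ennreal (h 1 k x) * indicator (ball 0 R) x \<partial>lborel) + (\<integral>\<^sup>+x. ennreal (h (-1) k x) * indicator (ball 0 R) x \<partial>lborel)" for k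
      proof -
        have "h s k x \<ge> 0" for s x by (simp add: h_def)
        then show ?thesis by (simp add: distrib_right nn_integral_add)
      qed
      then show ?thesis using tendsto_add[OF h0[of 1 R] h0[of "-1" R]] by simp
    qed
    then have "liminf (\<lambda>k. \<integral>\<^sup>+x. ennreal (h 1 k x + h (-1) k x) * indicator (ball 0 R) x \<partial>lborel) = 0"
      by (rule lim_imp_Liminf[OF trivial_limit_sequentially])
    finally have "(\<integral>\<^sup>+x. liminf (\<lambda>k. ennreal (h 1 k x + h (-1) k x) * indicator (ball 0 R) x) \<partial>lborel) = 0" by simp
    then show ?thesis by (subst (asm) nn_integral_0_iff_AE) auto
  qed
  then have "AE x in lborel. \<forall>R::nat. liminf (\<lambda>k. ennreal (h 1 k x + h (-1) k x) * indicator (ball 0 (real R)) x) = 0"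
    by (subst AE_all_countable) auto
  with lim show ?thesis
  proof eventually_elim
    case (elim x)
    obtain R :: nat where "norm x < real R" using reals_Archimedean2 by blast
    then have li: "liminf (\<lambda>k. ennreal (h 1 k x + h (-1) k x)) = 0" using elim(2)[rule_format, of R] by simp
    show ?case
    proof (intro allI impI)
      fix L assume L: "(\<lambda>k. g k (x + v k) + g k (x - v k) - 2 * g k x) \<longlonglongrightarrow> L"
      have freq: "\<exists>k\<ge>n. h 1 k x + h (-1) k x < 1 / real (Suc n)" for n
      proof (rule ccontr)
        assume "\<not> ?thesis"
        then have "\<And>k. k \<ge> n \<Longrightarrow> 1 / real (Suc n) \<le> h 1 k x + h (-1) k x" by (auto simp: not_less)
        then have "eventually (\<lambda>k. ennreal (1 / real (Suc n)) \<le> ennreal (h 1 k x + h (-1) k x)) sequentially"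
          unfolding eventually_sequentially by (intro exI[of _ n] allI impI ennreal_leI)
        then have "ennreal (1 / real (Suc n)) \<le> liminf (\<lambda>k. ennreal (h 1 k x + h (-1) k x))"
          by (rule Liminf_bounded)
        with li have "ennreal (1 / real (Suc n)) \<le> 0" by simp
        then show False by (simp add: ennreal_eq_0_iff)
      qed
      then obtain \<sigma> where \<sigma>: "\<And>n. \<sigma> n \<ge> n" "\<And>n. h 1 (\<sigma> n) x + h (-1) (\<sigma> n) x < 1 / real (Suc n)" by metis
      have \<sigma>_lim: "filterlim \<sigma> at_top sequentially"
        using \<sigma>(1) by (intro filterlim_at_top_mono[OF filterlim_ident]) auto
      have conv1: "(\<lambda>n. g (\<sigma> n) (x + s *\<^sub>R v (\<sigma> n))) \<longlonglongrightarrow> a x" if "s = 1 \<or> s = -1" for s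
      proof -
        have "(\<lambda>n. arctan (g (\<sigma> n) (x + s *\<^sub>R v (\<sigma> n))) - arctan (a x)) \<longlonglongrightarrow> 0"
        proof (rule Lim_null_comparison)
          have "h 1 k x \<ge> 0" "h (-1) k x \<ge> 0" for k by (simp_all add: h_def)
          then have "h s (\<sigma> n) x \<le> 1 / real (Suc n)" for n
            using \<sigma>(2)[of n] that by (smt (verit))
          then show "eventually (\<lambda>n. norm (arctan (g (\<sigma> n) (x + s *\<^sub>R v (\<sigma> n))) - arctan (a x)) \<le> 1 / real (Suc n)) sequentially"
            by (intro always_eventually) (simp add: h_def)
          show "(\<lambda>n. 1 / real (Suc n)) \<longlonglongrightarrow> 0" by (rule LIMSEQ_Suc[OF lim_1_over_n])
        qed
        then have "(\<lambda>n. arctan (g (\<sigma> n) (x + s *\<^sub>R v (\<sigma> n)))) \<longlonglongrightarrow> arctan (a x)" by (simp add: LIM_zero_iff)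
        then have "(\<lambda>n. tan (arctan (g (\<sigma> n) (x + s *\<^sub>R v (\<sigma> n))))) \<longlonglongrightarrow> tan (arctan (a x))"
          by (rule isCont_tendsto_compose[OF isCont_tan[OF cos_arctan_not_zero]])
        then show ?thesis by (simp add: tan_arctan)
      qed
      have "(\<lambda>n. g (\<sigma> n) (x + v (\<sigma> n)) + g (\<sigma> n) (x - v (\<sigma> n)) - 2 * g (\<sigma> n) x) \<longlonglongrightarrow> a x + a x - 2 * a x"
        using conv1[of 1] conv1[of "-1"] filterlim_compose[OF elim(1) \<sigma>_lim]
        by (intro tendsto_intros) auto
      moreover have "(\<lambda>n. g (\<sigma> n) (x + v (\<sigma> n)) + g (\<sigma> n) (x - v (\<sigma> n)) - 2 * g (\<sigma> n) x) \<longlonglongrightarrow> L"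
        by (rule filterlim_compose[OF L \<sigma>_lim])
      ultimately show "L = 0" using LIMSEQ_unique by fastforce
    qed
  qed
qed

section \<open>The parallelogram law for second directional derivatives\<close>

lemma negligible_imp_AE_lborel:
  assumes "negligible {x \<in> U. \<not> P x}"
  shows "AE x in lborel. x \<in> U \<longrightarrow> P x"
proof -
  have "AE x in lebesgue. x \<notin> {x \<in> U. \<not> P x}"
    using assms by (intro AE_not_in) (simp add: negligible_iff_null_sets)
  then have "AE x in lebesgue. x \<in> U \<longrightarrow> P x" by eventually_elim auto
  then show ?thesis by (simp add: AE_completion_iff)
qed

lemma AE_lborel_imp_negligible:
  assumes "AE x in lborel. P x"
  shows "negligible {x. \<not> P x}"
proof -
  obtain N where "N \<in> null_sets lborel" "{x \<in> space lborel. \<not> P x} \<subseteq> N"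
    using assms by (auto elim!: AE_E simp: null_sets_def)
  then have "negligible N" "{x. \<not> P x} \<subseteq> N"
    by (auto simp: negligible_iff_null_sets null_sets_completionI)
  then show ?thesis by (rule negligible_subset)
qed

lemma second_order_second_difference:
  assumes "second_order_at_0 h a q"
  shows "(\<lambda>k. (h (1 / real (Suc k)) + h (- (1 / real (Suc k))) - 2 * h 0) * (real (Suc k))\<^sup>2) \<longlonglongrightarrow> 2 * q"
proof -
  have "(\<lambda>k. (h (1 * (1 / real (Suc k))) - h 0 - 1 / real (Suc k) * (1 * a)) / (1 / real (Suc k))\<^sup>2
        + (h (- 1 * (1 / real (Suc k))) - h 0 - 1 / real (Suc k) * (- 1 * a)) / (1 / real (Suc k))\<^sup>2)
      \<longlonglongrightarrow> 1\<^sup>2 * q + (- 1)\<^sup>2 * q"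
    by (intro tendsto_add second_order_blowup[OF assms harmonic_step])
  moreover have "(x - y - t) / (1 / real (Suc k))\<^sup>2 + (z - y + t) / (1 / real (Suc k))\<^sup>2 = (x + z - 2 * y) * (real (Suc k))\<^sup>2"
    for x y z t k by (simp add: power_divide algebra_simps del: of_nat_Suc)
  ultimately show ?thesis by simp
qed

text \<open>With \<open>D e\<close> the second difference in direction \<open>e\<close>, one has the exact identity
  \<open>D (v + w) + D (v - w) - 2 D v - 2 D w = D v (D w)\<close>, a second difference of second differences. On the
  left, division by the squared step gives the defect in the parallelogram law in the limit. On the
  right stands a second difference of almost everywhere convergent functions at vanishing shifts, and
  its only possible limit is 0.\<close>

theorem convex_parallelogram_ae:
  fixes f :: "'a::euclidean_space \<Rightarrow> real" and v w :: 'a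
  assumes conv: "convex_on U f" and "open U"
  defines "S \<equiv> \<lambda>x e q. \<exists>a. second_order_at_0 (\<lambda>t. f (x + t *\<^sub>R e)) a q"
  shows "negligible {x \<in> U. \<not> (\<forall>q1 q2 q3 q4. S x v q1 \<longrightarrow> S x w q2 \<longrightarrow> S x (v + w) q3 \<longrightarrow> S x (v - w) q4
            \<longrightarrow> q3 + q4 = 2 * q1 + 2 * q2)}"
proof -
  have cont: "continuous_on U f" using convex_on_continuous[OF \<open>open U\<close> conv] .
  have U[measurable]: "U \<in> sets borel" using \<open>open U\<close> by auto
  define f0 where "f0 = (\<lambda>x. if x \<in> U then f x else 0)"
  have f0[measurable]: "f0 \<in> borel_measurable borel"
    unfolding f0_def by (rule zero_extension_borel) fact+
  define \<tau> where "\<tau> = (\<lambda>k. 1 / real (Suc k))"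
  have \<tau>: "\<tau> \<longlonglongrightarrow> 0" unfolding \<tau>_def by (rule LIMSEQ_Suc[OF lim_1_over_n])
  define D where "D = (\<lambda>e k x. (f0 (x + \<tau> k *\<^sub>R e) + f0 (x - \<tau> k *\<^sub>R e) - 2 * f0 x) * (real (Suc k))\<^sup>2)"
  \<comment> \<open>Setting \<open>g\<close> to 0 off \<open>U\<close> makes it converge almost everywhere on the whole space.\<close>
  define g where "g = (\<lambda>k x. if x \<in> U then D w k x else 0)"
  have g[measurable]: "g k \<in> borel_measurable borel" for k
    unfolding g_def D_def by measurable
  have ev: "eventually (\<lambda>k. x + \<tau> k *\<^sub>R e \<in> U) sequentially" if "x \<in> U" for x e
  proof -
    have "(\<lambda>k. x + \<tau> k *\<^sub>R e) \<longlonglongrightarrow> x + 0 *\<^sub>R e" by (intro tendsto_intros \<tau>)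
    then show ?thesis using topological_tendstoD[OF _ \<open>open U\<close>] that by simp
  qed
  have Dlim: "(\<lambda>k. D e k x) \<longlonglongrightarrow> 2 * q" if "x \<in> U" "S x e q" for x e q
  proof -
    obtain a where "second_order_at_0 (\<lambda>t. f (x + t *\<^sub>R e)) a q" using \<open>S x e q\<close> unfolding S_def by blast
    from second_order_second_difference[OF this]
    have "(\<lambda>k. (f (x + \<tau> k *\<^sub>R e) + f (x - \<tau> k *\<^sub>R e) - 2 * f x) * (real (Suc k))\<^sup>2) \<longlonglongrightarrow> 2 * q"
      by (simp add: \<tau>_def)
    then show ?thesis
    proof (rule Lim_transform_eventually)
      show "eventually (\<lambda>k. (f (x + \<tau> k *\<^sub>R e) + f (x - \<tau> k *\<^sub>R e) - 2 * f x) * (real (Suc k))\<^sup>2 = D e k x) sequentially"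
        using ev[OF \<open>x \<in> U\<close>, of e] ev[OF \<open>x \<in> U\<close>, of "- e"]
        by eventually_elim (simp add: D_def f0_def \<open>x \<in> U\<close>)
    qed
  qed
  have "AE x in lborel. x \<in> U \<longrightarrow> (\<exists>a q. second_order_at_0 (\<lambda>t. f (x + t *\<^sub>R w)) a q)"
    by (rule negligible_imp_AE_lborel[OF convex_second_order_ae_along[OF conv \<open>open U\<close>]])
  then have "AE x in lborel. convergent (\<lambda>k. g k x)"
  proof eventually_elim
    case (elim x)
    show ?case
    proof (cases "x \<in> U")
      case True
      with elim obtain q where "S x w q" unfolding S_def by blast
      from Dlim[OF True this] show ?thesis using True by (auto simp: g_def convergent_def)
    qed (simp add: g_def convergent_const)
  qed
  moreover have "(\<lambda>k. \<tau> k *\<^sub>R v) \<longlonglongrightarrow> 0" using tendsto_scaleR[OF \<tau> tendsto_const[of v]] by simp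
  ultimately have "AE x in lborel. \<forall>L. (\<lambda>k. g k (x + \<tau> k *\<^sub>R v) + g k (x - \<tau> k *\<^sub>R v) - 2 * g k x) \<longlonglongrightarrow> L \<longrightarrow> L = 0"
    by (intro shifted_second_difference_ae g)
  then have "AE x in lborel. x \<in> U \<longrightarrow> (\<forall>q1 q2 q3 q4. S x v q1 \<longrightarrow> S x w q2 \<longrightarrow> S x (v + w) q3 \<longrightarrow> S x (v - w) q4
            \<longrightarrow> q3 + q4 = 2 * q1 + 2 * q2)"
  proof eventually_elim
    case (elim x)
    show ?case
    proof (intro impI allI)
      fix q1 q2 q3 q4
      assume x: "x \<in> U" and S: "S x v q1" "S x w q2" "S x (v + w) q3" "S x (v - w) q4"
      have "(\<lambda>k. D (v + w) k x + D (v - w) k x - 2 * D v k x - 2 * D w k x)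
          \<longlonglongrightarrow> 2 * q3 + 2 * q4 - 2 * (2 * q1) - 2 * (2 * q2)"
        by (intro tendsto_intros Dlim x S)
      then have "(\<lambda>k. g k (x + \<tau> k *\<^sub>R v) + g k (x - \<tau> k *\<^sub>R v) - 2 * g k x)
          \<longlonglongrightarrow> 2 * q3 + 2 * q4 - 2 * (2 * q1) - 2 * (2 * q2)"
      proof (rule Lim_transform_eventually)
        show "eventually (\<lambda>k. D (v + w) k x + D (v - w) k x - 2 * D v k x - 2 * D w k x
            = g k (x + \<tau> k *\<^sub>R v) + g k (x - \<tau> k *\<^sub>R v) - 2 * g k x) sequentially"
          using ev[OF x, of v] ev[OF x, of "- v"]
        proof eventually_elim
          case (elim k)
          then have inU: "x + \<tau> k *\<^sub>R v \<in> U" "x - \<tau> k *\<^sub>R v \<in> U" by auto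
          have *: "x + \<tau> k *\<^sub>R v + \<tau> k *\<^sub>R w = x + \<tau> k *\<^sub>R (v + w)"
            "x + \<tau> k *\<^sub>R v - \<tau> k *\<^sub>R w = x + \<tau> k *\<^sub>R (v - w)"
            "x - \<tau> k *\<^sub>R v + \<tau> k *\<^sub>R w = x - \<tau> k *\<^sub>R (v - w)"
            "x - \<tau> k *\<^sub>R v - \<tau> k *\<^sub>R w = x - \<tau> k *\<^sub>R (v + w)"
            by (simp_all add: algebra_simps)
          have "g k (x + \<tau> k *\<^sub>R v) = D w k (x + \<tau> k *\<^sub>R v)" "g k (x - \<tau> k *\<^sub>R v) = D w k (x - \<tau> k *\<^sub>R v)" "g k x = D w k x"
            using inU x by (simp_all add: g_def)
          moreover have "(a1 + a2 - 2 * c) * s + (b1 + b2 - 2 * c) * s - 2 * ((v1 + v2 - 2 * c) * s) - 2 * ((w1 + w2 - 2 * c) * s)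
              = (a1 + b1 - 2 * v1) * s + (b2 + a2 - 2 * v2) * s - 2 * ((w1 + w2 - 2 * c) * s)"
            for a1 a2 b1 b2 v1 v2 w1 w2 c s :: real by (simp add: algebra_simps)
          ultimately show ?case
            unfolding D_def * by (simp only:)
        qed
      qed
      with elim have "2 * q3 + 2 * q4 - 2 * (2 * q1) - 2 * (2 * q2) = 0" by blast
      then show "q3 + q4 = 2 * q1 + 2 * q2" by linarith
    qed
  qed
  from AE_lborel_imp_negligible[OF this] show ?thesis
    by (rule negligible_subset) auto
qed

section \<open>Quadratic forms on the integer lattice and convexity\<close>

text \<open>Integer vectors serve as the countable set of directions: they form a group, and their real
  multiples are dense.\<close>

definition lattice_vec :: "int^'n \<Rightarrow> real^'n" where
  "lattice_vec e = (\<chi> i. real_of_int (e $ i))"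

lemma lattice_vec_add: "lattice_vec (e + f) = lattice_vec e + lattice_vec f"
  by (simp add: lattice_vec_def vec_eq_iff)

lemma lattice_vec_diff: "lattice_vec (e - f) = lattice_vec e - lattice_vec f"
  by (simp add: lattice_vec_def vec_eq_iff)

lemma additive_on_lattice:
  fixes T :: "int^'n \<Rightarrow> real"
  assumes add: "\<And>x y. T (x + y) = T x + T y"
  shows "T x = (\<Sum>i\<in>UNIV. real_of_int (x $ i) * T (axis i 1))"
proof -
  have T0: "T 0 = 0" using add[of 0 0] by simp
  have Tneg: "T (- y) = - T y" for y using add[of y "- y"] T0 by simp
  have scale: "T (k *s y) = real_of_int k * T y" for k y
  proof -
    have nat: "T (int n *s y) = real n * T y" for n
    proof (induction n)
      case 0
      have "(0::int) *s y = 0" by (simp add: vec_eq_iff)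
      then show ?case by (simp add: T0)
    next
      case (Suc n)
      have "int (Suc n) *s y = y + int n *s y" by (simp add: vec_eq_iff algebra_simps)
      then show ?case using Suc add[of y "int n *s y"] by (simp add: algebra_simps)
    qed
    show ?thesis
    proof (cases "k \<ge> 0")
      case True
      then show ?thesis using nat[of "nat k"] by simp
    next
      case False
      have "k *s y = - (int (nat (- k)) *s y)" using False by (simp add: vec_eq_iff)
      then show ?thesis using nat[of "nat (- k)"] False by (simp add: Tneg)
    qed
  qed
  have Tsum: "T (\<Sum>i\<in>S. g i) = (\<Sum>i\<in>S. T (g i))" if "finite S" for S and g :: "'n \<Rightarrow> int^'n"
    using that by induction (auto simp: T0 add)
  have "T x = T (\<Sum>i\<in>UNIV. (x $ i) *s axis i 1)" by (simp add: basis_expansion)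
  also have "\<dots> = (\<Sum>i\<in>UNIV. real_of_int (x $ i) * T (axis i 1))" by (simp add: Tsum scale)
  finally show ?thesis .
qed

text \<open>The parallelogram law implies that the third differences of \<open>q\<close> vanish, so its polarization
  is additive in each argument and is determined by its values on the unit vectors.\<close>

lemma parallelogram_quadratic_form:
  fixes q :: "int^'n \<Rightarrow> real"
  assumes par: "\<And>e f. q (e + f) + q (e - f) = 2 * q e + 2 * q f"
  obtains A :: "real^'n^'n" where "transpose A = A"
    "\<And>e. q e = 1 / 2 * ((A *v lattice_vec e) \<bullet> lattice_vec e)"
proof -
  have q0: "q 0 = 0" using par[of 0 0] by simp
  have three: "q (a + b + c) = q (a + b) + q (a + c) + q (b + c) - q a - q b - q c" for a b c
  proof -
    have 1: "q (a + b + c) + q (a + b - c) = 2 * q (a + b) + 2 * q c" by (rule par)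
    have 2: "q (a - c + b) + q (a - c - b) = 2 * q (a - c) + 2 * q b" by (rule par)
    have 3: "q (a + (b + c)) + q (a - (b + c)) = 2 * q a + 2 * q (b + c)" by (rule par)
    have 4: "q (a + c) + q (a - c) = 2 * q a + 2 * q c" by (rule par)
    have "a - c + b = a + b - c" "a - c - b = a - (b + c)" "a + (b + c) = a + b + c" by (simp_all add: algebra_simps)
    with 1 2 3 4 show ?thesis by simp
  qed
  define B where "B = (\<lambda>e f. (q (e + f) - q e - q f) / 2)"
  have B_sym: "B e f = B f e" for e f by (simp add: B_def add.commute)
  have B_add: "B (e + e') f = B e f + B e' f" for e e' f
    using three[of e e' f] by (simp add: B_def field_simps)
  have B_add': "B e (f + f') = B e f + B e f'" for e f f'
    using B_add[of f f' e] by (simp add: B_sym)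
  define A :: "real^'n^'n" where "A = (\<chi> i j. 2 * B (axis i 1) (axis j 1))"
  show thesis
  proof (rule that[of A])
    show "transpose A = A" by (simp add: A_def transpose_def vec_eq_iff B_sym)
    fix e
    have "q e = B e e" using par[of e e] by (simp add: B_def q0)
    also have "\<dots> = (\<Sum>i\<in>UNIV. real_of_int (e $ i) * B (axis i 1) e)"
      by (rule additive_on_lattice[of "\<lambda>x. B x e"]) (rule B_add)
    also have "\<dots> = (\<Sum>i\<in>UNIV. real_of_int (e $ i) * (\<Sum>j\<in>UNIV. real_of_int (e $ j) * B (axis i 1) (axis j 1)))"
      by (intro sum.cong refl arg_cong2[where f = "(*)"] additive_on_lattice[of "B _"]) (rule B_add')
    also have "\<dots> = 1 / 2 * ((A *v lattice_vec e) \<bullet> lattice_vec e)"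
      by (simp add: A_def inner_vec_def matrix_vector_mult_def lattice_vec_def sum_distrib_left sum_distrib_right mult_ac)
    finally show "q e = 1 / 2 * ((A *v lattice_vec e) \<bullet> lattice_vec e)" .
  qed
qed

lemma line_eventually_in_open:
  fixes x :: "'a::real_normed_vector"
  assumes "open U" "x \<in> U"
  shows "eventually (\<lambda>t. x + t *\<^sub>R e \<in> U) (nhds 0)"
proof -
  have "((\<lambda>t. x + t *\<^sub>R e) \<longlongrightarrow> x + 0 *\<^sub>R e) (nhds 0)" by (intro tendsto_intros) (simp add: filterlim_ident)
  then show ?thesis using topological_tendstoD[OF _ assms(1)] assms(2) by simp
qed

lemma convex_on_midpoint:
  assumes "convex_on C f" "x \<in> C" "y \<in> C" and mid: "x + y = 2 *\<^sub>R z"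
  shows "2 * f z \<le> f x + f y"
proof -
  have "(1/2) *\<^sub>R x + (1/2) *\<^sub>R y = z" using arg_cong[OF mid, of "scaleR (1/2)"] by (simp add: scaleR_right_distrib)
  moreover have "f ((1/2) *\<^sub>R x + (1/2) *\<^sub>R y) \<le> 1/2 * f x + 1/2 * f y"
    using assms(1)[unfolded convex_on_def, THEN conjunct2, rule_format, OF assms(2,3), of "1/2" "1/2"] by simp
  ultimately show ?thesis by simp
qed

text \<open>By midpoint convexity, \<open>K t = f (x + 2 t e) / 2 + f (x + 2 t e') / 2 - f (x + t (e + e'))\<close> is
  nonnegative and vanishes at 0, so its derivative there is 0.\<close>

lemma convex_directional_slope_add:
  fixes f :: "'a::euclidean_space \<Rightarrow> real"
  assumes conv: "convex_on U f" and U: "open U" "x \<in> U"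
    and e: "second_order_at_0 (\<lambda>t. f (x + t *\<^sub>R e)) a q"
    and e': "second_order_at_0 (\<lambda>t. f (x + t *\<^sub>R e')) a' q'"
    and ee': "second_order_at_0 (\<lambda>t. f (x + t *\<^sub>R (e + e'))) b q''"
  shows "b = a + a'"
proof -
  define K where "K = (\<lambda>t. 1 / 2 * f (x + (2 * t) *\<^sub>R e) + 1 / 2 * f (x + (2 * t) *\<^sub>R e') - f (x + t *\<^sub>R (e + e')))"
  have d: "((\<lambda>t. f (x + (2 * t) *\<^sub>R e)) has_field_derivative a * 2) (at 0)"
    if "second_order_at_0 (\<lambda>t. f (x + t *\<^sub>R e)) a q" for e a q
  proof -
    have 1: "((\<lambda>t. f (x + t *\<^sub>R e)) has_field_derivative a) (at (2 * 0))"
      using second_order_at_0_imp_derivative[OF that] by simp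
    have 2: "((\<lambda>t. 2 * t) has_field_derivative 2) (at (0::real))" by (auto intro!: derivative_eq_intros)
    show ?thesis using DERIV_chain2[OF 1 2] .
  qed
  have "(K has_field_derivative 1 / 2 * (a * 2) + 1 / 2 * (a' * 2) - b) (at 0)"
    unfolding K_def
    by (intro DERIV_diff DERIV_add DERIV_cmult d[OF e] d[OF e'] second_order_at_0_imp_derivative[OF ee'])
  then have K: "(K has_field_derivative a + a' - b) (at 0)" by simp
  have ev: "eventually (\<lambda>t. x + t *\<^sub>R (2 *\<^sub>R e) \<in> U \<and> x + t *\<^sub>R (2 *\<^sub>R e') \<in> U) (nhds 0)"
    by (intro eventually_conj line_eventually_in_open U)
  then obtain d where d: "d > 0" "\<And>t. \<bar>t\<bar> < d \<Longrightarrow> x + t *\<^sub>R (2 *\<^sub>R e) \<in> U \<and> x + t *\<^sub>R (2 *\<^sub>R e') \<in> U"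
    unfolding eventually_nhds_metric by (auto simp: dist_real_def)
  have "K 0 \<le> K t" if "\<bar>0 - t\<bar> < d" for t
  proof -
    have in_U: "x + (2 * t) *\<^sub>R e \<in> U" "x + (2 * t) *\<^sub>R e' \<in> U" using d(2)[of t] that by (auto simp: mult.commute)
    have "2 * f (x + t *\<^sub>R (e + e')) \<le> f (x + (2 * t) *\<^sub>R e) + f (x + (2 * t) *\<^sub>R e')"
      by (rule convex_on_midpoint[OF conv in_U]) (simp add: algebra_simps scaleR_2)
    then have "0 \<le> K t" by (simp add: K_def)
    moreover have "K 0 = 0" by (simp add: K_def)
    ultimately show ?thesis by simp
  qed
  then have "a + a' - b = 0" using DERIV_local_min[OF K \<open>d > 0\<close>] by blast
  then show ?thesis by simp
qed

text \<open>Convexity bounds a function on a cross-polytope by its values at the \<open>2 n\<close> vertices. A vector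
  with all coordinates at most \<open>\<rho> / n\<close> is the average of the \<open>n\<close> vectors with one nonzero coordinate,
  each of size at most \<open>\<rho>\<close>, so it belongs to the cross-polytope of radius \<open>\<rho>\<close>.\<close>

lemma convex_cross_polytope_bound:
  fixes F :: "real^'n \<Rightarrow> real"
  assumes conv: "convex_on C F" and "\<rho> > 0"
    and vert: "\<And>i. d + \<rho> *\<^sub>R axis i 1 \<in> C \<and> F (d + \<rho> *\<^sub>R axis i 1) \<le> M"
      "\<And>i. d - \<rho> *\<^sub>R axis i 1 \<in> C \<and> F (d - \<rho> *\<^sub>R axis i 1) \<le> M"
    and w: "\<And>i. \<bar>w $ i\<bar> \<le> \<rho> / real CARD('n)"
  shows "F (d + w) \<le> M"
proof -
  define V where "V = range (\<lambda>i. d + \<rho> *\<^sub>R axis i 1) \<union> range (\<lambda>i::'n. d - \<rho> *\<^sub>R axis i 1)"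
  let ?n = "real CARD('n)"
  have n: "?n > 0" by simp
  have pt: "d + (?n * w $ i) *\<^sub>R axis i 1 \<in> convex hull V" for i
  proof -
    \<comment> \<open>The weight of the vertex \<open>d + \<rho> axis i 1\<close> on the segment to the opposite vertex.\<close>
    define \<theta> where "\<theta> = (1 + ?n * w $ i / \<rho>) / 2"
    have "\<bar>?n * w $ i\<bar> \<le> \<rho>" using w[of i] n by (simp add: abs_mult field_simps)
    then have "\<bar>?n * w $ i / \<rho>\<bar> \<le> 1" using \<open>\<rho> > 0\<close> by (simp add: abs_divide)
    from abs_le_D1[OF this] abs_le_D2[OF this] have "0 \<le> 1 + ?n * w $ i / \<rho>" "?n * w $ i / \<rho> \<le> 1" by auto
    then have \<theta>: "0 \<le> \<theta>" "0 \<le> 1 - \<theta>"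
      unfolding \<theta>_def by auto
    have "\<theta> *\<^sub>R (d + \<rho> *\<^sub>R axis i 1) + (1 - \<theta>) *\<^sub>R (d - \<rho> *\<^sub>R axis i 1) \<in> convex hull V"
      using \<theta> by (intro convexD[OF convex_convex_hull] hull_inc) (auto simp: V_def)
    also have "\<theta> *\<^sub>R (d + \<rho> *\<^sub>R axis i 1) + (1 - \<theta>) *\<^sub>R (d - \<rho> *\<^sub>R axis i 1) = d + ((2 * \<theta> - 1) * \<rho>) *\<^sub>R axis i 1"
      by (simp add: vec_eq_iff algebra_simps)
    also have "(2 * \<theta> - 1) * \<rho> = ?n * w $ i" using \<open>\<rho> > 0\<close> by (simp add: \<theta>_def field_simps)
    finally show ?thesis .
  qed
  have "(\<Sum>i\<in>UNIV. (1 / ?n) *\<^sub>R (d + (?n * w $ i) *\<^sub>R axis i 1)) \<in> convex hull V"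
    by (intro convex_sum) (auto simp: pt)
  also have "(\<Sum>i\<in>UNIV. (1 / ?n) *\<^sub>R (d + (?n * w $ i) *\<^sub>R axis i 1)) = d + (\<Sum>i\<in>UNIV. w $ i *\<^sub>R axis i 1)"
  proof -
    have "(\<Sum>i\<in>UNIV. (1 / ?n) *\<^sub>R (d + (?n * w $ i) *\<^sub>R axis i 1)) = (\<Sum>i\<in>UNIV. (1 / ?n) *\<^sub>R d + w $ i *\<^sub>R axis i 1)"
      using n by (intro sum.cong refl) (simp add: scaleR_right_distrib)
    also have "\<dots> = (\<Sum>i\<in>(UNIV::'n set). (1 / ?n) *\<^sub>R d) + (\<Sum>i\<in>UNIV. w $ i *\<^sub>R axis i 1)"
      by (rule sum.distrib)
    also have "(\<Sum>i\<in>(UNIV::'n set). (1 / ?n) *\<^sub>R d) = d"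
      unfolding sum_constant_scaleR by simp
    finally show ?thesis .
  qed
  also have "(\<Sum>i\<in>UNIV. w $ i *\<^sub>R axis i 1) = w"
    using basis_expansion[of w] by (simp add: scalar_mult_eq_scaleR)
  finally have mem: "d + w \<in> convex hull V" .
  have "V \<subseteq> C" using vert by (auto simp: V_def)
  then have "convex hull V \<subseteq> C" using convex_on_imp_convex[OF conv] by (rule hull_minimal)
  then have "convex_on (convex hull V) F" by (rule convex_on_subset[OF conv]) simp
  moreover have "\<forall>x\<in>V. F x \<le> M" using vert by (auto simp: V_def)
  ultimately show ?thesis using convex_on_convex_hull_bound mem by blast
qed

section \<open>Alexandrov's theorem for convex functions\<close>

lemma lattice_vec_axis: "lattice_vec (k *s axis i 1) = real_of_int k *\<^sub>R axis i 1"
  by (simp add: lattice_vec_def vec_eq_iff axis_def)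

lemma lattice_vec_floor_close:
  fixes u :: "real^'n"
  assumes "m > (0::nat)"
  shows "\<bar>((1 / real m) *\<^sub>R lattice_vec (\<chi> i. \<lfloor>real m * u $ i\<rfloor>)) $ i - u $ i\<bar> \<le> 1 / real m"
proof -
  have "\<bar>real_of_int \<lfloor>real m * u $ i\<rfloor> - real m * u $ i\<bar> \<le> 1" by linarith
  then have "\<bar>real_of_int \<lfloor>real m * u $ i\<rfloor> - real m * u $ i\<bar> / real m \<le> 1 / real m"
    by (intro divide_right_mono) auto
  moreover have "\<bar>real_of_int \<lfloor>real m * u $ i\<rfloor> - real m * u $ i\<bar> / real m
      = \<bar>(real_of_int \<lfloor>real m * u $ i\<rfloor> - real m * u $ i) / real m\<bar>" by (simp add: abs_divide)
  moreover have "(real_of_int \<lfloor>real m * u $ i\<rfloor> - real m * u $ i) / real m = 1 / real m * real_of_int \<lfloor>real m * u $ i\<rfloor> - u $ i"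
    using assms by (simp add: field_simps)
  ultimately show ?thesis by (simp add: lattice_vec_def)
qed

lemma lattice_vec_floor_norm:
  fixes u :: "real^'n"
  assumes "m > (0::nat)"
  shows "norm ((1 / real m) *\<^sub>R lattice_vec (\<chi> i. \<lfloor>real m * u $ i\<rfloor>) - u) \<le> real CARD('n) / real m"
    (is "norm ?w \<le> _")
proof -
  have "norm ?w \<le> (\<Sum>i\<in>UNIV. \<bar>?w $ i\<bar>)" by (rule norm_le_l1_cart)
  also have "\<dots> \<le> (\<Sum>i\<in>(UNIV::'n set). 1 / real m)"
    by (rule sum_mono) (use lattice_vec_floor_close[OF assms] in simp)
  finally show ?thesis by simp
qed

text \<open>Around \<open>u0\<close> one places a cross-polytope with vertices at lattice points of mesh \<open>1 / m\<close>. It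
  contains \<open>u k\<close> for large \<open>k\<close>, and at its finitely many vertices pointwise convergence is available.\<close>

lemma convex_pointwise_limit_upper:
  fixes \<Phi> :: "nat \<Rightarrow> real^'n \<Rightarrow> real" and Q :: "real^'n \<Rightarrow> real"
  assumes conv: "\<And>R. eventually (\<lambda>k. convex_on (ball 0 R) (\<Phi> k)) sequentially"
    and lim: "\<And>s e. (\<lambda>k. \<Phi> k (s *\<^sub>R lattice_vec e)) \<longlonglongrightarrow> Q (s *\<^sub>R lattice_vec e)"
    and Q: "continuous_on UNIV Q" and u: "u \<longlonglongrightarrow> u0" and "\<epsilon> > 0"
  shows "eventually (\<lambda>k. \<Phi> k (u k) \<le> Q u0 + \<epsilon>) sequentially"
proof -
  let ?n = "real CARD('n)"
  have n1: "?n \<ge> 1" by (simp add: Suc_leI)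
  have "isCont Q u0" using Q by (simp add: continuous_on_eq_continuous_at)
  then obtain \<eta> where \<eta>: "\<eta> > 0" "\<And>y. dist y u0 < \<eta> \<Longrightarrow> \<bar>Q y - Q u0\<bar> < \<epsilon> / 2"
    using \<open>\<epsilon> > 0\<close> unfolding continuous_at_eps_delta dist_real_def by (meson half_gt_zero)
  obtain m :: nat where m: "3 * ?n / \<eta> < real m" using reals_Archimedean2 by blast
  have "0 \<le> 3 * ?n / \<eta>" using \<eta> by simp
  with m have m0: "m > 0" by linarith
  \<comment> \<open>Both \<open>d\<close> and \<open>u k\<close> lie within \<open>1 / m\<close> of \<open>u0\<close> in each coordinate, and \<open>\<rho> / n = 2 / m\<close>.\<close>
  define \<rho> where "\<rho> = 2 * ?n / real m"
  have \<rho>: "\<rho> > 0" using m0 by (simp add: \<rho>_def)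
  define e where "e = (\<chi> i. \<lfloor>real m * u0 $ i\<rfloor>)"
  define d where "d = (1 / real m) *\<^sub>R lattice_vec e"
  have close: "\<bar>d $ i - u0 $ i\<bar> \<le> 1 / real m" for i
    unfolding d_def e_def by (rule lattice_vec_floor_close[OF m0])
  have d_u0: "norm (d - u0) \<le> ?n / real m"
    unfolding d_def e_def by (rule lattice_vec_floor_norm[OF m0])
  have vert_eq: "d + \<rho> *\<^sub>R axis i 1 = (1 / real m) *\<^sub>R lattice_vec (e + (2 * int CARD('n)) *s axis i 1)"
    "d - \<rho> *\<^sub>R axis i 1 = (1 / real m) *\<^sub>R lattice_vec (e - (2 * int CARD('n)) *s axis i 1)" for i
    by (simp_all add: d_def \<rho>_def lattice_vec_add lattice_vec_diff lattice_vec_axis algebra_simps)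
  have m3: "?n / real m + \<rho> < \<eta>"
  proof -
    have "?n / real m + \<rho> = 3 * ?n / real m" by (simp add: \<rho>_def add_divide_distrib[symmetric])
    also have "\<dots> < \<eta>" using m m0 \<eta> by (simp add: field_simps)
    finally show ?thesis .
  qed
  have vert_close: "dist (d + s *\<^sub>R axis i 1) u0 < \<eta>" if "\<bar>s\<bar> = \<rho>" for s and i :: 'n
  proof -
    have "norm (d - u0 + s *\<^sub>R axis i 1) \<le> norm (d - u0) + norm (s *\<^sub>R axis i (1::real) :: real^'n)"
      by (rule norm_triangle_ineq)
    also have "\<dots> \<le> ?n / real m + \<rho>" using d_u0 that by simp
    finally show ?thesis using m3 by (simp add: dist_norm algebra_simps)
  qed
  define R where "R = norm u0 + \<eta>"
  have inR: "y \<in> ball 0 R" if "dist y u0 < \<eta>" for y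
  proof -
    have "norm y \<le> norm u0 + norm (y - u0)" by (rule norm_triangle_sub)
    then show ?thesis using that by (simp add: R_def dist_norm)
  qed
  have ev: "eventually (\<lambda>k. \<Phi> k (s *\<^sub>R lattice_vec f) \<le> Q u0 + \<epsilon>) sequentially"
    if "dist (s *\<^sub>R lattice_vec f) u0 < \<eta>" for s f
  proof -
    have "Q (s *\<^sub>R lattice_vec f) < Q u0 + \<epsilon>" using \<eta>(2)[OF that] \<open>\<epsilon> > 0\<close> by linarith
    from order_tendstoD(2)[OF lim this] show ?thesis by eventually_elim simp
  qed
  have 1: "eventually (\<lambda>k. \<forall>i. \<Phi> k (d + \<rho> *\<^sub>R axis i 1) \<le> Q u0 + \<epsilon>) sequentially"
    unfolding eventually_all_finite
    using ev vert_close[of \<rho>] \<rho> by (simp add: vert_eq eventually_all_finite)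
  have 2: "eventually (\<lambda>k. \<forall>i. \<Phi> k (d - \<rho> *\<^sub>R axis i 1) \<le> Q u0 + \<epsilon>) sequentially"
    using ev vert_close[of "- \<rho>"] \<rho> by (simp add: vert_eq eventually_all_finite)
  have 3: "eventually (\<lambda>k. dist (u k) u0 < 1 / real m) sequentially"
    using u m0 by (auto simp: tendsto_iff)
  from 1 2 3 conv[of R] show ?thesis
  proof eventually_elim
    case (elim k)
    have "\<Phi> k (d + (u k - d)) \<le> Q u0 + \<epsilon>"
    proof (rule convex_cross_polytope_bound[OF elim(4) \<rho>])
      show "d + \<rho> *\<^sub>R axis i 1 \<in> ball 0 R \<and> \<Phi> k (d + \<rho> *\<^sub>R axis i 1) \<le> Q u0 + \<epsilon>" for i
        using elim(1) inR[OF vert_close[of \<rho> i]] \<rho> by simp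
      show "d - \<rho> *\<^sub>R axis i 1 \<in> ball 0 R \<and> \<Phi> k (d - \<rho> *\<^sub>R axis i 1) \<le> Q u0 + \<epsilon>" for i
        using elim(2) inR[OF vert_close[of "- \<rho>" i]] \<rho> by simp
      fix i
      have "\<bar>(u k - u0) $ i\<bar> \<le> norm (u k - u0)" by (rule component_le_norm_cart)
      then have "\<bar>u k $ i - u0 $ i\<bar> \<le> 1 / real m" using elim(3) by (simp add: dist_norm)
      with close[of i] have "\<bar>(u k - d) $ i\<bar> \<le> 2 / real m" by simp
      also have "2 / real m = \<rho> / ?n" by (simp add: \<rho>_def)
      finally show "\<bar>(u k - d) $ i\<bar> \<le> \<rho> / ?n" .
    qed
    then show ?case by simp
  qed
qed

text \<open>For convex functions, pointwise convergence on a dense set forces convergence along moving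
  points. The lower bound follows from the upper bound at the mirror image \<open>2 d - u k\<close> of \<open>u k\<close> in a lattice
  point \<open>d\<close> close to \<open>u0\<close>.\<close>

lemma convex_pointwise_limit:
  fixes \<Phi> :: "nat \<Rightarrow> real^'n \<Rightarrow> real" and Q :: "real^'n \<Rightarrow> real"
  assumes conv: "\<And>R. eventually (\<lambda>k. convex_on (ball 0 R) (\<Phi> k)) sequentially"
    and lim: "\<And>s e. (\<lambda>k. \<Phi> k (s *\<^sub>R lattice_vec e)) \<longlonglongrightarrow> Q (s *\<^sub>R lattice_vec e)"
    and Q: "continuous_on UNIV Q" and u: "u \<longlonglongrightarrow> u0"
  shows "(\<lambda>k. \<Phi> k (u k)) \<longlonglongrightarrow> Q u0"
proof (rule tendstoI)
  fix \<epsilon> :: real assume \<epsilon>: "\<epsilon> > 0"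
  define \<gamma> where "\<gamma> = \<epsilon> / 8"
  have \<gamma>: "\<gamma> > 0" using \<epsilon> by (simp add: \<gamma>_def)
  have up: "eventually (\<lambda>k. \<Phi> k (u k) \<le> Q u0 + \<gamma>) sequentially"
    by (rule convex_pointwise_limit_upper[OF conv lim Q u \<gamma>])
  have "isCont Q u0" using Q by (simp add: continuous_on_eq_continuous_at)
  then obtain \<eta> where \<eta>: "\<eta> > 0" "\<And>y. dist y u0 < \<eta> \<Longrightarrow> \<bar>Q y - Q u0\<bar> < \<gamma>"
    using \<gamma> unfolding continuous_at_eps_delta dist_real_def by metis
  have "\<exists>d s e. d = s *\<^sub>R lattice_vec e \<and> 2 * norm (d - u0) < \<eta>"
  proof -
    let ?n = "real CARD('n)"
    obtain m :: nat where m: "2 * ?n / \<eta> < real m" using reals_Archimedean2 by blast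
    have "0 \<le> 2 * ?n / \<eta>" using \<eta> by simp
    with m have m0: "m > 0" by linarith
    define d where "d = (1 / real m) *\<^sub>R lattice_vec (\<chi> i. \<lfloor>real m * u0 $ i\<rfloor>)"
    have "2 * norm (d - u0) \<le> 2 * (?n / real m)"
      unfolding d_def using lattice_vec_floor_norm[OF m0] by (rule mult_left_mono) simp
    also have "\<dots> < \<eta>" using m m0 \<eta> by (simp add: field_simps)
    finally show ?thesis unfolding d_def by blast
  qed
  then obtain d s e where d: "d = s *\<^sub>R lattice_vec e" "2 * norm (d - u0) < \<eta>" by blast
  have "(\<lambda>k. 2 *\<^sub>R d - u k) \<longlonglongrightarrow> 2 *\<^sub>R d - u0" by (intro tendsto_intros u)
  from convex_pointwise_limit_upper[OF conv lim Q this \<gamma>]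
  have refl: "eventually (\<lambda>k. \<Phi> k (2 *\<^sub>R d - u k) \<le> Q (2 *\<^sub>R d - u0) + \<gamma>) sequentially" .
  have "(\<lambda>k. \<Phi> k d) \<longlonglongrightarrow> Q d" unfolding d(1) by (rule lim)
  from order_tendstoD(1)[OF this, of "Q d - \<gamma>"] \<gamma>
  have mid: "eventually (\<lambda>k. Q d - \<gamma> < \<Phi> k d) sequentially" by simp
  have "2 *\<^sub>R d - u0 - u0 = 2 *\<^sub>R (d - u0)" by (simp add: algebra_simps scaleR_2)
  then have "dist (2 *\<^sub>R d - u0) u0 < \<eta>" using d(2) by (simp add: dist_norm)
  then have Q1: "\<bar>Q (2 *\<^sub>R d - u0) - Q u0\<bar> < \<gamma>" by (rule \<eta>(2))
  have "dist d u0 < \<eta>" using d(2) norm_ge_zero[of "d - u0"] unfolding dist_norm by linarith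
  then have Q2: "\<bar>Q d - Q u0\<bar> < \<gamma>" by (rule \<eta>(2))
  define R where "R = norm u0 + 2 * norm d + 1"
  have bdd: "eventually (\<lambda>k. dist (u k) u0 < 1) sequentially" using u by (auto simp: tendsto_iff)
  from up refl mid conv[of R] bdd show "eventually (\<lambda>k. dist (\<Phi> k (u k)) (Q u0) < \<epsilon>) sequentially"
  proof eventually_elim
    case (elim k)
    have "norm (u k) < norm u0 + 1"
      using norm_triangle_sub[of "u k" u0] elim(5) unfolding dist_norm by linarith
    moreover have "norm (2 *\<^sub>R d - u k) \<le> 2 * norm d + norm (u k)"
      using norm_triangle_ineq4[of "2 *\<^sub>R d" "u k"] by simp
    ultimately have m1: "u k \<in> ball 0 R" and m2: "2 *\<^sub>R d - u k \<in> ball 0 R"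
      using norm_ge_zero[of d] unfolding mem_ball_0 R_def by linarith+
    have "2 * \<Phi> k d \<le> \<Phi> k (u k) + \<Phi> k (2 *\<^sub>R d - u k)"
      by (rule convex_on_midpoint[OF elim(4) m1 m2]) simp
    then have "Q u0 - 6 * \<gamma> \<le> \<Phi> k (u k)" using elim(2,3) Q1 Q2 by linarith
    moreover have "\<Phi> k (u k) \<le> Q u0 + \<gamma>" by (rule elim)
    ultimately show ?case using \<gamma> unfolding dist_real_def \<gamma>_def by linarith
  qed
qed

lemma convex_blowup:
  fixes f :: "real^'n \<Rightarrow> real"
  assumes conv: "convex_on U f" and U: "open U" "x \<in> U" and \<tau>: "\<tau> \<longlonglongrightarrow> 0" "\<And>k. \<tau> k > 0"
  shows "eventually (\<lambda>k. convex_on (ball 0 R) (\<lambda>y. (f (x + \<tau> k *\<^sub>R y) - f x - \<tau> k * (b \<bullet> y)) / (\<tau> k)\<^sup>2)) sequentially"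
proof -
  obtain r where r: "r > 0" "ball x r \<subseteq> U" using U by (meson open_contains_ball)
  have "(\<lambda>k. \<tau> k * \<bar>R\<bar>) \<longlonglongrightarrow> 0 * \<bar>R\<bar>" by (intro tendsto_intros \<tau>)
  then have "eventually (\<lambda>k. \<tau> k * \<bar>R\<bar> < r) sequentially" using r by (auto intro: order_tendstoD)
  then show ?thesis
  proof eventually_elim
    case (elim k)
    have inU: "x + \<tau> k *\<^sub>R y \<in> U" if "y \<in> ball 0 R" for y
    proof -
      have "\<tau> k * norm y \<le> \<tau> k * \<bar>R\<bar>" using that \<tau>(2)[of k] by (intro mult_left_mono) auto
      from le_less_trans[OF this elim] have "x + \<tau> k *\<^sub>R y \<in> ball x r" using \<tau>(2)[of k] by (simp add: dist_norm)
      then show ?thesis using r by blast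
    qed
    show ?case
      unfolding convex_on_def
    proof (intro conjI ballI allI impI)
      fix y z :: "real^'n" and u v :: real
      assume *: "y \<in> ball 0 R" "z \<in> ball 0 R" "0 \<le> u" "0 \<le> v" "u + v = 1"
      have "x = u *\<^sub>R x + v *\<^sub>R x" using *(5) by (simp flip: scaleR_left_distrib)
      then have eq: "x + \<tau> k *\<^sub>R (u *\<^sub>R y + v *\<^sub>R z) = u *\<^sub>R (x + \<tau> k *\<^sub>R y) + v *\<^sub>R (x + \<tau> k *\<^sub>R z)"
        by (simp add: algebra_simps)
      have fx: "f x = u * f x + v * f x" using *(5) by (simp flip: distrib_right)
      let ?F = "\<lambda>y. f (x + \<tau> k *\<^sub>R y) - f x - \<tau> k * (b \<bullet> y)"
      have "f (x + \<tau> k *\<^sub>R (u *\<^sub>R y + v *\<^sub>R z)) \<le> u * f (x + \<tau> k *\<^sub>R y) + v * f (x + \<tau> k *\<^sub>R z)"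
        unfolding eq using conv inU[OF *(1)] inU[OF *(2)] *(3-5) unfolding convex_on_def by blast
      then have "?F (u *\<^sub>R y + v *\<^sub>R z) \<le> u * ?F y + v * ?F z"
        using fx by (simp add: inner_add_right algebra_simps)
      then have "?F (u *\<^sub>R y + v *\<^sub>R z) / (\<tau> k)\<^sup>2 \<le> (u * ?F y + v * ?F z) / (\<tau> k)\<^sup>2"
        by (rule divide_right_mono) simp
      then show "?F (u *\<^sub>R y + v *\<^sub>R z) / (\<tau> k)\<^sup>2 \<le> u * (?F y / (\<tau> k)\<^sup>2) + v * (?F z / (\<tau> k)\<^sup>2)"
        by (simp add: add_divide_distrib)
    qed simp
  qed
qed

text \<open>If the expansion failed along points \<open>Y k\<close>, one could pass to a subsequence on which the
  directions \<open>(Y k - x) / norm (Y k - x)\<close> converge. The blow-ups of \<open>f\<close> at the scales \<open>norm (Y k - x)\<close> are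
  convex and converge to the quadratic form along all integer directions, hence also along these
  directions, a contradiction.\<close>

lemma convex_peano_at_point:
  fixes f :: "real^'n \<Rightarrow> real"
  assumes conv: "convex_on U f" and U: "open U" "x \<in> U"
    and so: "\<And>e. second_order_at_0 (\<lambda>t. f (x + t *\<^sub>R lattice_vec e)) (a e) (q e)"
    and par: "\<And>e e'. q (e + e') + q (e - e') = 2 * q e + 2 * q e'"
  shows "\<exists>b A. peano_expansion f x b A"
proof -
  obtain A where A: "transpose A = A" "\<And>e. q e = 1 / 2 * ((A *v lattice_vec e) \<bullet> lattice_vec e)"
    using parallelogram_quadratic_form[OF par] by blast
  have a_add: "a (e + e') = a e + a e'" for e e'
    by (rule convex_directional_slope_add[OF conv U so[of e] so[of e'] so[of "e + e'", unfolded lattice_vec_add]])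
  define b :: "real^'n" where "b = (\<chi> i. a (axis i 1))"
  have a_eq: "a e = b \<bullet> lattice_vec e" for e
  proof -
    have "a e = (\<Sum>i\<in>UNIV. real_of_int (e $ i) * a (axis i 1))" by (rule additive_on_lattice) (rule a_add)
    also have "\<dots> = b \<bullet> lattice_vec e" by (simp add: b_def lattice_vec_def inner_vec_def mult.commute)
    finally show ?thesis .
  qed
  define Q where "Q = (\<lambda>y. 1 / 2 * ((A *v y) \<bullet> y))"
  have Qc: "continuous_on UNIV Q"
    unfolding Q_def by (intro continuous_intros matrix_vector_mult_linear_continuous_on)
  have Qs: "Q (s *\<^sub>R y) = s\<^sup>2 * Q y" for s y
    by (simp add: Q_def matrix_vector_mult_scaleR power2_eq_square)
  define r where "r = (\<lambda>y. (f y - (f x + b \<bullet> (y - x) + 1 / 2 * ((A *v (y - x)) \<bullet> (y - x)))) / (norm (y - x))\<^sup>2)"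
  have "(r \<longlongrightarrow> 0) (at x)"
    unfolding tendsto_at_iff_sequentially
  proof (intro allI impI)
    fix X assume X: "\<forall>i. X i \<in> UNIV - {x}" "X \<longlonglongrightarrow> x"
    show "(r \<circ> X) \<longlonglongrightarrow> 0"
    proof (rule ccontr)
      assume "\<not> (r \<circ> X) \<longlonglongrightarrow> 0"
      then obtain \<epsilon> where \<epsilon>: "\<epsilon> > 0" "\<not> eventually (\<lambda>k. \<bar>r (X k)\<bar> < \<epsilon>) sequentially"
        by (auto simp: tendsto_iff dist_real_def)
      from not_eventually_sequentiallyD[OF \<epsilon>(2)]
      obtain \<sigma> :: "nat \<Rightarrow> nat" where \<sigma>: "strict_mono \<sigma>" "\<And>k. \<not> \<bar>r (X (\<sigma> k))\<bar> < \<epsilon>" by blast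
      define Y where "Y = (\<lambda>k. X (\<sigma> k))"
      define w where "w = (\<lambda>k. (1 / norm (Y k - x)) *\<^sub>R (Y k - x))"
      have Y: "Y k \<noteq> x" for k using X(1) by (auto simp: Y_def)
      have "\<forall>k. w k \<in> sphere 0 1" using Y by (simp add: w_def)
      then obtain u0 \<rho> where \<rho>: "strict_mono \<rho>" "(w \<circ> \<rho>) \<longlonglongrightarrow> u0"
        using compact_sphere[of "0::real^'n" 1] unfolding compact_def by metis
      define \<tau> where "\<tau> = (\<lambda>k. norm (Y (\<rho> k) - x))"
      have Ylim: "(\<lambda>k. Y (\<rho> k)) \<longlonglongrightarrow> x"
        using LIMSEQ_subseq_LIMSEQ[OF LIMSEQ_subseq_LIMSEQ[OF X(2) \<sigma>(1)] \<rho>(1)] by (simp add: Y_def o_def)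
      have \<tau>: "\<tau> \<longlonglongrightarrow> 0" unfolding \<tau>_def
        using tendsto_norm_zero[OF LIM_zero[OF Ylim]] .
      have \<tau>0: "\<tau> k > 0" for k using Y by (simp add: \<tau>_def)
      define \<Phi> where "\<Phi> = (\<lambda>k y. (f (x + \<tau> k *\<^sub>R y) - f x - \<tau> k * (b \<bullet> y)) / (\<tau> k)\<^sup>2)"
      have "(\<lambda>k. \<Phi> k ((w \<circ> \<rho>) k)) \<longlonglongrightarrow> Q u0"
      proof (rule convex_pointwise_limit[OF _ _ Qc \<rho>(2)])
        show "eventually (\<lambda>k. convex_on (ball 0 R) (\<Phi> k)) sequentially" for R
          unfolding \<Phi>_def by (rule convex_blowup[OF conv U \<tau> \<tau>0])
        have "Q (lattice_vec e) = q e" for e by (simp add: Q_def A(2))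
        then show "(\<lambda>k. \<Phi> k (s *\<^sub>R lattice_vec e)) \<longlonglongrightarrow> Q (s *\<^sub>R lattice_vec e)" for s e
          using second_order_blowup[OF so[of e] \<tau> \<tau>0, of s]
          by (simp add: \<Phi>_def Qs a_eq mult.commute)
      qed
      moreover have "(\<lambda>k. Q ((w \<circ> \<rho>) k)) \<longlonglongrightarrow> Q u0"
        by (rule continuous_on_tendsto_compose[OF Qc \<rho>(2)]) auto
      ultimately have "(\<lambda>k. \<Phi> k ((w \<circ> \<rho>) k) - Q ((w \<circ> \<rho>) k)) \<longlonglongrightarrow> Q u0 - Q u0"
        by (rule tendsto_diff)
      moreover have "\<Phi> k ((w \<circ> \<rho>) k) - Q ((w \<circ> \<rho>) k) = r (Y (\<rho> k))" for k
      proof -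
        have w: "Y (\<rho> k) - x = \<tau> k *\<^sub>R w (\<rho> k)" using Y by (simp add: w_def \<tau>_def)
        then have y: "Y (\<rho> k) = x + \<tau> k *\<^sub>R w (\<rho> k)" by (simp add: algebra_simps)
        have "r (Y (\<rho> k)) = (f (x + \<tau> k *\<^sub>R w (\<rho> k)) - (f x + b \<bullet> (\<tau> k *\<^sub>R w (\<rho> k)) + Q (\<tau> k *\<^sub>R w (\<rho> k)))) / (\<tau> k)\<^sup>2"
        proof -
          have "norm (\<tau> k *\<^sub>R w (\<rho> k)) = \<tau> k" unfolding w[symmetric] by (simp add: \<tau>_def)
          then show ?thesis unfolding r_def w Q_def by (simp only: y)
        qed
        also have "\<dots> = \<Phi> k (w (\<rho> k)) - Q (w (\<rho> k))"
          using \<tau>0[of k] by (simp add: \<Phi>_def Qs field_simps)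
        finally show ?thesis by simp
      qed
      ultimately have "(\<lambda>k. r (Y (\<rho> k))) \<longlonglongrightarrow> 0" by simp
      then have "eventually (\<lambda>k. \<bar>r (Y (\<rho> k))\<bar> < \<epsilon>) sequentially"
        using \<epsilon>(1) by (auto simp: tendsto_iff dist_real_def)
      then obtain k where "\<bar>r (Y (\<rho> k))\<bar> < \<epsilon>" by (auto simp: eventually_sequentially)
      then show False using \<sigma>(2) by (simp add: Y_def)
    qed
  qed
  then have "peano_expansion f x b A"
    unfolding peano_expansion_def r_def using A(1)
    by (intro conjI smalloI_tendsto) (auto simp: eventually_at_filter)
  then show ?thesis by blast
qed

text \<open>Only countably many null sets have to be discarded: one for each integer direction and one for
  each pair of them.\<close>

theorem alexandrov_convex:
  fixes f :: "real^'n \<Rightarrow> real"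
  assumes conv: "convex_on U f" and "open U"
  shows "negligible {x \<in> U. \<not> (\<exists>b A. peano_expansion f x b A)}"
proof -
  define S where "S = (\<lambda>x e q. \<exists>a. second_order_at_0 (\<lambda>t. f (x + t *\<^sub>R e)) a q)"
  define L where "L = (\<lambda>x e. \<exists>a q. second_order_at_0 (\<lambda>t. f (x + t *\<^sub>R lattice_vec e)) a q)"
  define par where "par = (\<lambda>x v w. \<forall>q1 q2 q3 q4. S x v q1 \<longrightarrow> S x w q2 \<longrightarrow> S x (v + w) q3
       \<longrightarrow> S x (v - w) q4 \<longrightarrow> q3 + q4 = 2 * q1 + 2 * q2)"
  define N1 where "N1 = (\<Union>e. {x \<in> U. \<not> L x e})"
  define N2 where "N2 = (\<Union>(e, e'). {x \<in> U. \<not> par x (lattice_vec e) (lattice_vec e')})"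
  have "negligible N1"
    unfolding N1_def
  proof (rule negligible_countable_Union, safe)
    show "negligible {x \<in> U. \<not> L x e}" for e
      unfolding L_def by (rule convex_second_order_ae_along[OF assms])
  qed simp
  moreover have "negligible N2"
    unfolding N2_def
  proof (rule negligible_countable_Union, safe)
    show "negligible {x \<in> U. \<not> par x (lattice_vec e) (lattice_vec e')}" for e e'
      unfolding par_def S_def by (rule convex_parallelogram_ae[OF assms])
  qed simp
  ultimately have "negligible (N1 \<union> N2)" by (rule negligible_Un)
  then show ?thesis
  proof (rule negligible_subset, intro subsetI)
    fix x assume "x \<in> {x \<in> U. \<not> (\<exists>b A. peano_expansion f x b A)}"
    then have x: "x \<in> U" and np: "\<not> (\<exists>b A. peano_expansion f x b A)" by auto
    show "x \<in> N1 \<union> N2"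
    proof (rule ccontr)
      assume no: "x \<notin> N1 \<union> N2"
      then have "\<forall>e. L x e" using x unfolding N1_def by blast
      then obtain a q where so: "\<And>e. second_order_at_0 (\<lambda>t. f (x + t *\<^sub>R lattice_vec e)) (a e) (q e)"
        unfolding L_def by metis
      then have S: "S x (lattice_vec e) (q e)" for e unfolding S_def by blast
      have "q (e + e') + q (e - e') = 2 * q e + 2 * q e'" for e e'
      proof -
        have "par x (lattice_vec e) (lattice_vec e')" using no x unfolding N2_def by auto
        then show ?thesis
          using S[of e] S[of e'] S[of "e + e'"] S[of "e - e'"]
          unfolding par_def lattice_vec_add lattice_vec_diff by blast
      qed
      from convex_peano_at_point[OF conv \<open>open U\<close> x so this] np show False by blast
    qed
  qed
qed

section \<open>The area inequality over arbitrary finite index types\<close>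

text \<open>A copy of an arbitrary finite index type, ordered like an initial segment of the natural
  numbers. The area inequality is first obtained with ordered coordinates and then extended by relabelling.\<close>

typedef (overloaded) ('n::finite) idx = "{..<CARD('n)}"
  by (rule exI[of _ 0]) simp

instantiation idx :: (finite) wellorder
begin
definition "x \<le> y \<longleftrightarrow> Rep_idx x \<le> Rep_idx y"
definition "x < y \<longleftrightarrow> Rep_idx x < Rep_idx y"
instance
proof
  fix x y z :: "'a idx" and P :: "'a idx \<Rightarrow> bool"
  show "(x < y) = (x \<le> y \<and> \<not> y \<le> x)" "x \<le> x" "x \<le> y \<Longrightarrow> y \<le> z \<Longrightarrow> x \<le> z"
    "x \<le> y \<Longrightarrow> y \<le> x \<Longrightarrow> x = y" "x \<le> y \<or> y \<le> x"
    by (auto simp: less_eq_idx_def less_idx_def Rep_idx_inject)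
  assume step: "\<And>x. (\<And>y. y < x \<Longrightarrow> P y) \<Longrightarrow> P x"
  show "P x"
    by (induction x rule: measure_induct_rule[of Rep_idx]) (rule step, simp add: less_idx_def)
qed
end

instance idx :: (finite) finite
proof
  have "(UNIV :: 'a idx set) = Abs_idx ` {..<CARD('a)}"
    by (metis type_definition.Abs_image type_definition_idx)
  then show "finite (UNIV :: 'a idx set)" using finite_imageI[OF finite_lessThan] by metis
qed

lemma card_idx: "CARD('n::finite idx) = CARD('n)"
proof -
  have "CARD('n idx) = card {..<CARD('n)}" by (rule type_definition.card[OF type_definition_idx])
  then show ?thesis by simp
qed

lemma idx_bij_exists: "\<exists>h :: 'n::finite idx \<Rightarrow> 'n. bij h"
  using finite_same_card_bij[of "UNIV :: 'n idx set" "UNIV :: 'n set"] by (auto simp: card_idx)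

definition reindex :: "('m \<Rightarrow> 'n) \<Rightarrow> 'a^'n \<Rightarrow> 'a^'m" where
  "reindex h x = (\<chi> i. x $ h i)"

lemma reindex_nth [simp]: "reindex h x $ i = x $ h i"
  by (simp add: reindex_def)

lemma linear_reindex: "linear (reindex h :: real^'n \<Rightarrow> real^'m)"
  by (rule linearI) (simp_all add: vec_eq_iff)

lemma reindex_inverse:
  assumes "bij h"
  shows "reindex (inv h) (reindex h x) = x" "reindex h (reindex (inv h) y) = y"
  using assms by (simp_all add: vec_eq_iff bij_is_surj surj_f_inv_f bij_is_inj)

lemma reindex_borel [measurable]: "(reindex h :: real^'n \<Rightarrow> real^'m) \<in> borel_measurable borel"
  by (intro borel_measurable_continuous_onI linear_continuous_on linear_conv_bounded_linear[THEN iffD1] linear_reindex)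

lemma distr_lborel_reindex:
  fixes h :: "'m::finite \<Rightarrow> 'n::finite"
  assumes "bij h"
  shows "distr lborel borel (reindex h :: real^'n \<Rightarrow> real^'m) = lborel"
proof (rule lborel_eqI[symmetric])
  fix l u :: "real^'m" assume le: "\<And>b. b \<in> Basis \<Longrightarrow> l \<bullet> b \<le> u \<bullet> b"
  have le': "l $ i \<le> u $ i" for i using le[of "axis i 1"] by (simp add: inner_axis)
  have "emeasure (distr lborel borel (reindex h :: real^'n \<Rightarrow> real^'m)) (box l u)
     = emeasure lborel (reindex h -` box l u :: (real^'n) set)"
    by (subst emeasure_distr) auto
  also have "(reindex h -` box l u :: (real^'n) set) = box (reindex (inv h) l) (reindex (inv h) u)"
  proof -
    have "(\<forall>i. l $ i < x $ h i \<and> x $ h i < u $ i) \<longleftrightarrow> (\<forall>j. l $ inv h j < x $ j \<and> x $ j < u $ inv h j)" for x :: "real^'n"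
      using assms by (metis bij_is_surj surj_f_inv_f bij_is_inj inv_f_f)
    then show ?thesis by (auto simp: mem_box_cart)
  qed
  also have "emeasure lborel \<dots> = ennreal (\<Prod>b\<in>Basis. (reindex (inv h) u - reindex (inv h) l) \<bullet> b)"
  proof (rule emeasure_lborel_box)
    fix b :: "real^'n" assume "b \<in> Basis"
    then obtain j where "b = axis j 1" by (auto simp: Basis_vec_def)
    then show "reindex (inv h) l \<bullet> b \<le> reindex (inv h) u \<bullet> b" by (simp add: inner_axis le')
  qed
  also have "(\<Prod>b\<in>Basis. (reindex (inv h) u - reindex (inv h) l :: real^'n) \<bullet> b) = (\<Prod>j\<in>UNIV. u $ inv h j - l $ inv h j)"
  proof -
    have B: "(Basis :: (real^'n) set) = range (\<lambda>j. axis j 1)" by (auto simp: Basis_vec_def)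
    show ?thesis unfolding B by (subst prod.reindex) (auto simp: inj_on_def axis_eq_axis inner_axis)
  qed
  also have "\<dots> = (\<Prod>i\<in>UNIV. u $ i - l $ i)"
    using assms by (intro prod.reindex_bij_betw[of "inv h" UNIV UNIV "\<lambda>i. u $ i - l $ i"]) (simp add: bij_imp_bij_inv)
  also have "\<dots> = (\<Prod>b\<in>Basis. (u - l) \<bullet> b)"
  proof -
    have B: "(Basis :: (real^'m) set) = range (\<lambda>j. axis j 1)" by (auto simp: Basis_vec_def)
    show ?thesis unfolding B by (subst prod.reindex) (auto simp: inj_on_def axis_eq_axis inner_axis)
  qed
  finally show "emeasure (distr lborel borel (reindex h :: real^'n \<Rightarrow> real^'m)) (box l u) = ennreal (\<Prod>b\<in>Basis. (u - l) \<bullet> b)" .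
qed simp

lemma lebesgue_reindex:
  fixes h :: "'m::finite \<Rightarrow> 'n::finite"
  assumes "bij h"
  shows measurable_lebesgue_reindex: "(reindex h :: real^'n \<Rightarrow> real^'m) \<in> lebesgue \<rightarrow>\<^sub>M lebesgue"
    and distr_lebesgue_reindex: "distr lebesgue lebesgue (reindex h :: real^'n \<Rightarrow> real^'m) = lebesgue"
proof -
  let ?X = "reindex h :: real^'n \<Rightarrow> real^'m"
  have X: "?X \<in> lborel \<rightarrow>\<^sub>M lborel" by simp
  have "distr lebesgue lborel ?X = distr lborel lborel ?X" by (rule distr_completion[OF X])
  also have "\<dots> = distr lborel borel ?X" by (rule distr_cong) auto
  finally have d: "distr lebesgue lborel ?X = lborel" by (simp add: distr_lborel_reindex[OF assms])
  show "?X \<in> lebesgue \<rightarrow>\<^sub>M lebesgue"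
    by (rule completion.measurable_completion2[OF measurable_completion[OF X]]) (simp add: d)
  have "completion (distr lebesgue lborel ?X) = distr lebesgue lebesgue ?X"
    by (rule completion.completion_distr_eq[OF measurable_completion[OF X]]) (simp add: d)
  then show "distr lebesgue lebesgue ?X = lebesgue" by (simp add: d)
qed

lemma swapidseq_conjugate:
  assumes "swapidseq n p" "bij h"
  shows "swapidseq n (h \<circ> p \<circ> inv h)"
  using assms(1)
proof induction
  case id
  have "h \<circ> id \<circ> inv h = id" using \<open>bij h\<close> by (simp add: fun_eq_iff bij_is_surj surj_f_inv_f)
  then show ?case by (simp only: swapidseq.id)
next
  case (comp_Suc n p a b)
  have "h \<circ> (Transposition.transpose a b \<circ> p) \<circ> inv h = Transposition.transpose (h a) (h b) \<circ> (h \<circ> p \<circ> inv h)"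
    using bij_is_inj[OF \<open>bij h\<close>] by (auto simp: fun_eq_iff Transposition.transpose_def inj_eq)
  moreover have hab: "h a \<noteq> h b" using comp_Suc bij_is_inj[OF \<open>bij h\<close>] by (simp add: inj_eq)
  from swapidseq.comp_Suc[OF comp_Suc.IH hab]
  have "swapidseq (Suc n) (Transposition.transpose (h a) (h b) \<circ> (h \<circ> p \<circ> inv h))" .
  ultimately show ?case by (simp only:)
qed

text \<open>Conjugation with \<open>h\<close> turns a product of transpositions into a product of equally many
  transpositions.\<close>

lemma sign_conjugate:
  assumes "permutation p" "bij h"
  shows "sign (h \<circ> p \<circ> inv h) = sign p"
proof -
  obtain n where n: "swapidseq n p" using assms(1) by (auto simp: permutation_def)
  have "evenperm p = even n" using evenperm_unique[OF n] by simp
  moreover have "evenperm (h \<circ> p \<circ> inv h) = even n"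
    using evenperm_unique[OF swapidseq_conjugate[OF n assms(2)]] by simp
  ultimately show ?thesis by (simp add: sign_def)
qed

lemma det_reindex:
  fixes A :: "real^'n^'n" and h :: "'m::finite \<Rightarrow> 'n::finite"
  assumes h: "bij h"
  shows "det (\<chi> i j. A $ h i $ h j) = det A"
proof -
  have hi: "h (inv h j) = j" "inv h (h i) = i" for i j
    using h by (simp_all add: bij_is_surj surj_f_inv_f bij_is_inj)
  show ?thesis
    unfolding det_def
  proof (rule sum.reindex_bij_witness[of _ "\<lambda>p. inv h \<circ> p \<circ> h" "\<lambda>p. h \<circ> p \<circ> inv h"])
    fix p assume "p \<in> {p. p permutes (UNIV :: 'm set)}"
    then have p: "p permutes UNIV" by simp
    show "inv h \<circ> (h \<circ> p \<circ> inv h) \<circ> h = p" by (simp add: fun_eq_iff hi)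
    show "h \<circ> p \<circ> inv h \<in> {p. p permutes UNIV}"
      by (intro CollectI bij_imp_permutes bij_comp bij_imp_bij_inv h permutes_bij[OF p]) auto
    have "sign (h \<circ> p \<circ> inv h) = sign p"
      using p h by (intro sign_conjugate) (auto simp: permutation_permutes)
    moreover have "(\<Prod>j\<in>UNIV. A $ j $ (h \<circ> p \<circ> inv h) j) = (\<Prod>i\<in>UNIV. A $ h i $ h (p i))"
      using prod.reindex_bij_betw[of h UNIV UNIV "\<lambda>j. A $ j $ (h \<circ> p \<circ> inv h) j"] h by (simp add: hi)
    ultimately show "real_of_int (sign (h \<circ> p \<circ> inv h)) * (\<Prod>j\<in>UNIV. A $ j $ (h \<circ> p \<circ> inv h) j)
        = real_of_int (sign p) * (\<Prod>i\<in>UNIV. (\<chi> i j. A $ h i $ h j) $ i $ p i)" by simp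
  next
    fix p assume "p \<in> {p. p permutes (UNIV :: 'n set)}"
    then have p: "p permutes UNIV" by simp
    show "h \<circ> (inv h \<circ> p \<circ> h) \<circ> inv h = p" by (simp add: fun_eq_iff hi)
    show "inv h \<circ> p \<circ> h \<in> {p. p permutes UNIV}"
      by (intro CollectI bij_imp_permutes bij_comp bij_imp_bij_inv h permutes_bij[OF p]) auto
  qed
qed

lemma area_inequality_wellorder:
  fixes f :: "real^'n::{finite,wellorder} \<Rightarrow> real^'n::_"
  assumes S: "S \<in> sets lebesgue"
    and der: "\<And>x. x \<in> S \<Longrightarrow> (f has_derivative (\<lambda>v. A x *v v)) (at x within S)"
    and fin: "(\<integral>\<^sup>+x\<in>S. ennreal \<bar>det (A x)\<bar> \<partial>lebesgue) < \<infinity>"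
  shows "f ` S \<in> sets lebesgue"
    "emeasure lebesgue (f ` S) \<le> (\<integral>\<^sup>+x\<in>S. ennreal \<bar>det (A x)\<bar> \<partial>lebesgue)"
proof -
  have m: "(\<lambda>x. det (A x)) \<in> borel_measurable (lebesgue_on S)"
    using borel_measurable_det_Jacobian[OF S der] by simp
  have nn: "(\<integral>\<^sup>+x. ennreal \<bar>det (A x)\<bar> \<partial>lebesgue_on S) = (\<integral>\<^sup>+x\<in>S. ennreal \<bar>det (A x)\<bar> \<partial>lebesgue)"
    using S by (simp add: nn_integral_restrict_space)
  have i: "integrable (lebesgue_on S) (\<lambda>x. \<bar>det (A x)\<bar>)"
    using m fin nn by (intro integrableI_bounded) auto
  have I: "(\<lambda>x. \<bar>det (matrix (\<lambda>v. A x *v v))\<bar>) integrable_on S"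
    using integrable_on_lebesgue_on[OF i S] by simp
  have L: "f ` S \<in> lmeasurable"
    by (rule measurable_differentiable_image[OF S der I])
  then show "f ` S \<in> sets lebesgue" by auto
  have "emeasure lebesgue (f ` S) = ennreal (measure lebesgue (f ` S))"
    using L by (simp add: emeasure_eq_measure2)
  also have "\<dots> \<le> ennreal (integral S (\<lambda>x. \<bar>det (A x)\<bar>))"
    using measure_differentiable_image[OF S der I] by (intro ennreal_leI) simp
  also have "\<dots> = ennreal (integral\<^sup>L (lebesgue_on S) (\<lambda>x. \<bar>det (A x)\<bar>))"
    using lebesgue_integral_eq_integral[OF i S] by simp
  also have "\<dots> = (\<integral>\<^sup>+x. ennreal \<bar>det (A x)\<bar> \<partial>lebesgue_on S)"
    using nn_integral_eq_integral[OF i] by simp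
  also note nn
  finally show "emeasure lebesgue (f ` S) \<le> (\<integral>\<^sup>+x\<in>S. ennreal \<bar>det (A x)\<bar> \<partial>lebesgue)" .
qed

text \<open>The differentiability is required only relative to \<open>S\<close>, which is what the slope map on a contact
  set provides. The statement is carried over from an ordered index type by relabelling the
  coordinates, which preserves measure and determinants.\<close>

theorem area_inequality:
  fixes f :: "real^'n \<Rightarrow> real^'n"
  assumes S: "S \<in> sets lebesgue"
    and der: "\<And>x. x \<in> S \<Longrightarrow> (f has_derivative (\<lambda>v. A x *v v)) (at x within S)"
    and fin: "(\<integral>\<^sup>+x\<in>S. ennreal \<bar>det (A x)\<bar> \<partial>lebesgue) < \<infinity>"
  shows "f ` S \<in> sets lebesgue"
    and "emeasure lebesgue (f ` S) \<le> (\<integral>\<^sup>+x\<in>S. ennreal \<bar>det (A x)\<bar> \<partial>lebesgue)"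
proof -
  obtain h :: "'n idx \<Rightarrow> 'n" where h: "bij h" using idx_bij_exists by blast
  have h': "bij (inv h)" using h by (rule bij_imp_bij_inv)
  define \<iota> :: "real^'n \<Rightarrow> real^'n idx" where "\<iota> = reindex h"
  define \<kappa> :: "real^'n idx \<Rightarrow> real^'n" where "\<kappa> = reindex (inv h)"
  have inv: "\<kappa> (\<iota> x) = x" "\<iota> (\<kappa> y) = y" for x y
    unfolding \<iota>_def \<kappa>_def by (rule reindex_inverse[OF h])+
  have lin: "bounded_linear \<iota>" "bounded_linear \<kappa>"
    unfolding \<iota>_def \<kappa>_def by (simp_all add: linear_conv_bounded_linear[symmetric] linear_reindex)
  have mi: "\<iota> \<in> lebesgue \<rightarrow>\<^sub>M lebesgue" "\<kappa> \<in> lebesgue \<rightarrow>\<^sub>M lebesgue"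
    unfolding \<iota>_def \<kappa>_def by (rule measurable_lebesgue_reindex h h')+
  have di: "distr lebesgue lebesgue \<iota> = lebesgue"
    unfolding \<iota>_def by (rule distr_lebesgue_reindex[OF h])
  define S' where "S' = \<iota> ` S"
  have S'_eq: "S' = \<kappa> -` S" unfolding S'_def using inv by (auto simp: image_iff) metis
  have S': "S' \<in> sets lebesgue" unfolding S'_eq using measurable_sets[OF mi(2) S] by simp
  define A' where "A' = (\<lambda>y. \<chi> i j. A (\<kappa> y) $ h i $ h j)"
  have det': "det (A' y) = det (A (\<kappa> y))" for y unfolding A'_def by (rule det_reindex[OF h])
  have der': "((\<iota> \<circ> f \<circ> \<kappa>) has_derivative (\<lambda>v. A' y *v v)) (at y within S')" if "y \<in> S'" for y
  proof -
    have "\<kappa> y \<in> S" using that by (simp add: S'_eq)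
    have 1: "(\<kappa> has_derivative \<kappa>) (at y within S')" by (rule bounded_linear_imp_has_derivative[OF lin(2)])
    have "\<kappa> ` S' = S" by (auto simp: S'_def image_image inv)
    then have 2: "(f has_derivative (\<lambda>v. A (\<kappa> y) *v v)) (at (\<kappa> y) within \<kappa> ` S')" using der[OF \<open>\<kappa> y \<in> S\<close>] by simp
    have "((\<lambda>y. \<iota> (f (\<kappa> y))) has_derivative (\<lambda>v. \<iota> (A (\<kappa> y) *v \<kappa> v))) (at y within S')"
      using bounded_linear.has_derivative[OF lin(1) diff_chain_within[OF 1 2]] by (simp add: o_def)
    moreover have "\<iota> (A (\<kappa> y) *v \<kappa> v) = A' y *v v" for v
    proof -
      have "(\<Sum>j\<in>UNIV. A (\<kappa> y) $ h i $ j * v $ inv h j) = (\<Sum>j\<in>UNIV. A (\<kappa> y) $ h i $ h j * v $ j)" for i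
        using sum.reindex_bij_betw[of h UNIV UNIV "\<lambda>j. A (\<kappa> y) $ h i $ j * v $ inv h j"] h
        by (simp add: bij_is_inj)
      then show ?thesis by (simp add: vec_eq_iff A'_def \<iota>_def \<kappa>_def matrix_vector_mult_def)
    qed
    ultimately show ?thesis by (simp add: o_def)
  qed
  have int_eq: "(\<integral>\<^sup>+y\<in>S'. ennreal \<bar>det (A' y)\<bar> \<partial>lebesgue) = (\<integral>\<^sup>+x\<in>S. ennreal \<bar>det (A x)\<bar> \<partial>lebesgue)"
  proof -
    have "(\<lambda>y. det (matrix (\<lambda>v. A' y *v v))) \<in> borel_measurable (lebesgue_on S')"
      by (rule borel_measurable_det_Jacobian[OF S' der'])
    then have m1: "(\<lambda>y. ennreal \<bar>det (A' y)\<bar>) \<in> borel_measurable (lebesgue_on S')" by simp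
    have m2: "S' \<inter> space lebesgue \<in> sets lebesgue" using S' by simp
    have m: "(\<lambda>y. ennreal \<bar>det (A' y)\<bar> * indicator S' y) \<in> borel_measurable lebesgue"
      by (rule iffD1[OF borel_measurable_restrict_space_iff_ennreal[OF m2] m1])
    have "(\<integral>\<^sup>+y\<in>S'. ennreal \<bar>det (A' y)\<bar> \<partial>lebesgue) = (\<integral>\<^sup>+y\<in>S'. ennreal \<bar>det (A' y)\<bar> \<partial>distr lebesgue lebesgue \<iota>)"
      by (simp add: di)
    also have "\<dots> = (\<integral>\<^sup>+x. ennreal \<bar>det (A' (\<iota> x))\<bar> * indicator S' (\<iota> x) \<partial>lebesgue)"
      by (rule nn_integral_distr[OF mi(1)]) (use m in simp)
    also have "\<dots> = (\<integral>\<^sup>+x\<in>S. ennreal \<bar>det (A x)\<bar> \<partial>lebesgue)"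
      by (intro nn_integral_cong) (simp add: det' inv S'_eq indicator_def)
    finally show ?thesis .
  qed
  have fin': "(\<integral>\<^sup>+y\<in>S'. ennreal \<bar>det (A' y)\<bar> \<partial>lebesgue) < \<infinity>" using fin by (simp add: int_eq)
  note wo = area_inequality_wellorder[OF S' der' fin']
  have img: "(\<iota> \<circ> f \<circ> \<kappa>) ` S' = \<iota> ` (f ` S)"
    by (auto simp: S'_def image_image inv)
  have pre: "\<iota> -` (\<iota> ` (f ` S)) = f ` S" using inv by (auto simp: image_iff) metis
  show "f ` S \<in> sets lebesgue"
    using measurable_sets[OF mi(1) wo(1)[unfolded img]] by (simp add: pre)
  have "emeasure lebesgue (f ` S) = emeasure (distr lebesgue lebesgue \<iota>) (\<iota> ` (f ` S))"
    using wo(1) unfolding img by (subst emeasure_distr[OF mi(1)]) (simp_all add: pre)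
  also have "\<dots> \<le> (\<integral>\<^sup>+y\<in>S'. ennreal \<bar>det (A' y)\<bar> \<partial>lebesgue)"
    using wo(2) unfolding img di .
  finally show "emeasure lebesgue (f ` S) \<le> (\<integral>\<^sup>+x\<in>S. ennreal \<bar>det (A x)\<bar> \<partial>lebesgue)"
    by (simp add: int_eq)
qed

section \<open>Slopes at upper contact points of semiconvex functions\<close>

text \<open>The condition that puts \<open>x\<close> into the flat upper contact set, for a real-valued function and with
  the slope made explicit.\<close>

definition touches :: "('a::real_inner \<Rightarrow> real) \<Rightarrow> 'a set \<Rightarrow> 'a \<Rightarrow> 'a \<Rightarrow> bool" where
  "touches v \<Omega> x p \<longleftrightarrow> (\<forall>y\<in>\<Omega>. v y \<le> v x + p \<bullet> (y - x))"

text \<open>Semiconvexity at the midpoint \<open>z\<close> of \<open>z + w\<close> and \<open>z - w\<close>, with the upper bound at \<open>z - w\<close>, gives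
  a lower bound at \<open>z + w\<close>. So a contact point carries a quadratic bound from both sides.\<close>

lemma touches_lower_bound:
  fixes v :: "'a::real_inner \<Rightarrow> real"
  assumes conv: "convex_on B (\<lambda>x. v x + l / 2 * (norm x)\<^sup>2)" and "B \<subseteq> \<Omega>"
    and B: "z + w \<in> B" "z - w \<in> B" and p: "touches v \<Omega> z p"
  shows "v z + p \<bullet> w - l * (norm w)\<^sup>2 \<le> v (z + w)"
proof -
  have 1: "2 * (v z + l / 2 * (norm z)\<^sup>2) \<le> v (z + w) + l / 2 * (norm (z + w))\<^sup>2 + (v (z - w) + l / 2 * (norm (z - w))\<^sup>2)"
    by (rule convex_on_midpoint[OF conv B]) (simp add: scaleR_2)
  have 2: "(norm (z + w))\<^sup>2 + (norm (z - w))\<^sup>2 = 2 * (norm z)\<^sup>2 + 2 * (norm w)\<^sup>2"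
    by (simp add: power2_norm_eq_inner inner_add_left inner_add_right inner_diff_left inner_diff_right inner_commute)
  have "z - w \<in> \<Omega>" using B \<open>B \<subseteq> \<Omega>\<close> by blast
  with p have 3: "v (z - w) \<le> v z - p \<bullet> w" by (auto simp: touches_def dest: bspec[of _ _ "z - w"])
  have 4: "l / 2 * (norm (z + w))\<^sup>2 + l / 2 * (norm (z - w))\<^sup>2 = 2 * (l / 2 * (norm z)\<^sup>2) + l * (norm w)\<^sup>2"
    using arg_cong[OF 2, of "\<lambda>t. l / 2 * t"] by (simp add: algebra_simps)
  have "a \<ge> c + s - k" if "2 * (c + e) \<le> a + b1 + (b + b2)" "b \<le> c - s" "b1 + b2 = 2 * e + k"
    for a b c e s k b1 b2 :: real
    using that by argo
  from this[OF 1 3 4] show ?thesis .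
qed

text \<open>Slopes depend on the contact point in a Lipschitz way; for \<open>z = x\<close> this says that the slope is
  unique. The lower bound at \<open>z\<close> is confronted with the upper bound at \<open>x\<close> in the point \<open>z + w\<close>, where
  \<open>w\<close> points in the direction of \<open>p' - p\<close>.\<close>

lemma touches_slope_close:
  fixes v :: "'a::real_inner \<Rightarrow> real"
  assumes conv: "convex_on B (\<lambda>x. v x + l / 2 * (norm x)\<^sup>2)" and "B \<subseteq> \<Omega>" and "l \<ge> 0"
    and B: "ball c (4 * \<rho>) \<subseteq> B" and xz: "x \<in> ball c \<rho>" "z \<in> ball c \<rho>"
    and p: "touches v \<Omega> x p" and p': "touches v \<Omega> z p'"
  shows "norm (p' - p) \<le> 2 * l * norm (z - x)"
proof -
  \<comment> \<open>The length \<open>t\<close> of the test vector stays free: it is \<open>norm (z - x)\<close> in general and tends to 0 if \<open>z = x\<close>.\<close>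
  have main: "norm (p' - p) \<le> 2 * l * t" if t: "norm (z - x) \<le> t" "0 < t" "t < 2 * \<rho>" for t
  proof (cases "p' = p")
    case False
    define w where "w = (t / norm (p' - p)) *\<^sub>R (p' - p)"
    have w: "norm w = t" using False t by (simp add: w_def)
    have inB: "y \<in> B" if "norm (y - c) < 4 * \<rho>" for y
      using that B by (auto simp: subset_eq dist_norm norm_minus_commute)
    have xc: "norm (x - c) < \<rho>" "norm (z - c) < \<rho>" using xz by (auto simp: dist_norm norm_minus_commute)
    have "norm (z + w - c) \<le> norm (z - c) + norm w" using norm_triangle_ineq[of "z - c" w] by (simp add: algebra_simps)
    then have zw1: "z + w \<in> B" using w t xc by (intro inB) linarith
    have "norm (z - w - c) \<le> norm (z - c) + norm w" using norm_triangle_ineq4[of "z - c" w] by (simp add: algebra_simps)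
    then have zw2: "z - w \<in> B" using w t xc by (intro inB) linarith
    have "norm (x - (z - x) - c) \<le> norm (x - c) + norm (z - x)" using norm_triangle_ineq4[of "x - c" "z - x"] by (simp add: algebra_simps)
    then have x1: "x - (z - x) \<in> B" using t xc by (intro inB) linarith
    have x2: "x + (z - x) \<in> B" using xc t by (intro inB) auto
    have a: "v z + p' \<bullet> w - l * (norm w)\<^sup>2 \<le> v (z + w)"
      by (rule touches_lower_bound[OF conv \<open>B \<subseteq> \<Omega>\<close> zw1 zw2 p'])
    have b: "v x + p \<bullet> (z - x) - l * (norm (z - x))\<^sup>2 \<le> v z"
      using touches_lower_bound[OF conv \<open>B \<subseteq> \<Omega>\<close> x2 x1 p] by simp
    have "z + w \<in> \<Omega>" using zw1 \<open>B \<subseteq> \<Omega>\<close> by blast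
    then have c: "v (z + w) \<le> v x + p \<bullet> (z + w - x)" using p by (simp add: touches_def)
    have "(p' - p) \<bullet> w \<le> l * (norm w)\<^sup>2 + l * (norm (z - x))\<^sup>2"
      using a b c by (simp add: inner_diff_left inner_diff_right inner_add_right)
    also have "\<dots> \<le> l * t\<^sup>2 + l * t\<^sup>2"
      using w t \<open>l \<ge> 0\<close> by (intro add_mono mult_left_mono power_mono) auto
    finally have "(p' - p) \<bullet> w \<le> 2 * l * t * t" by (simp add: power2_eq_square)
    moreover have "(p' - p) \<bullet> w = norm (p' - p) * t"
      using False by (simp add: w_def power2_norm_eq_inner[symmetric] power2_eq_square)
    ultimately show ?thesis using t by simp
  qed (use t \<open>l \<ge> 0\<close> in simp)
  have h: "norm (z - x) < 2 * \<rho>"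
    using norm_triangle_ineq4[of "z - c" "x - c"] xz by (simp add: dist_norm norm_minus_commute)
  show ?thesis
  proof (cases "z = x")
    case False then show ?thesis using main[of "norm (z - x)"] h by simp
  next
    case True
    have "norm (p' - p) \<le> 0 + e" if "e > 0" for e
    proof -
      define t where "t = min \<rho> (e / (2 * l + 1))"
      have \<rho>: "\<rho> > 0" using h True by simp
      have t: "0 < t" "t < 2 * \<rho>" using \<rho> \<open>e > 0\<close> \<open>l \<ge> 0\<close> by (auto simp: t_def)
      have "2 * l * t \<le> (2 * l + 1) * t" using t by simp
      also have "\<dots> \<le> (2 * l + 1) * (e / (2 * l + 1))" using \<open>l \<ge> 0\<close> by (intro mult_left_mono) (auto simp: t_def)
      also have "\<dots> = e" using \<open>l \<ge> 0\<close> by simp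
      finally show ?thesis using main[of t] t True by simp
    qed
    then have "norm (p' - p) \<le> 0" by (rule field_le_epsilon)
    then show ?thesis using True by simp
  qed
qed

lemma peano_expansionD:
  assumes "peano_expansion v x q A" "e > 0"
  obtains d where "d > 0" "\<And>y. norm (y - x) < d \<Longrightarrow>
    \<bar>v y - (v x + q \<bullet> (y - x) + 1 / 2 * ((A *v (y - x)) \<bullet> (y - x)))\<bar> \<le> e * (norm (y - x))\<^sup>2"
proof -
  have "eventually (\<lambda>y. norm (v y - (v x + q \<bullet> (y - x) + 1 / 2 * ((A *v (y - x)) \<bullet> (y - x)))) \<le> e * norm ((norm (y - x))\<^sup>2)) (at x)"
    using assms unfolding peano_expansion_def by (auto dest: landau_o.smallD)
  then obtain d where d: "d > 0" "\<And>y. y \<noteq> x \<Longrightarrow> dist y x < d \<Longrightarrow>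
    \<bar>v y - (v x + q \<bullet> (y - x) + 1 / 2 * ((A *v (y - x)) \<bullet> (y - x)))\<bar> \<le> e * (norm (y - x))\<^sup>2"
    unfolding eventually_at by auto
  show thesis
  proof (rule that[OF d(1)])
    fix y assume "norm (y - x) < d"
    then show "\<bar>v y - (v x + q \<bullet> (y - x) + 1 / 2 * ((A *v (y - x)) \<bullet> (y - x)))\<bar> \<le> e * (norm (y - x))\<^sup>2"
      using d(2)[of y] by (cases "y = x") (auto simp: dist_norm)
  qed
qed

lemma symmetric_matrix_inner:
  fixes A :: "real^'n^'n"
  assumes "transpose A = A"
  shows "(A *v z) \<bullet> w = (A *v w) \<bullet> z"
  by (metis assms dot_lmul_matrix inner_commute transpose_matrix_vector)

text \<open>At a contact point where \<open>v\<close> has a Peano expansion, the matrix \<open>A\<close> is also the derivative of the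
  slope map relative to the contact points. With \<open>g = p - q - A (z - x)\<close>, the expansion error changes by
  \<open>g \<bullet> w\<close> up to \<open>O(norm w ^ 2)\<close> when passing from \<open>z\<close> to \<open>z + w\<close>. If the expansion error is at most
  \<open>s\<^sup>2 (norm (y - x))\<^sup>2\<close>, a step of length \<open>s norm (z - x)\<close> balances the terms and bounds \<open>g\<close> by a multiple
  of \<open>s norm (z - x)\<close>.\<close>

lemma touches_slope_peano:
  fixes v :: "real^'n \<Rightarrow> real"
  assumes conv: "convex_on B (\<lambda>x. v x + l / 2 * (norm x)\<^sup>2)" and "B \<subseteq> \<Omega>" and "l \<ge> 0"
    and B: "ball x (4 * \<rho>) \<subseteq> B" "\<rho> > 0" and pe: "peano_expansion v x q A" and "e > 0"
  shows "\<exists>d>0. \<forall>z p. touches v \<Omega> z p \<longrightarrow> norm (z - x) < d \<longrightarrow>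
      norm (p - q - A *v (z - x)) \<le> e * norm (z - x)"
proof -
  have sym: "transpose A = A" using pe by (simp add: peano_expansion_def)
  obtain K where K: "K \<ge> 0" "\<And>w. \<bar>(A *v w) \<bullet> w\<bar> \<le> K * (norm w)\<^sup>2"
  proof -
    obtain K where K: "\<And>w. norm (A *v w) \<le> norm w * K" "K > 0"
      using bounded_linear.pos_bounded[OF matrix_vector_mul_bounded_linear[of A]] by auto
    have "\<bar>(A *v w) \<bullet> w\<bar> \<le> K * (norm w)\<^sup>2" for w
    proof -
      have "\<bar>(A *v w) \<bullet> w\<bar> \<le> norm (A *v w) * norm w" by (rule Cauchy_Schwarz_ineq2)
      also have "\<dots> \<le> (norm w * K) * norm w" by (intro mult_right_mono K) auto
      finally show ?thesis by (simp add: power2_eq_square mult_ac)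
    qed
    then show thesis using that[of K] K(2) by simp
  qed
  define L where "L = 5 + l + K"
  have L: "L > 0" using \<open>l \<ge> 0\<close> K by (simp add: L_def)
  \<comment> \<open>The constant \<open>L\<close> collects the coefficients of the estimate, whose outcome is \<open>s L norm (z - x)\<close>.\<close>
  define s where "s = min 1 (e / L)"
  have s: "0 < s" "s \<le> 1" "s * L \<le> e"
  proof -
    show "0 < s" "s \<le> 1" using \<open>e > 0\<close> L by (auto simp: s_def)
    have "s * L \<le> e / L * L" using L by (intro mult_right_mono) (auto simp: s_def)
    then show "s * L \<le> e" using L by simp
  qed
  obtain d0 where d0: "d0 > 0" "\<And>y. norm (y - x) < d0 \<Longrightarrow>
    \<bar>v y - (v x + q \<bullet> (y - x) + 1 / 2 * ((A *v (y - x)) \<bullet> (y - x)))\<bar> \<le> s\<^sup>2 * (norm (y - x))\<^sup>2"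
    using peano_expansionD[OF pe, of "s\<^sup>2"] s by auto
  define d where "d = min (d0 / 2) \<rho>"
  have d: "d > 0" using d0 B by (simp add: d_def)
  define R where "R = (\<lambda>y. v y - (v x + q \<bullet> (y - x) + 1 / 2 * ((A *v (y - x)) \<bullet> (y - x))))"
  have key: "norm (p - q - A *v (z - x)) * t \<le> s\<^sup>2 * (norm (z - x) + t)\<^sup>2 + s\<^sup>2 * (norm (z - x))\<^sup>2 + (l + K) * t\<^sup>2"
    if p: "touches v \<Omega> z p" and z: "norm (z - x) < d" and t: "0 < t" "t < d" for z p t
  proof (cases "p - q - A *v (z - x) = 0")
    case False
    define g where "g = p - q - A *v (z - x)"
    have g: "norm g > 0" using False by (simp add: g_def)
    define w where "w = (t / norm g) *\<^sub>R g"
    have w: "norm w = t" using g t by (simp add: w_def)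
    have inB: "y \<in> B" if "norm (y - x) < 4 * \<rho>" for y
      using that B by (auto simp: subset_eq dist_norm norm_minus_commute)
    have nzw: "norm (z + w - x) \<le> norm (z - x) + t" using norm_triangle_ineq[of "z - x" w] w by (simp add: algebra_simps)
    have nzw': "norm (z - w - x) \<le> norm (z - x) + t" using norm_triangle_ineq4[of "z - x" w] w by (simp add: algebra_simps)
    have small: "norm (z - x) + t < 4 * \<rho>" "norm (z - x) + t < d0" using z t B unfolding d_def by auto
    have "v z + p \<bullet> w - l * (norm w)\<^sup>2 \<le> v (z + w)"
      using nzw nzw' small by (intro touches_lower_bound[OF conv \<open>B \<subseteq> \<Omega>\<close> _ _ p] inB) linarith+
    then have low: "p \<bullet> w - l * t\<^sup>2 \<le> v (z + w) - v z" by (simp add: w)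
    have "R (z + w) - R z = v (z + w) - v z - q \<bullet> w - (A *v (z - x)) \<bullet> w - 1 / 2 * ((A *v w) \<bullet> w)"
    proof -
      define \<zeta> where "\<zeta> = z - x"
      have \<zeta>: "z + w - x = \<zeta> + w" "z - x = \<zeta>" by (simp_all add: \<zeta>_def)
      show ?thesis
        unfolding R_def \<zeta>
        by (simp add: inner_add_left inner_add_right matrix_vector_right_distrib symmetric_matrix_inner[OF sym, of w \<zeta>] field_simps)
    qed
    then have "g \<bullet> w \<le> R (z + w) - R z + l * t\<^sup>2 + 1 / 2 * ((A *v w) \<bullet> w)"
      using low by (simp add: g_def inner_diff_left)
    also have "\<dots> \<le> s\<^sup>2 * (norm (z - x) + t)\<^sup>2 + s\<^sup>2 * (norm (z - x))\<^sup>2 + l * t\<^sup>2 + K * t\<^sup>2"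
    proof -
      have "\<bar>R (z + w)\<bar> \<le> s\<^sup>2 * (norm (z + w - x))\<^sup>2" unfolding R_def using nzw small by (intro d0(2)) linarith
      also have "\<dots> \<le> s\<^sup>2 * (norm (z - x) + t)\<^sup>2" using nzw by (intro mult_left_mono power_mono) auto
      finally have 1: "\<bar>R (z + w)\<bar> \<le> s\<^sup>2 * (norm (z - x) + t)\<^sup>2" .
      have 2: "\<bar>R z\<bar> \<le> s\<^sup>2 * (norm (z - x))\<^sup>2" unfolding R_def using t small by (intro d0(2)) linarith
      have "1 / 2 * ((A *v w) \<bullet> w) \<le> K * t\<^sup>2" using K(2)[of w] K(1) w by (simp add: abs_le_iff)
      then show ?thesis using 1 2 by linarith
    qed
    also have "g \<bullet> w = norm g * t" using g by (simp add: w_def power2_norm_eq_inner[symmetric] power2_eq_square)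
    finally show ?thesis by (simp add: g_def algebra_simps)
  qed (use \<open>l \<ge> 0\<close> K in simp)
  show ?thesis
  proof (intro exI[of _ d] conjI d allI impI)
    fix z p assume p: "touches v \<Omega> z p" and z: "norm (z - x) < d"
    define h where "h = norm (z - x)"
    show "norm (p - q - A *v (z - x)) \<le> e * norm (z - x)"
    proof (cases "h = 0")
      case False
      then have h: "h > 0" by (simp add: h_def)
      have "s * h \<le> 1 * h" using s h by (intro mult_right_mono) auto
      then have "s * h < d" using z unfolding h_def[symmetric] by simp
      from key[OF p z _ this] have "norm (p - q - A *v (z - x)) * (s * h) \<le> s\<^sup>2 * (h + s * h)\<^sup>2 + s\<^sup>2 * h\<^sup>2 + (l + K) * (s * h)\<^sup>2"
        using s h by (simp add: h_def)
      also have "\<dots> \<le> s\<^sup>2 * (h + h)\<^sup>2 + s\<^sup>2 * h\<^sup>2 + (l + K) * (s * h)\<^sup>2"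
      proof -
        have "h + s * h \<le> h + h" using mult_right_mono[OF s(2), of h] h by simp
        then show ?thesis using s h by (intro add_mono mult_left_mono power_mono order_refl) auto
      qed
      also have "\<dots> = (s * L * h) * (s * h)" by (simp add: L_def power2_eq_square algebra_simps)
      finally have "norm (p - q - A *v (z - x)) * (s * h) \<le> (s * L * h) * (s * h)" .
      then have "norm (p - q - A *v (z - x)) \<le> s * L * h"
        by (rule mult_right_le_imp_le) (use s h in simp)
      also have "\<dots> \<le> e * h" using s h by (intro mult_right_mono) auto
      finally show ?thesis by (simp add: h_def)
    next
      case True
      then have zx: "z = x" by (simp add: h_def)
      have "norm (p - q) \<le> 0 + r" if "r > 0" for r
      proof -
        define t where "t = min (d / 2) (r / L)"
        have t: "0 < t" "t < d" using d L \<open>r > 0\<close> by (auto simp: t_def)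
        have "norm (p - q) * t \<le> s\<^sup>2 * t\<^sup>2 + (l + K) * t\<^sup>2"
          using key[OF p z t] zx by simp
        also have "\<dots> \<le> 1 * t\<^sup>2 + (l + K) * t\<^sup>2"
          using s by (intro add_mono mult_right_mono order_refl) (auto simp: power_le_one)
        also have "\<dots> \<le> L * t\<^sup>2" by (simp add: L_def algebra_simps)
        finally have "norm (p - q) \<le> L * t" using t by (simp add: power2_eq_square)
        also have "\<dots> \<le> L * (r / L)" using L by (intro mult_left_mono) (auto simp: t_def)
        finally show ?thesis using L by simp
      qed
      then have "norm (p - q) \<le> 0" by (rule field_le_epsilon)
      then show ?thesis using zx by simp
    qed
  qed
qed

lemma semiconvex_peano:
  fixes v :: "real^'n \<Rightarrow> real"
  assumes "peano_expansion (\<lambda>x. v x + l / 2 * (norm x)\<^sup>2) x q A"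
  shows "peano_expansion v x (q - l *\<^sub>R x) (A - l *\<^sub>R mat 1)"
proof -
  have "transpose (A - l *\<^sub>R mat 1) = A - l *\<^sub>R mat 1"
    using assms by (simp add: peano_expansion_def transpose_def vec_eq_iff mat_def)
  moreover have "v y - (v x + (q - l *\<^sub>R x) \<bullet> (y - x) + 1 / 2 * (((A - l *\<^sub>R mat 1) *v (y - x)) \<bullet> (y - x)))
     = v y + l / 2 * (norm y)\<^sup>2 - (v x + l / 2 * (norm x)\<^sup>2 + q \<bullet> (y - x) + 1 / 2 * ((A *v (y - x)) \<bullet> (y - x)))" for y
  proof -
    define d where "d = y - x"
    have d: "y - x = d" by (simp add: d_def)
    have 1: "(A - l *\<^sub>R mat 1) *v d = A *v d - l *\<^sub>R d"
    proof -
      have "(A - l *\<^sub>R mat 1) *v d = A *v d - (l *\<^sub>R mat 1) *v d" by (rule matrix_vector_mult_diff_rdistrib)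
      also have "(l *\<^sub>R mat 1) *v d = l *\<^sub>R d" by (simp only: scaleR_matrix_vector_assoc[symmetric] matrix_vector_mul_lid)
      finally show ?thesis .
    qed
    have "(norm (x + d))\<^sup>2 = (norm x)\<^sup>2 + 2 * (x \<bullet> d) + d \<bullet> d"
      by (simp add: power2_norm_eq_inner inner_add_left inner_add_right inner_commute)
    then have 2: "(norm y)\<^sup>2 = (norm x)\<^sup>2 + 2 * (x \<bullet> d) + d \<bullet> d" by (simp add: d_def)
    show ?thesis unfolding d 1 2 by (simp add: inner_diff_left field_simps)
  qed
  ultimately show ?thesis using assms unfolding peano_expansion_def by (simp only:)
qed

section \<open>The maximum principle\<close>

lemma locally_semiconvex_ball:
  fixes u :: "'a::real_inner \<Rightarrow> ereal"
  assumes "locally_semiconvex_on \<Omega> u" "x \<in> \<Omega>"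
  shows "\<exists>l \<rho>. l \<ge> 0 \<and> \<rho> > 0 \<and> ball x (4 * \<rho>) \<subseteq> \<Omega> \<and>
    convex_on (ball x (4 * \<rho>)) (\<lambda>y. real_of_ereal (u y) + l / 2 * (norm y)\<^sup>2) \<and>
    (\<forall>y\<in>ball x (4 * \<rho>). \<bar>u y\<bar> \<noteq> \<infinity>)"
proof -
  obtain z r l where z: "x \<in> ball z r" "ball z r \<subseteq> \<Omega>" "l \<ge> 0" "semiconvex_on l (ball z r) u"
    using assms unfolding locally_semiconvex_on_def by blast
  obtain e where e: "e > 0" "ball x e \<subseteq> ball z r"
    using z(1) open_ball[of z r] by (meson open_contains_ball)
  have sub: "ball x (4 * (e / 4)) \<subseteq> ball z r" using e by simp
  have "\<forall>y\<in>ball x (4 * (e / 4)). \<bar>u y\<bar> \<noteq> \<infinity>"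
    using z(4) sub unfolding semiconvex_on_def by (meson subsetD)
  moreover have "convex_on (ball x (4 * (e / 4))) (\<lambda>y. real_of_ereal (u y) + l / 2 * (norm y)\<^sup>2)"
    using z(4) unfolding semiconvex_on_def by (intro convex_on_subset[OF _ sub]) auto
  ultimately show ?thesis
    using z(2,3) e sub by (intro exI[of _ l] exI[of _ "e / 4"] conjI) auto
qed

lemma locally_semiconvex_finite:
  fixes u :: "'a::real_inner \<Rightarrow> ereal"
  assumes "locally_semiconvex_on \<Omega> u" "x \<in> \<Omega>"
  shows "u x = ereal (real_of_ereal (u x))"
proof -
  obtain \<rho> where "\<rho> > 0" "\<forall>y\<in>ball x (4 * \<rho>). \<bar>u y\<bar> \<noteq> \<infinity>"
    using locally_semiconvex_ball[OF assms] by blast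
  then have "\<bar>u x\<bar> \<noteq> \<infinity>" by simp
  then show ?thesis by (simp add: ereal_real)
qed

lemma locally_semiconvex_continuous:
  fixes u :: "'a::euclidean_space \<Rightarrow> ereal"
  assumes "locally_semiconvex_on \<Omega> u" "open \<Omega>"
  shows "continuous_on \<Omega> (\<lambda>x. real_of_ereal (u x))"
proof -
  have "isCont (\<lambda>x. real_of_ereal (u x)) x" if x: "x \<in> \<Omega>" for x
  proof -
    obtain l \<rho> where \<rho>: "\<rho> > 0" "convex_on (ball x (4 * \<rho>)) (\<lambda>y. real_of_ereal (u y) + l / 2 * (norm y)\<^sup>2)"
      using locally_semiconvex_ball[OF assms(1) x] by blast
    have "continuous_on (ball x (4 * \<rho>)) (\<lambda>y. real_of_ereal (u y) + l / 2 * (norm y)\<^sup>2)"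
      by (rule convex_on_continuous[OF open_ball \<rho>(2)])
    moreover have "continuous_on (ball x (4 * \<rho>)) (\<lambda>y. l / 2 * (norm y)\<^sup>2)"
      by (intro continuous_intros)
    ultimately have "continuous_on (ball x (4 * \<rho>)) (\<lambda>y. (real_of_ereal (u y) + l / 2 * (norm y)\<^sup>2) - l / 2 * (norm y)\<^sup>2)"
      by (rule continuous_on_diff)
    then have "continuous_on (ball x (4 * \<rho>)) (\<lambda>y. real_of_ereal (u y))" by simp
    then show ?thesis using \<rho>(1) by (simp add: continuous_on_eq_continuous_at)
  qed
  then show ?thesis by (simp add: continuous_at_imp_continuous_on)
qed

text \<open>Locally \<open>u\<close> differs from a convex function by a quadratic polynomial.\<close>

theorem alexandrov_locally_semiconvex:
  fixes u :: "real^'n \<Rightarrow> ereal"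
  assumes sc: "locally_semiconvex_on \<Omega> u" and "open \<Omega>"
  shows "negligible (\<Omega> - Diff2 \<Omega> u)"
proof (rule iffD2[OF locally_negligible_alt], rule ballI)
  fix x assume x: "x \<in> \<Omega> - Diff2 \<Omega> u"
  then have "x \<in> \<Omega>" by blast
  obtain l \<rho> where "l \<ge> 0" and \<rho>: "\<rho> > 0" "ball x (4 * \<rho>) \<subseteq> \<Omega>"
    "convex_on (ball x (4 * \<rho>)) (\<lambda>y. real_of_ereal (u y) + l / 2 * (norm y)\<^sup>2)"
    "\<forall>y\<in>ball x (4 * \<rho>). \<bar>u y\<bar> \<noteq> \<infinity>"
    using locally_semiconvex_ball[OF sc \<open>x \<in> \<Omega>\<close>] by blast
  let ?B = "ball x (4 * \<rho>)"
  have "negligible {y \<in> ?B. \<not> (\<exists>b A. peano_expansion (\<lambda>y. real_of_ereal (u y) + l / 2 * (norm y)\<^sup>2) y b A)}"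
    by (rule alexandrov_convex[OF \<rho>(3) open_ball])
  moreover have "?B \<inter> (\<Omega> - Diff2 \<Omega> u) \<subseteq> {y \<in> ?B. \<not> (\<exists>b A. peano_expansion (\<lambda>y. real_of_ereal (u y) + l / 2 * (norm y)\<^sup>2) y b A)}"
  proof (intro subsetI CollectI conjI notI)
    fix y assume y: "y \<in> ?B \<inter> (\<Omega> - Diff2 \<Omega> u)"
    then show "y \<in> ?B" by blast
    assume "\<exists>b A. peano_expansion (\<lambda>y. real_of_ereal (u y) + l / 2 * (norm y)\<^sup>2) y b A"
    then obtain b A where "peano_expansion (\<lambda>y. real_of_ereal (u y) + l / 2 * (norm y)\<^sup>2) y b A" by blast
    from semiconvex_peano[OF this] have "\<exists>q A. peano_expansion (\<lambda>y. real_of_ereal (u y)) y q A" by blast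
    moreover have "eventually (\<lambda>y. y \<in> ?B) (nhds y)" using y by (intro eventually_nhds_in_open) auto
    then have "eventually (\<lambda>y. \<bar>u y\<bar> \<noteq> \<infinity>) (nhds y)" by eventually_elim (rule bspec[OF \<rho>(4)])
    ultimately show False using y unfolding Diff2_def by blast
  qed
  ultimately have "negligible (?B \<inter> (\<Omega> - Diff2 \<Omega> u))" by (rule negligible_subset)
  moreover have "openin (top_of_set (\<Omega> - Diff2 \<Omega> u)) (?B \<inter> (\<Omega> - Diff2 \<Omega> u))"
    by (metis Int_commute open_ball openin_open)
  ultimately show "\<exists>U. openin (top_of_set (\<Omega> - Diff2 \<Omega> u)) U \<and> x \<in> U \<and> negligible U"
    using x \<rho>(1) by (intro exI[of _ "?B \<inter> (\<Omega> - Diff2 \<Omega> u)"]) auto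
qed

text \<open>Slopes in a ball form a compact set, so the contact set is relatively closed in \<open>\<Omega>\<close>.\<close>

lemma contact_set_borel:
  fixes v :: "'a::euclidean_space \<Rightarrow> real"
  assumes "open \<Omega>" and cont: "continuous_on \<Omega> v"
  shows "{x \<in> \<Omega>. \<exists>p\<in>cball 0 \<delta>. touches v \<Omega> x p} \<in> sets borel" (is "?C \<in> _")
proof -
  have "closure ?C \<inter> \<Omega> \<subseteq> ?C"
  proof
    fix x assume x: "x \<in> closure ?C \<inter> \<Omega>"
    then have "x \<in> closure ?C" by blast
    then obtain X where X: "\<And>k. X k \<in> ?C" "X \<longlonglongrightarrow> x" unfolding closure_sequential by blast
    from X(1) have "\<forall>k. \<exists>p. p \<in> cball 0 \<delta> \<and> touches v \<Omega> (X k) p" by blast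
    then obtain p where p: "\<And>k. p k \<in> cball 0 \<delta>" "\<And>k. touches v \<Omega> (X k) (p k)" by metis
    obtain p0 \<sigma> where \<sigma>: "p0 \<in> cball 0 \<delta>" "strict_mono (\<sigma> :: nat \<Rightarrow> nat)" "(p \<circ> \<sigma>) \<longlonglongrightarrow> p0"
      using compact_cball[of "0::'a" \<delta>] p(1) unfolding compact_def by metis
    have X\<sigma>: "(\<lambda>k. X (\<sigma> k)) \<longlonglongrightarrow> x" using LIMSEQ_subseq_LIMSEQ[OF X(2) \<sigma>(2)] by (simp add: o_def)
    have p\<sigma>: "(\<lambda>k. p (\<sigma> k)) \<longlonglongrightarrow> p0" using \<sigma>(3) by (simp add: o_def)
    have "isCont v x" using cont x \<open>open \<Omega>\<close> by (simp add: continuous_on_eq_continuous_at)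
    then have v: "(\<lambda>k. v (X (\<sigma> k))) \<longlonglongrightarrow> v x" using X\<sigma> by (rule isCont_tendsto_compose)
    have "v y \<le> v x + p0 \<bullet> (y - x)" if "y \<in> \<Omega>" for y
    proof (rule LIMSEQ_le_const)
      show "(\<lambda>k. v (X (\<sigma> k)) + p (\<sigma> k) \<bullet> (y - X (\<sigma> k))) \<longlonglongrightarrow> v x + p0 \<bullet> (y - x)"
        by (intro tendsto_intros v p\<sigma> X\<sigma>)
      show "\<exists>N. \<forall>n\<ge>N. v y \<le> v (X (\<sigma> n)) + p (\<sigma> n) \<bullet> (y - X (\<sigma> n))"
        using p(2) that unfolding touches_def by blast
    qed
    then show "x \<in> ?C" using x \<sigma>(1) unfolding touches_def by blast
  qed
  moreover have "?C \<subseteq> closure ?C \<inter> \<Omega>" using closure_subset[of ?C] by blast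
  ultimately have eq: "closure ?C \<inter> \<Omega> = ?C" by (rule subset_antisym)
  have "closure ?C \<inter> \<Omega> \<in> sets borel"
    by (intro sets.Int borel_closed borel_open closed_closure \<open>open \<Omega>\<close>)
  then show ?thesis unfolding eq .
qed

text \<open>The slope map sends the contact set onto the ball. Contact points outside \<open>Diff2 \<Omega> u\<close> form a null
  set, whose image is null because the slope map is locally Lipschitz; on the remaining ones the area
  inequality applies with derivative \<open>D2 u\<close>.\<close>

theorem contact_slopes_measure:
  fixes u :: "real^'n \<Rightarrow> ereal"
  assumes sc: "locally_semiconvex_on \<Omega> u" and op: "open \<Omega>"
    and all: "\<And>p. p \<in> cball 0 \<delta> \<Longrightarrow> \<exists>x\<in>\<Omega>. touches (\<lambda>x. real_of_ereal (u x)) \<Omega> x p"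
  shows "emeasure lebesgue (cball (0::real^'n) \<delta>) \<le>
     (\<integral>\<^sup>+x\<in>(flat_upper_contact \<Omega> u \<inter> Diff2 \<Omega> u). ennreal \<bar>det (D2 u x)\<bar> \<partial>lebesgue)"
    (is "_ \<le> ?I")
proof (cases "?I = \<infinity>")
  case False
  define v where "v = (\<lambda>x. real_of_ereal (u x))"
  define C where "C = {x \<in> \<Omega>. \<exists>p\<in>cball 0 \<delta>. touches v \<Omega> x p}"
  define P where "P = (\<lambda>x. SOME p. p \<in> cball 0 \<delta> \<and> touches v \<Omega> x p)"
  have fin: "u x = ereal (v x)" if "x \<in> \<Omega>" for x
    unfolding v_def by (rule locally_semiconvex_finite[OF sc that])
  have P: "touches v \<Omega> x (P x)" if "x \<in> C" for x
    using that unfolding C_def P_def by (intro someI2_ex[where Q = "\<lambda>p. touches v \<Omega> x p"]) auto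
  have lip: "\<exists>l \<rho>. l \<ge> 0 \<and> \<rho> > 0 \<and> ball x (4 * \<rho>) \<subseteq> \<Omega> \<and> convex_on (ball x (4 * \<rho>)) (\<lambda>y. v y + l / 2 * (norm y)\<^sup>2)"
    if x: "x \<in> \<Omega>" for x
    using locally_semiconvex_ball[OF sc x] unfolding v_def by blast
  have unique: "p = P x" if "x \<in> C" "touches v \<Omega> x p" for x p
  proof -
    have "x \<in> \<Omega>" using that by (simp add: C_def)
    from lip[OF this] obtain l \<rho> where l: "l \<ge> 0" "\<rho> > 0" "ball x (4 * \<rho>) \<subseteq> \<Omega>"
      "convex_on (ball x (4 * \<rho>)) (\<lambda>y. v y + l / 2 * (norm y)\<^sup>2)" by blast
    have "norm (p - P x) \<le> 2 * l * norm (x - x)"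
      by (rule touches_slope_close[OF l(4,3,1) order_refl _ _ P[OF that(1)] that(2)]) (use l in auto)
    then show ?thesis by simp
  qed
  have cov: "cball 0 \<delta> \<subseteq> P ` C"
  proof
    fix p :: "real^'n" assume p: "p \<in> cball 0 \<delta>"
    from all[OF this] obtain x where x: "x \<in> \<Omega>" "touches v \<Omega> x p" unfolding v_def by blast
    then have "x \<in> C" using p unfolding C_def by blast
    then show "p \<in> P ` C" using unique[OF _ x(2)] by blast
  qed
  define S where "S = C \<inter> Diff2 \<Omega> u"
  define N where "N = C - Diff2 \<Omega> u"
  have Cm: "C \<in> sets lebesgue"
    using contact_set_borel[OF op locally_semiconvex_continuous[OF sc op]] unfolding C_def v_def
    by (intro sets_completionI_sets) simp
  have Nn: "negligible N"
    by (rule negligible_subset[OF alexandrov_locally_semiconvex[OF sc op]]) (auto simp: N_def C_def)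
  have "S = C - N" unfolding S_def N_def by blast
  then have Sm: "S \<in> sets lebesgue"
    using Cm negligible_imp_sets[OF Nn] by simp
  have "negligible (P ` N)"
  proof (rule negligible_locally_Lipschitz_image)
    fix x assume x: "x \<in> N"
    then have "x \<in> \<Omega>" by (simp add: N_def C_def)
    from lip[OF this] obtain l \<rho> where l: "l \<ge> 0" "\<rho> > 0" "ball x (4 * \<rho>) \<subseteq> \<Omega>"
      "convex_on (ball x (4 * \<rho>)) (\<lambda>y. v y + l / 2 * (norm y)\<^sup>2)" by blast
    have "norm (P y - P x) \<le> 2 * l * norm (y - x)" if y: "y \<in> N \<inter> ball x \<rho>" for y
      by (rule touches_slope_close[OF l(4,3,1) order_refl, of x y]) (use l x y P in \<open>auto simp: N_def\<close>)
    then show "\<exists>T B. open T \<and> x \<in> T \<and> (\<forall>y\<in>N \<inter> T. norm (P y - P x) \<le> B * norm (y - x))"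
      using l(2) by (intro exI[of _ "ball x \<rho>"] exI[of _ "2 * l"]) auto
  qed (use Nn in auto)
  have der: "(P has_derivative (\<lambda>w. D2 u x *v w)) (at x within S)" if x: "x \<in> S" for x
  proof -
    from x obtain q A where pe: "peano_expansion v x q A" unfolding S_def Diff2_def v_def by blast
    then have D2: "D2 u x = A" unfolding D2_def v_def by (rule peano_hessian_eq)
    have "x \<in> C" "x \<in> \<Omega>" using x by (auto simp: S_def C_def)
    from lip[OF this(2)] obtain l \<rho> where l: "l \<ge> 0" "\<rho> > 0" "ball x (4 * \<rho>) \<subseteq> \<Omega>"
      "convex_on (ball x (4 * \<rho>)) (\<lambda>y. v y + l / 2 * (norm y)\<^sup>2)" by blast
    have Pq: "P x = q"
    proof -
      obtain d where "d > 0" "\<And>z p. touches v \<Omega> z p \<Longrightarrow> norm (z - x) < d \<Longrightarrow> norm (p - q - A *v (z - x)) \<le> 1 * norm (z - x)"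
        using touches_slope_peano[OF l(4,3,1) order_refl l(2) pe zero_less_one] by blast
      from this(2)[OF P[OF \<open>x \<in> C\<close>]] this(1) show ?thesis by simp
    qed
    show ?thesis
      unfolding D2 has_derivative_within_alt
    proof (intro conjI allI impI)
      show "bounded_linear (\<lambda>w. A *v w)" by (rule matrix_vector_mul_bounded_linear)
      fix e :: real assume "e > 0"
      obtain d where d: "d > 0" "\<And>z p. touches v \<Omega> z p \<Longrightarrow> norm (z - x) < d \<Longrightarrow> norm (p - q - A *v (z - x)) \<le> e * norm (z - x)"
        using touches_slope_peano[OF l(4,3,1) order_refl l(2) pe \<open>e > 0\<close>] by blast
      show "\<exists>d>0. \<forall>y\<in>S. norm (y - x) < d \<longrightarrow> norm (P y - P x - A *v (y - x)) \<le> e * norm (y - x)"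
      proof (intro exI conjI ballI impI)
        fix y assume "y \<in> S" "norm (y - x) < d"
        then show "norm (P y - P x - A *v (y - x)) \<le> e * norm (y - x)"
          using d(2)[of y "P y"] P[of y] by (simp add: Pq S_def)
      qed (rule d(1))
    qed
  qed
  have sub: "S \<subseteq> flat_upper_contact \<Omega> u \<inter> Diff2 \<Omega> u"
  proof
    fix x assume x: "x \<in> S"
    then have xC: "x \<in> C" "x \<in> \<Omega>" by (auto simp: S_def C_def)
    have "u y \<le> u x + ereal (P x \<bullet> (y - x))" if "y \<in> \<Omega>" for y
      using P[OF xC(1)] that fin[OF that] fin[OF xC(2)] by (simp add: touches_def)
    then have "x \<in> flat_upper_contact \<Omega> u" using xC(2) unfolding flat_upper_contact_def by blast
    then show "x \<in> flat_upper_contact \<Omega> u \<inter> Diff2 \<Omega> u" using x by (simp add: S_def)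
  qed
  have le: "(\<integral>\<^sup>+x\<in>S. ennreal \<bar>det (D2 u x)\<bar> \<partial>lebesgue) \<le> ?I"
    using sub by (intro nn_integral_mono) (auto simp: indicator_def)
  then have fin_int: "(\<integral>\<^sup>+x\<in>S. ennreal \<bar>det (D2 u x)\<bar> \<partial>lebesgue) < \<infinity>"
    using False by (simp add: less_top[symmetric] top_unique order.strict_iff_order) (metis le top_unique)
  note area = area_inequality[OF Sm der fin_int]
  have "cball 0 \<delta> \<subseteq> P ` S \<union> P ` N" using cov unfolding S_def N_def by blast
  then have "emeasure lebesgue (cball (0::real^'n) \<delta>) \<le> emeasure lebesgue (P ` S \<union> P ` N)"
    using area(1) negligible_imp_sets[OF \<open>negligible (P ` N)\<close>] by (intro emeasure_mono) auto
  also have "\<dots> = emeasure lebesgue (P ` S)"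
    using area(1) \<open>negligible (P ` N)\<close> by (intro emeasure_Un_null_set) (auto simp: negligible_iff_null_sets)
  also have "\<dots> \<le> (\<integral>\<^sup>+x\<in>S. ennreal \<bar>det (D2 u x)\<bar> \<partial>lebesgue)" by (rule area(2))
  also note le
  finally show ?thesis .
qed simp

text \<open>An upper tangent of slope \<open>p\<close> touches at a maximum point of \<open>u - p \<bullet> x\<close>. Tilting by \<open>p\<close> changes
  values by at most \<open>\<delta>\<close> times the diameter, so such a maximum is taken on the superlevel set \<open>K\<close>. By upper
  semicontinuity \<open>K\<close> is compact, by the assumed gap it avoids the boundary, and on it \<open>u\<close> is finite and
  continuous.\<close>

lemma contact_point_exists:
  fixes u :: "real^'n \<Rightarrow> ereal"
  assumes sc: "locally_semiconvex_on \<Omega> u" and op: "open \<Omega>" and bd: "bounded \<Omega>" and usc: "u \<in> USC (closure \<Omega>)"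
    and x0: "x0 \<in> \<Omega>" and gap: "\<And>y. y \<in> frontier \<Omega> \<Longrightarrow> u y + ereal (\<delta> * diameter \<Omega>) < u x0"
    and p: "norm p \<le> \<delta>"
  shows "\<exists>x\<in>\<Omega>. touches (\<lambda>x. real_of_ereal (u x)) \<Omega> x p"
proof -
  define v where "v = (\<lambda>x. real_of_ereal (u x))"
  define c where "c = v x0 - \<delta> * diameter \<Omega>"
  have \<delta>: "\<delta> \<ge> 0" using p norm_ge_zero[of p] by linarith
  have D: "diameter \<Omega> \<ge> 0" by (rule diameter_ge_0[OF bd])
  have fin: "u x = ereal (v x)" if "x \<in> \<Omega>" for x
    unfolding v_def by (rule locally_semiconvex_finite[OF sc that])
  define K where "K = {x \<in> closure \<Omega>. ereal c \<le> u x}"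
  have "closed K"
    unfolding closed_limpt
  proof (intro allI impI)
    fix x assume x: "x islimpt K"
    then have "x islimpt closure \<Omega>" by (rule islimpt_subset) (auto simp: K_def)
    then have xcl: "x \<in> closure \<Omega>" using closed_limpt by blast
    show "x \<in> K"
    proof (rule ccontr)
      assume "x \<notin> K"
      then have "u x < ereal c" using xcl by (auto simp: K_def not_le)
      then have "eventually (\<lambda>y. u y < ereal c) (at x within closure \<Omega>)"
        using usc xcl unfolding USC_def by blast
      then obtain d where "d > 0" "\<And>y. y \<in> closure \<Omega> \<Longrightarrow> y \<noteq> x \<Longrightarrow> dist y x < d \<Longrightarrow> u y < ereal c"
        unfolding eventually_at by blast
      moreover from x \<open>d > 0\<close> obtain y where "y \<in> K" "y \<noteq> x" "dist y x < d" unfolding islimpt_approachable by blast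
      ultimately show False by (auto simp: K_def not_le[symmetric])
    qed
  qed
  moreover have "bounded K" by (rule bounded_subset[OF bounded_closure[OF bd]]) (auto simp: K_def)
  ultimately have "compact K" by (simp add: compact_eq_bounded_closed)
  have KO: "K \<subseteq> \<Omega>"
  proof
    fix x assume x: "x \<in> K"
    show "x \<in> \<Omega>"
    proof (rule ccontr)
      assume "x \<notin> \<Omega>"
      then have "x \<in> frontier \<Omega>" using x op by (simp add: K_def frontier_def interior_open)
      from gap[OF this] have "u x + ereal (\<delta> * diameter \<Omega>) < ereal (v x0)" using fin[OF x0] by simp
      moreover have "ereal c \<le> u x" using x by (simp add: K_def)
      ultimately show False by (cases "u x") (auto simp: c_def)
    qed
  qed
  have "x0 \<in> K" using x0 \<delta> D fin[OF x0] closure_subset[of \<Omega>] by (auto simp: K_def c_def)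
  have "continuous_on K (\<lambda>x. v x - p \<bullet> x)"
    unfolding v_def by (intro continuous_intros continuous_on_subset[OF locally_semiconvex_continuous[OF sc op] KO])
  moreover have "K \<noteq> {}" using \<open>x0 \<in> K\<close> by blast
  ultimately have "\<exists>x\<in>K. \<forall>y\<in>K. v y - p \<bullet> y \<le> v x - p \<bullet> x"
    by (intro continuous_attains_sup \<open>compact K\<close>)
  then obtain x1 where x1: "x1 \<in> K" "\<And>y. y \<in> K \<Longrightarrow> v y - p \<bullet> y \<le> v x1 - p \<bullet> x1" by blast
  have "v y \<le> v x1 + p \<bullet> (y - x1)" if y: "y \<in> \<Omega>" for y
  proof (cases "y \<in> K")
    case True
    then show ?thesis using x1(2)[OF True] by (simp add: inner_diff_right)
  next
    case False
    then have "v y < c" using y fin[OF y] closure_subset[of \<Omega>] by (auto simp: K_def)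
    moreover have "p \<bullet> (x0 - y) \<le> \<delta> * diameter \<Omega>"
    proof -
      have "p \<bullet> (x0 - y) \<le> norm p * norm (x0 - y)" by (rule norm_cauchy_schwarz)
      also have "\<dots> \<le> \<delta> * diameter \<Omega>"
        using p \<delta> diameter_bounded_bound[OF bd x0 y] by (intro mult_mono) (auto simp: dist_norm)
      finally show ?thesis .
    qed
    ultimately show ?thesis using x1(2)[OF \<open>x0 \<in> K\<close>] by (simp add: inner_diff_right c_def)
  qed
  then show ?thesis using x1(1) KO unfolding touches_def v_def by blast
qed

lemma diameter_open_pos:
  fixes \<Omega> :: "'a::euclidean_space set"
  assumes "open \<Omega>" "bounded \<Omega>" "x \<in> \<Omega>"
  shows "diameter \<Omega> > 0"
proof -
  obtain r where r: "r > 0" "ball x r \<subseteq> \<Omega>" using assms by (meson open_contains_ball)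
  obtain b :: 'a where b: "b \<in> Basis" using nonempty_Basis by blast
  have "x + (r / 2) *\<^sub>R b \<in> \<Omega>" using r b by (auto simp: subset_eq dist_norm)
  from diameter_bounded_bound[OF assms(2,3) this] have "r / 2 \<le> diameter \<Omega>" using r b by (simp add: dist_norm)
  then show ?thesis using r by linarith
qed

theorem theorem3p35:
  fixes \<Omega> :: "(real^'n) set" and u :: "real^'n \<Rightarrow> ereal"
  assumes "open \<Omega>" and "bounded \<Omega>"
    and "u \<in> USC (closure \<Omega>)"
    and "locally_semiconvex_on \<Omega> u"
  shows "(SUP x\<in>closure \<Omega>. u x) \<le>
           (SUP x\<in>frontier \<Omega>. u x) +
           ereal (diameter \<Omega> / root CARD('n) (measure lebesgue (ball (0::real^'n) 1))) *
           enn2ereal (ennreal_root CARD('n)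
             (\<integral>\<^sup>+x\<in>(flat_upper_contact \<Omega> u \<inter> Diff2 \<Omega> u). ennreal \<bar>det (D2 u x)\<bar> \<partial>lebesgue))"
proof -
  let ?n = "CARD('n)"
  let ?D = "diameter \<Omega>"
  define s where "s = (SUP x\<in>frontier \<Omega>. u x)"
  define \<omega> where "\<omega> = measure lebesgue (ball (0::real^'n) 1)"
  define I where "I = (\<integral>\<^sup>+x\<in>(flat_upper_contact \<Omega> u \<inter> Diff2 \<Omega> u). ennreal \<bar>det (D2 u x)\<bar> \<partial>lebesgue)"
  define T where "T = ereal (?D / root ?n \<omega>) * enn2ereal (ennreal_root ?n I)"
  have \<omega>_vol: "\<omega> = unit_ball_vol ?n" by (simp add: \<omega>_def content_ball)
  have \<omega>: "\<omega> > 0" unfolding \<omega>_vol by simp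
  have n: "?n > 0" by simp
  have "?D \<ge> 0" by (rule diameter_ge_0) fact
  then have T0: "T \<ge> 0" unfolding T_def using \<omega> n by (intro ereal_0_le_mult) auto
  have "u x0 \<le> s + T" if x0: "x0 \<in> closure \<Omega>" for x0
  proof (cases "x0 \<in> \<Omega>")
    case False
    then have "x0 \<in> frontier \<Omega>" using x0 \<open>open \<Omega>\<close> by (simp add: frontier_def interior_open)
    then have "u x0 \<le> s" unfolding s_def by (rule SUP_upper)
    also have "s \<le> s + T" using T0 by (simp add: ereal_le_add_self)
    finally show ?thesis .
  next
    case True
    define M where "M = real_of_ereal (u x0)"
    have M: "u x0 = ereal M" unfolding M_def by (rule locally_semiconvex_finite[OF assms(4) True])
    have D: "?D > 0" by (rule diameter_open_pos[OF assms(1,2) True])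
    show ?thesis
    proof (rule ccontr)
      assume "\<not> u x0 \<le> s + T"
      then have lt: "s + T < ereal M" by (simp add: M not_le)
      have "I \<noteq> \<infinity>"
      proof
        \<comment> \<open>Here the diameter must be positive, since \<open>0 * \<infinity> = 0\<close>.\<close>
        assume "I = \<infinity>"
        then have "T = \<infinity>" using D \<omega> n by (simp add: T_def ennreal_root_def)
        with lt show False by simp
      qed
      then obtain i where i: "I = ennreal i" "i \<ge> 0" by (cases I) auto
      define j where "j = ?D / root ?n \<omega> * root ?n i"
      have T: "T = ereal j"
        using i n by (simp add: T_def ennreal_root_def j_def enn2ereal_ennreal)
      have j0: "j \<ge> 0" using T0 T by simp
      \<comment> \<open>A radius of slopes too large for the integral; if \<open>u\<close> is \<open>-\<infinity>\<close> on the boundary, every radius is available.\<close>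
      obtain \<delta> where \<delta>: "j < \<delta> * ?D" "s + ereal (\<delta> * ?D) < ereal M"
      proof (cases s)
        case (real s')
        have "s' + j < M" using lt T real by simp
        have eq: "(j + (M - s')) / 2 / ?D * ?D = (j + (M - s')) / 2" using D by simp
        show thesis
        proof (rule that[of "(j + (M - s')) / 2 / ?D"])
          show "j < (j + (M - s')) / 2 / ?D * ?D" unfolding eq using \<open>s' + j < M\<close> by simp
          show "s + ereal ((j + (M - s')) / 2 / ?D * ?D) < ereal M"
            unfolding eq using \<open>s' + j < M\<close> by (simp add: real field_simps)
        qed
      next
        case PInf
        then show thesis using lt by simp
      next
        case MInf
        then show thesis using D by (intro that[of "(j + 1) / ?D"]) auto
      qed
      have "0 < \<delta> * ?D" using j0 \<delta>(1) by linarith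
      then have \<delta>0: "\<delta> > 0" using D by (simp add: zero_less_mult_iff)
      have "emeasure lebesgue (cball (0::real^'n) \<delta>) \<le> I"
        unfolding I_def
      proof (rule contact_slopes_measure[OF assms(4,1)])
        fix p :: "real^'n" assume "p \<in> cball 0 \<delta>"
        then have p: "norm p \<le> \<delta>" by simp
        show "\<exists>x\<in>\<Omega>. touches (\<lambda>x. real_of_ereal (u x)) \<Omega> x p"
        proof (rule contact_point_exists[OF assms(4,1,2,3) True _ p])
          fix y assume "y \<in> frontier \<Omega>"
          then have "u y \<le> s" unfolding s_def by (rule SUP_upper)
          then have "u y + ereal (\<delta> * ?D) \<le> s + ereal (\<delta> * ?D)" by (rule add_right_mono)
          also have "\<dots> < u x0" using \<delta>(2) M by simp
          finally show "u y + ereal (\<delta> * ?D) < u x0" .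
        qed
      qed
      moreover have "emeasure lebesgue (cball (0::real^'n) \<delta>) = ennreal (\<omega> * \<delta> ^ ?n)"
        using \<delta>0 by (simp add: emeasure_cball \<omega>_vol)
      ultimately have "\<omega> * \<delta> ^ ?n \<le> i" using i by simp
      then have "root ?n (\<omega> * \<delta> ^ ?n) \<le> root ?n i" using n by simp
      then have "root ?n \<omega> * \<delta> \<le> root ?n i" using n \<delta>0 by (simp add: real_root_mult real_root_power_cancel)
      then have "\<delta> \<le> root ?n i / root ?n \<omega>" using \<omega> n by (simp add: pos_le_divide_eq mult.commute)
      then have "\<delta> * ?D \<le> j" using mult_right_mono[of \<delta> "root ?n i / root ?n \<omega>" ?D] D by (simp add: j_def mult_ac)
      then show False using \<delta>(1) by simp
    qed
  qed
  then have "(SUP x\<in>closure \<Omega>. u x) \<le> s + T" by (rule SUP_least)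
  then show ?thesis unfolding s_def T_def \<omega>_def I_def .
qed

end
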